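(* Let $p\ge 1$ and $q\ge 1$ be integers with $\gcd(p,q)=1$. Then the Seifert foliation $S_{p,q}$ of $\mathbb{S}^3$ is isotopic to the foliation defined by a non-vanishing, real-analytic, divergence-free vector field $X$ on $\mathbb{S}^3$ that is Legendrian with respect to the standard contact structure.
   Context: $\mathbb{S}^3=\{(z_1,z_2)\in\mathbb{C}^2:|z_1|^2+|z_2|^2=1\}$, $z_j=x_j+\mathrm{i}y_j$, with its standard volume form (divergence is taken with respect to it). The standard contact structure is the kernel on $T\mathbb{S}^3$ of $-y_1dx_1+x_1dy_1-y_2dx_2+x_2dy_2$, and a vector field is Legendrian if it is everywhere tangent to this fixed plane field. The Seifert foliation $S_{p,q}$ is the foliation of $\mathbb{S}^3$ by circles whose leaf through $(z_1,z_2)$ is the curve $\varphi\mapsto(z_1e^{\mathrm{i}p\varphi},z_2e^{\mathrm{i}q\varphi})$, $\varphi\in[0,2\pi)$. Two foliations are isotopic if there is a diffeomorphism of $\mathbb{S}^3$ isotopic to the identity mapping one to the other. *)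

theory Defs
  imports "HOL-Analysis.Analysis"
begin

type_synonym C2 = "complex \<times> complex"

definition S3 :: "C2 set" where
  "S3 = {(z1, z2). (cmod z1)\<^sup>2 + (cmod z2)\<^sup>2 = 1}"

text \<open>The tangent space of the unit sphere at a point \<open>x\<close>; the inner product of
  \<^typ>\<open>complex \<times> complex\<close> is the Euclidean one in the coordinates \<open>x1, y1, x2, y2\<close>.\<close>
definition T_S3 :: "C2 \<Rightarrow> C2 set" where
  "T_S3 x = {v. x \<bullet> v = 0}"


section \<open>Smooth and real-analytic maps\<close>

primrec Ck_on :: "nat \<Rightarrow> ('a::euclidean_space \<Rightarrow> 'b::euclidean_space) \<Rightarrow> 'a set \<Rightarrow> bool" where
  "Ck_on 0 f U = continuous_on U f"
| "Ck_on (Suc k) f U =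
     ((\<forall>x\<in>U. f differentiable (at x)) \<and>
      (\<forall>v. Ck_on k (\<lambda>x. frechet_derivative f (at x) v) U))"

definition real_analytic_at ::
    "('a::euclidean_space \<Rightarrow> 'b::euclidean_space) \<Rightarrow> 'a \<Rightarrow> bool" where
  "real_analytic_at f a \<longleftrightarrow>
     (\<exists>(c :: ('a \<Rightarrow> nat) \<Rightarrow> 'b) r. r > 0 \<and>
       (\<forall>x\<in>ball a r.
         ((\<lambda>\<alpha>. (\<Prod>i\<in>Basis. ((x - a) \<bullet> i) ^ \<alpha> i) *\<^sub>R c \<alpha>) has_sum f x)
           (Basis \<rightarrow>\<^sub>E UNIV)))"

text \<open>On a subset \<open>S\<close> of a Euclidean space (an embedded submanifold, possibly with boundary),
  a map is smooth, respectively real-analytic, if locally it is the restriction of such a map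
  defined on an open set of the ambient space.\<close>

definition smooth_map ::
    "'a::euclidean_space set \<Rightarrow> ('a \<Rightarrow> 'b::euclidean_space) \<Rightarrow> bool" where
  "smooth_map S f \<longleftrightarrow>
     (\<forall>x\<in>S. \<exists>U g. open U \<and> x \<in> U \<and> (\<forall>k. Ck_on k g U) \<and> (\<forall>y\<in>S \<inter> U. g y = f y))"

definition real_analytic_map ::
    "'a::euclidean_space set \<Rightarrow> ('a \<Rightarrow> 'b::euclidean_space) \<Rightarrow> bool" where
  "real_analytic_map S f \<longleftrightarrow>
     (\<forall>x\<in>S. \<exists>U g. open U \<and> x \<in> U \<and> (\<forall>y\<in>U. real_analytic_at g y) \<and>
       (\<forall>y\<in>S \<inter> U. g y = f y))"


section \<open>Isotopic foliations\<close>

definition diffeo_S3 :: "(C2 \<Rightarrow> C2) \<Rightarrow> bool" where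
  "diffeo_S3 f \<longleftrightarrow>
     bij_betw f S3 S3 \<and> smooth_map S3 f \<and> smooth_map S3 (inv_into S3 f)"

definition isotopic_to_id :: "(C2 \<Rightarrow> C2) \<Rightarrow> bool" where
  "isotopic_to_id f \<longleftrightarrow>
     (\<exists>H :: real \<Rightarrow> C2 \<Rightarrow> C2.
        smooth_map ({0..1} \<times> S3) (\<lambda>(t, x). H t x) \<and>
        (\<forall>t\<in>{0..1}. diffeo_S3 (H t)) \<and>
        (\<forall>x\<in>S3. H 0 x = x) \<and> (\<forall>x\<in>S3. H 1 x = f x))"

text \<open>A foliation is represented by the set of its leaves.\<close>

definition isotopic_foliations :: "C2 set set \<Rightarrow> C2 set set \<Rightarrow> bool" where
  "isotopic_foliations F G \<longleftrightarrow>
     (\<exists>f. diffeo_S3 f \<and> isotopic_to_id f \<and> (\<lambda>L. f ` L) ` F = G)"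

definition seifert_leaf :: "int \<Rightarrow> int \<Rightarrow> C2 \<Rightarrow> C2 set" where
  "seifert_leaf p q z =
     {(fst z * cis (of_int p * \<phi>), snd z * cis (of_int q * \<phi>)) | \<phi>. \<phi> \<in> {0..<2 * pi}}"

definition seifert_foliation :: "int \<Rightarrow> int \<Rightarrow> C2 set set" where
  "seifert_foliation p q = seifert_leaf p q ` S3"


section \<open>Vector fields on the sphere\<close>

text \<open>A vector field is represented by a map of the ambient space of which only the values on
  \<^const>\<open>S3\<close> matter.\<close>

definition tangent_field :: "(C2 \<Rightarrow> C2) \<Rightarrow> bool" where
  "tangent_field X \<longleftrightarrow> (\<forall>x\<in>S3. X x \<in> T_S3 x)"

text \<open>A leaf is the image of a maximal integral curve. Since the sphere is compact, the maximal
  integral curves of a smooth tangent field are defined for all times.\<close>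

definition field_leaf :: "(C2 \<Rightarrow> C2) \<Rightarrow> C2 \<Rightarrow> C2 set" where
  "field_leaf X z =
     {\<gamma> t | (\<gamma> :: real \<Rightarrow> C2) t.
        \<gamma> 0 = z \<and>
        (\<forall>s. \<gamma> s \<in> S3 \<and> (\<gamma> has_vector_derivative X (\<gamma> s)) (at s))}"

definition field_foliation :: "(C2 \<Rightarrow> C2) \<Rightarrow> C2 set set" where
  "field_foliation X = field_leaf X ` S3"

definition contact_form :: "C2 \<Rightarrow> C2 \<Rightarrow> real" where
  "contact_form z v =
     - Im (fst z) * Re (fst v) + Re (fst z) * Im (fst v)
     - Im (snd z) * Re (snd v) + Re (snd z) * Im (snd v)"

definition legendrian_field :: "(C2 \<Rightarrow> C2) \<Rightarrow> bool" where
  "legendrian_field X \<longleftrightarrow> tangent_field X \<and> (\<forall>x\<in>S3. contact_form x (X x) = 0)"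

definition coords :: "C2 \<Rightarrow> real^4" where
  "coords v = vector [Re (fst v), Im (fst v), Re (snd v), Im (snd v)]"

text \<open>The standard volume form of the sphere: the contraction of \<open>dx1 dy1 dx2 dy2\<close> with the
  outer unit normal \<open>x\<close> at the point \<open>x\<close>.\<close>
definition vol_S3 :: "C2 \<Rightarrow> C2 \<Rightarrow> C2 \<Rightarrow> C2 \<Rightarrow> real" where
  "vol_S3 x u v w = det (vector [coords x, coords u, coords v, coords w] :: real^4^4)"

definition interior_vol :: "(C2 \<Rightarrow> C2) \<Rightarrow> C2 \<Rightarrow> C2 \<Rightarrow> C2 \<Rightarrow> real" where
  "interior_vol X x v w = vol_S3 x (X x) v w"

text \<open>The exterior derivative, at a point \<open>x\<close> of the sphere and on tangent vectors \<open>u, v, w\<close>, of a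
  2-form \<open>\<beta>\<close>. To differentiate, \<open>\<beta>\<close> is first extended to the complement of the origin as
  \<open>y \<mapsto> \<beta> (sgn y)\<close>, where \<open>sgn y\<close> is the radial projection of \<open>y\<close>; as the exterior derivative
  commutes with the pullback to the sphere, the choice of the extension is immaterial.\<close>
definition ext_deriv_S3 ::
    "(C2 \<Rightarrow> C2 \<Rightarrow> C2 \<Rightarrow> real) \<Rightarrow> C2 \<Rightarrow> C2 \<Rightarrow> C2 \<Rightarrow> C2 \<Rightarrow> real" where
  "ext_deriv_S3 \<beta> x u v w =
     frechet_derivative (\<lambda>y. \<beta> (sgn y) v w) (at x) u
     - frechet_derivative (\<lambda>y. \<beta> (sgn y) u w) (at x) v
     + frechet_derivative (\<lambda>y. \<beta> (sgn y) u v) (at x) w"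

text \<open>The divergence is the function \<open>h\<close> such that the Lie derivative of the volume form along
  \<open>X\<close> is \<open>h\<close> times the volume form. The volume form has top degree on the sphere, hence is
  closed, so by Cartan's formula this Lie derivative is the exterior derivative of the contraction
  of the volume form with \<open>X\<close>.\<close>
definition has_divergence :: "(C2 \<Rightarrow> C2) \<Rightarrow> (C2 \<Rightarrow> real) \<Rightarrow> bool" where
  "has_divergence X h \<longleftrightarrow>
     (\<forall>x\<in>S3. \<forall>u\<in>T_S3 x. \<forall>v\<in>T_S3 x. \<forall>w\<in>T_S3 x.
        ext_deriv_S3 (interior_vol X) x u v w = h x * vol_S3 x u v w)"

end

theory Submission
  imports Defs
begin

text \<open>The plane field of the form \<open>Re (z1 dz2 - z2 dz1)\<close> is mapped to the standard contact
  structure by the linear map \<open>rot 1\<close>. With \<open>\<tau> = (p - q) / (p + 3 q)\<close>, the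
  polynomial map with components \<open>z1 - \<tau> cnj z1 (cnj z2)^2\<close> and \<open>D z2 + \<tau> (cnj
  z1)^2 cnj z2 + \<tau>^3 z1^2 z2^3\<close>, where \<open>D = 1 + 2 \<tau> - \<tau>^3 (2 + \<tau>)
  |z2|^4\<close>, sends the circles of the Seifert foliation to curves annihilated by the former form.
  Multiplying the second component by \<open>(1 + |z2|^2)^N\<close> preserves this, since \<open>|z2|\<close> is
  constant on each circle, and makes the normalized map an immersion of the sphere for large \<open>N\<close>.
  The same holds for all \<open>t \<tau>\<close> with \<open>t \<in> [0, 1]\<close>, applying \<open>rot
  t\<close> as well, so that the end \<open>\<psi>\<close> of an analytic isotopy carries the foliation to one
  by Legendrian curves. The Seifert field spans the kernel, on the sphere, of the closed 2-form \<open>q dx1 dy1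
  + p dx2 dy2\<close>, whose push-forward by \<open>\<psi>\<close> is again closed; the field whose contraction
  with the volume form is this push-forward is divergence-free, analytic and a nonvanishing multiple of the
  image of the Seifert field.\<close>

section \<open>Majorized power series\<close>

text \<open>The formulas are forced by the Legendrian condition. Along a Seifert circle the form is
  the real part of \<open>\<i>\<close> times a real factor times a combination of
  \<open>w = z1 z2\<close>, \<open>cnj w\<close> and their cubes. This combination has to be real:
  the cubic terms determine \<tau>, the linear ones determine \<open>D\<close>. Positive
  \<open>p\<close> and \<open>q\<close> put \<tau> strictly between -1/3 and 1; at these two ends
  the map degenerates on the circle \<open>z2 = 0\<close>, respectively \<open>z1 = 0\<close>. Only
  the end of the isotopy has to be Legendrian. Before that, immersions suffice, since a path of
  immersions that starts at the identity consists of embeddings. The immersion property is the main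
  obstacle, and the power factor reduces it to an estimate without derivatives in the direction of
  \<open>|z2|\<close>. Analyticity is carried by power series with explicit majorants because the
  push-forward needs an analytic inverse of the isotopy's end: the inverse function theorem is
  proved by iteration on majorants, and reciprocals, square roots and inverse diffeomorphisms follow
  from it.\<close>

definition monom_at :: "('a::euclidean_space \<Rightarrow> nat) \<Rightarrow> 'a \<Rightarrow> real" where
  "monom_at \<alpha> x = (\<Prod>b\<in>Basis. (x \<bullet> b) ^ \<alpha> b)"

definition mdeg :: "('a::euclidean_space \<Rightarrow> nat) \<Rightarrow> nat" where
  "mdeg \<alpha> = (\<Sum>b\<in>Basis. \<alpha> b)"

definition cube :: "real \<Rightarrow> 'a::euclidean_space set" where
  "cube r = {x. \<forall>b\<in>Basis. \<bar>x \<bullet> b\<bar> \<le> r}"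

text \<open>The terms of the power series are listed in an arbitrary order and a multi-index may occur
  repeatedly, so that products and substitutions need no regrouping; \<open>M\<close> bounds the sum of
  the absolute values on the cube.\<close>

definition maj :: "real \<Rightarrow> real \<Rightarrow> ('a::euclidean_space \<Rightarrow> real) \<Rightarrow> bool" where
  "maj r M f \<longleftrightarrow> 0 \<le> r \<and> (\<exists>(c :: nat \<Rightarrow> real) \<alpha>.
     (\<forall>F. finite F \<longrightarrow> (\<Sum>j\<in>F. \<bar>c j\<bar> * r ^ mdeg (\<alpha> j)) \<le> M) \<and>
     (\<forall>x\<in>cube r. ((\<lambda>j. c j * monom_at (\<alpha> j) x) has_sum f x) UNIV))"

lemma cube_mono: "r \<le> s \<Longrightarrow> cube r \<subseteq> cube s"
  by (auto simp: cube_def)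

lemma zero_in_cube: "0 \<le> r \<Longrightarrow> 0 \<in> cube r"
  by (auto simp: cube_def)

lemma monom_at_bound:
  assumes "x \<in> cube r"
  shows "\<bar>monom_at \<alpha> x\<bar> \<le> r ^ mdeg \<alpha>"
proof -
  have "\<bar>monom_at \<alpha> x\<bar> = (\<Prod>b\<in>Basis. \<bar>x \<bullet> b\<bar> ^ \<alpha> b)"
    by (simp add: monom_at_def abs_prod power_abs)
  also have "\<dots> \<le> (\<Prod>b\<in>(Basis::'a set). r ^ \<alpha> b)"
    using assms by (intro prod_mono) (auto simp: cube_def intro!: power_mono)
  also have "\<dots> = r ^ mdeg \<alpha>"
    by (simp add: mdeg_def power_sum)
  finally show ?thesis .
qed

lemma finite_sums_imp_summable:
  fixes q :: "'i \<Rightarrow> real"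
  assumes "\<And>F. finite F \<Longrightarrow> sum q F \<le> M" and "\<And>j. \<bar>t j\<bar> \<le> q j"
  shows "(\<lambda>j. \<bar>t j\<bar>) summable_on UNIV" and "t summable_on UNIV"
proof -
  show 1: "(\<lambda>j. \<bar>t j\<bar>) summable_on UNIV"
  proof (rule nonneg_bdd_above_summable_on)
    show "bdd_above (sum (\<lambda>j. \<bar>t j\<bar>) ` {F. F \<subseteq> UNIV \<and> finite F})"
      by (rule bdd_aboveI2[where M=M], rule order_trans[OF sum_mono assms(1)]) (use assms(2) in auto)
  qed auto
  show "t summable_on UNIV"
    using 1 summable_on_iff_abs_summable_on_real[of t] by simp
qed

text \<open>Products and double sums produce series indexed by pairs. They are brought back to the
  index type \<open>nat\<close> along \<open>to_nat\<close>, with coefficient 0 off its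
  range.\<close>

lemma majI:
  fixes c :: "'i::countable \<Rightarrow> real" and f :: "'a::euclidean_space \<Rightarrow> real"
  assumes r: "0 \<le> r"
    and bound: "\<And>F. finite F \<Longrightarrow> (\<Sum>j\<in>F. \<bar>c j\<bar> * r ^ mdeg (\<alpha> j)) \<le> M"
    and sums: "\<And>x. x \<in> cube r \<Longrightarrow> ((\<lambda>j. c j * monom_at (\<alpha> j) x) has_sum f x) UNIV"
  shows "maj r M f"
proof -
  let ?R = "range (to_nat :: 'i \<Rightarrow> nat)"
  define c' where "c' n = (if n \<in> ?R then c (from_nat n) else 0)" for n
  define \<alpha>' where "\<alpha>' n = \<alpha> (from_nat n)" for n
  have [simp]: "c' (to_nat i) = c i" "\<alpha>' (to_nat i) = \<alpha> i" for i
    by (auto simp: c'_def \<alpha>'_def)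
  have 1: "(\<Sum>n\<in>F. \<bar>c' n\<bar> * r ^ mdeg (\<alpha>' n)) \<le> M" if "finite F" for F
  proof -
    define G where "G = (to_nat :: 'i \<Rightarrow> nat) -` F"
    have fin: "finite G"
      unfolding G_def using that by (intro finite_vimageI) auto
    have im: "to_nat ` G = F \<inter> ?R" by (auto simp: G_def)
    have "(\<Sum>n\<in>F. \<bar>c' n\<bar> * r ^ mdeg (\<alpha>' n)) = (\<Sum>n\<in>F \<inter> ?R. \<bar>c' n\<bar> * r ^ mdeg (\<alpha>' n))"
      using that by (intro sum.mono_neutral_right) (auto simp: c'_def)
    also have "\<dots> = (\<Sum>i\<in>G. \<bar>c i\<bar> * r ^ mdeg (\<alpha> i))"
      unfolding im[symmetric] by (subst sum.reindex) (auto simp: inj_on_def)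
    also have "\<dots> \<le> M" using bound fin by blast
    finally show ?thesis .
  qed
  have 2: "((\<lambda>n. c' n * monom_at (\<alpha>' n) x) has_sum f x) UNIV" if "x \<in> cube r" for x
  proof -
    have "((\<lambda>n. c' n * monom_at (\<alpha>' n) x) has_sum f x) ?R"
      using sums[OF that] by (subst has_sum_reindex) (auto simp: o_def inj_on_def)
    then show ?thesis
      by (subst has_sum_cong_neutral[where S = UNIV and T = ?R and g = "\<lambda>n. c' n * monom_at (\<alpha>' n) x"])
        (auto simp: c'_def)
  qed
  show ?thesis unfolding maj_def using r 1 2 by blast
qed

lemma majE:
  assumes "maj r M f"
  obtains c :: "nat \<Rightarrow> real" and \<alpha> where
    "0 \<le> r" "\<And>F. finite F \<Longrightarrow> (\<Sum>j\<in>F. \<bar>c j\<bar> * r ^ mdeg (\<alpha> j)) \<le> M"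
    "\<And>x. x \<in> cube r \<Longrightarrow> ((\<lambda>j. c j * monom_at (\<alpha> j) x) has_sum f x) UNIV"
    "\<And>x. x \<in> cube r \<Longrightarrow> (\<lambda>j. \<bar>c j * monom_at (\<alpha> j) x\<bar>) summable_on UNIV"
proof -
  obtain c :: "nat \<Rightarrow> real" and \<alpha> where *: "0 \<le> r" "\<And>F. finite F \<Longrightarrow> (\<Sum>j\<in>F. \<bar>c j\<bar> * r ^ mdeg (\<alpha> j)) \<le> M"
    "\<And>x. x \<in> cube r \<Longrightarrow> ((\<lambda>j. c j * monom_at (\<alpha> j) x) has_sum f x) UNIV"
    using assms unfolding maj_def by blast
  have "(\<lambda>j. \<bar>c j * monom_at (\<alpha> j) x\<bar>) summable_on UNIV" if "x \<in> cube r" for x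
    by (rule finite_sums_imp_summable(1)[OF *(2)])
      (auto simp: abs_mult intro!: mult_left_mono monom_at_bound that)
  with * that show ?thesis by blast
qed

lemma maj_nonneg: assumes "maj r M f" shows "0 \<le> r" "0 \<le> M"
proof -
  show "0 \<le> r" using assms by (simp add: maj_def)
  show "0 \<le> M" using assms
    by (rule majE) (metis finite.emptyI sum.empty)
qed

text \<open>At radius 0 the cube is the origin alone, so for a constant function a majorant is just
  a bound on its absolute value. Estimates stated for series are later applied to single points in
  this way.\<close>

lemma maj_bound:
  assumes "maj r M f" "x \<in> cube r" shows "\<bar>f x\<bar> \<le> M"
  using assms(1)
proof (rule majE)
  fix c :: "nat \<Rightarrow> real" and \<alpha>
  assume a: "0 \<le> r" "\<And>F. finite F \<Longrightarrow> (\<Sum>j\<in>F. \<bar>c j\<bar> * r ^ mdeg (\<alpha> j)) \<le> M"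
    "\<And>x. x \<in> cube r \<Longrightarrow> ((\<lambda>j. c j * monom_at (\<alpha> j) x) has_sum f x) UNIV"
    "\<And>x. x \<in> cube r \<Longrightarrow> (\<lambda>j. \<bar>c j * monom_at (\<alpha> j) x\<bar>) summable_on UNIV"
  have "\<bar>f x\<bar> \<le> (\<Sum>\<^sub>\<infinity>j. \<bar>c j * monom_at (\<alpha> j) x\<bar>)"
    using norm_has_sum_bound[OF _ a(3)[OF assms(2)]] a(4)[OF assms(2)] by fastforce
  also have "\<dots> \<le> M"
  proof (rule infsum_le_finite_sums[OF a(4)[OF assms(2)]])
    fix F :: "nat set" assume "finite F"
    have "(\<Sum>j\<in>F. \<bar>c j * monom_at (\<alpha> j) x\<bar>) \<le> (\<Sum>j\<in>F. \<bar>c j\<bar> * r ^ mdeg (\<alpha> j))"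
      by (auto simp: abs_mult intro!: sum_mono mult_left_mono monom_at_bound assms(2))
    with a(2)[OF \<open>finite F\<close>] show "(\<Sum>j\<in>F. \<bar>c j * monom_at (\<alpha> j) x\<bar>) \<le> M" by linarith
  qed
  finally show ?thesis .
qed

lemma maj_mono:
  assumes "maj r M f" "0 \<le> r'" "r' \<le> r" "M \<le> M'" shows "maj r' M' f"
  using assms(1)
proof (rule majE)
  fix c :: "nat \<Rightarrow> real" and \<alpha>
  assume a: "0 \<le> r" "\<And>F. finite F \<Longrightarrow> (\<Sum>j\<in>F. \<bar>c j\<bar> * r ^ mdeg (\<alpha> j)) \<le> M"
    "\<And>x. x \<in> cube r \<Longrightarrow> ((\<lambda>j. c j * monom_at (\<alpha> j) x) has_sum f x) UNIV"
  show ?thesis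
  proof (rule majI[where c=c and \<alpha>=\<alpha>])
    fix F :: "nat set" assume "finite F"
    have "(\<Sum>j\<in>F. \<bar>c j\<bar> * r' ^ mdeg (\<alpha> j)) \<le> (\<Sum>j\<in>F. \<bar>c j\<bar> * r ^ mdeg (\<alpha> j))"
      using assms by (auto intro!: sum_mono mult_left_mono power_mono)
    with a(2)[OF \<open>finite F\<close>] assms(4) show "(\<Sum>j\<in>F. \<bar>c j\<bar> * r' ^ mdeg (\<alpha> j)) \<le> M'" by linarith
  next
    show "((\<lambda>j. c j * monom_at (\<alpha> j) x) has_sum f x) UNIV" if "x \<in> cube r'" for x
      using a(3) that cube_mono[OF assms(3)] by auto
  qed (rule assms(2))
qed

section \<open>Sums, products and substitution of majorized series\<close>

lemma maj_cong:
  assumes "maj r M f" "\<And>x. x \<in> cube r \<Longrightarrow> f x = g x" shows "maj r M g"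
  using assms unfolding maj_def by auto

lemma maj_const:
  assumes "0 \<le> r" shows "maj r \<bar>k\<bar> (\<lambda>x :: 'a::euclidean_space. k)"
proof (rule majI[where c = "\<lambda>_::unit. k" and \<alpha> = "\<lambda>_ _. 0"])
  fix F :: "unit set"
  have "F = {} \<or> F = {()}" by (cases "() \<in> F") auto
  then show "(\<Sum>j\<in>F. \<bar>k\<bar> * r ^ mdeg (\<lambda>_ :: 'a. 0)) \<le> \<bar>k\<bar>" by (auto simp: mdeg_def)
qed (auto simp: monom_at_def UNIV_unit assms intro!: has_sum_finiteI)

lemma maj_coord:
  assumes "0 \<le> r" "b \<in> Basis" shows "maj r r (\<lambda>x. x \<bullet> b)"
proof -
  let ?\<alpha> = "\<lambda>_::unit. \<lambda>i. if i = b then 1 else (0::nat)"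
  have d: "mdeg (?\<alpha> u) = 1" for u using assms(2) by (simp add: mdeg_def)
  have m: "monom_at (?\<alpha> u) x = x \<bullet> b" for u x
    using assms(2) by (simp add: monom_at_def if_distrib[of "\<lambda>k. _ ^ k"] prod.delta cong: if_cong)
  show ?thesis
  proof (rule majI[where c = "\<lambda>_::unit. 1" and \<alpha> = ?\<alpha>])
    fix F :: "unit set"
    have "F = {} \<or> F = {()}" by (cases "() \<in> F") auto
    then show "(\<Sum>j\<in>F. \<bar>1\<bar> * r ^ mdeg (?\<alpha> j)) \<le> r" using d assms by auto
  qed (auto simp: m UNIV_unit assms intro!: has_sum_finiteI)
qed

text \<open>The expansions of all \<open>f n\<close> are concatenated into one series indexed by
  pairs. A finite set of pairs lies in a rectangle, so \<open>K\<close> bounds its sum of absolute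
  values, and the resulting absolute summability permits summing by rows.\<close>

lemma maj_has_sum:
  assumes f: "\<And>n::nat. maj r (M n) (f n)"
    and M: "\<And>F. finite F \<Longrightarrow> sum M F \<le> K"
    and g: "\<And>x. x \<in> cube r \<Longrightarrow> ((\<lambda>n. f n x) has_sum g x) UNIV"
  shows "maj r K g"
proof -
  define Q where "Q n c \<alpha> \<longleftrightarrow> (\<forall>F. finite F \<longrightarrow> (\<Sum>j\<in>F. \<bar>c j\<bar> * r ^ mdeg (\<alpha> j)) \<le> M n) \<and>
     (\<forall>x\<in>cube r. ((\<lambda>j. c j * monom_at (\<alpha> j) x) has_sum f n x) UNIV)"
    for n and c :: "nat \<Rightarrow> real" and \<alpha>
  have "\<exists>c \<alpha>. Q n c \<alpha>" for n
    using f[of n] unfolding maj_def Q_def by blast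
  then obtain c \<alpha> where Q: "\<And>n. Q n (c n) (\<alpha> n)" by metis
  have b: "\<And>n F. finite F \<Longrightarrow> (\<Sum>j\<in>F. \<bar>c n j\<bar> * r ^ mdeg (\<alpha> n j)) \<le> M n" and
    s: "\<And>n x. x \<in> cube r \<Longrightarrow> ((\<lambda>j. c n j * monom_at (\<alpha> n j) x) has_sum f n x) UNIV"
    using Q unfolding Q_def by auto
  have r: "0 \<le> r" using f maj_nonneg by blast
  have bnd: "(\<Sum>j\<in>F. \<bar>case_prod c j\<bar> * r ^ mdeg (case_prod \<alpha> j)) \<le> K" if "finite F" for F
  proof -
    have "F \<subseteq> fst ` F \<times> snd ` F" by force
    then have "(\<Sum>j\<in>F. \<bar>case_prod c j\<bar> * r ^ mdeg (case_prod \<alpha> j))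
       \<le> (\<Sum>j\<in>fst ` F \<times> snd ` F. \<bar>case_prod c j\<bar> * r ^ mdeg (case_prod \<alpha> j))"
      using that r by (intro sum_mono2) auto
    also have "\<dots> = (\<Sum>n\<in>fst ` F. \<Sum>j\<in>snd ` F. \<bar>c n j\<bar> * r ^ mdeg (\<alpha> n j))"
      by (simp add: sum.cartesian_product split_def)
    also have "\<dots> \<le> sum M (fst ` F)"
      using b that by (intro sum_mono) auto
    also have "\<dots> \<le> K" using M that by auto
    finally show ?thesis .
  qed
  show ?thesis
  proof (rule majI[where c = "case_prod c" and \<alpha> = "case_prod \<alpha>", OF r bnd])
    fix x :: 'a assume x: "x \<in> cube r"
    have "((\<lambda>j. case_prod c j * monom_at (case_prod \<alpha> j) x) has_sum g x) (SIGMA n:UNIV. UNIV)"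
    proof (rule has_sum_SigmaI[where g = "\<lambda>n. f n x"])
      have "\<bar>case_prod c j * monom_at (case_prod \<alpha> j) x\<bar> \<le> \<bar>case_prod c j\<bar> * r ^ mdeg (case_prod \<alpha> j)" for j
        unfolding abs_mult by (intro mult_left_mono monom_at_bound x) auto
      from finite_sums_imp_summable(2)[OF bnd this]
      show "(\<lambda>j. case_prod c j * monom_at (case_prod \<alpha> j) x) summable_on (SIGMA n:UNIV. UNIV)" by simp
    qed (use s[OF x] g[OF x] in auto)
    then show "((\<lambda>j. case_prod c j * monom_at (case_prod \<alpha> j) x) has_sum g x) UNIV" by simp
  qed
qed

text \<open>The pairwise products of the terms are kept as they are, so the Cauchy product is a
  plain sum over pairs with added multi-indices.\<close>

lemma maj_mult:
  assumes f: "maj r A f" and g: "maj r B g" shows "maj r (A * B) (\<lambda>x. f x * g x)"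
proof -
  obtain c :: "nat \<Rightarrow> real" and \<alpha> where r: "0 \<le> r" and
    bc: "\<And>F. finite F \<Longrightarrow> (\<Sum>j\<in>F. \<bar>c j\<bar> * r ^ mdeg (\<alpha> j)) \<le> A" and
    sc: "\<And>x. x \<in> cube r \<Longrightarrow> ((\<lambda>j. c j * monom_at (\<alpha> j) x) has_sum f x) UNIV"
    using f by (rule majE) blast
  obtain d :: "nat \<Rightarrow> real" and \<beta> where
    bd: "\<And>F. finite F \<Longrightarrow> (\<Sum>j\<in>F. \<bar>d j\<bar> * r ^ mdeg (\<beta> j)) \<le> B" and
    sd: "\<And>x. x \<in> cube r \<Longrightarrow> ((\<lambda>j. d j * monom_at (\<beta> j) x) has_sum g x) UNIV"
    using g by (rule majE) blast
  let ?c = "\<lambda>(i, j). c i * d j" and ?\<alpha> = "\<lambda>(i, j). \<lambda>b. \<alpha> i b + \<beta> j b"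
  have dg: "mdeg (\<lambda>b. \<alpha> i b + \<beta> j b) = mdeg (\<alpha> i) + mdeg (\<beta> j)" for i j
    by (simp add: mdeg_def sum.distrib)
  have mo: "monom_at (\<lambda>b. \<alpha> i b + \<beta> j b) x = monom_at (\<alpha> i) x * monom_at (\<beta> j) x" for i j x
    by (simp add: monom_at_def power_add prod.distrib)
  have A: "0 \<le> A" using f maj_nonneg by blast
  have bnd: "(\<Sum>p\<in>F. \<bar>?c p\<bar> * r ^ mdeg (?\<alpha> p)) \<le> A * B" if "finite F" for F :: "(nat \<times> nat) set"
  proof -
    have "F \<subseteq> fst ` F \<times> snd ` F" by force
    then have "(\<Sum>p\<in>F. \<bar>?c p\<bar> * r ^ mdeg (?\<alpha> p)) \<le> (\<Sum>p\<in>fst ` F \<times> snd ` F. \<bar>?c p\<bar> * r ^ mdeg (?\<alpha> p))"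
      using that r by (intro sum_mono2) auto
    also have "\<dots> = (\<Sum>i\<in>fst ` F. \<Sum>j\<in>snd ` F. (\<bar>c i\<bar> * r ^ mdeg (\<alpha> i)) * (\<bar>d j\<bar> * r ^ mdeg (\<beta> j)))"
      by (simp add: sum.cartesian_product split_def dg power_add abs_mult mult_ac)
    also have "\<dots> = (\<Sum>i\<in>fst ` F. \<bar>c i\<bar> * r ^ mdeg (\<alpha> i)) * (\<Sum>j\<in>snd ` F. \<bar>d j\<bar> * r ^ mdeg (\<beta> j))"
      by (simp add: sum_product)
    also have "\<dots> \<le> A * B"
      using bc bd that A r by (intro mult_mono sum_nonneg) auto
    finally show ?thesis .
  qed
  show ?thesis
  proof (rule majI[where c = ?c and \<alpha> = ?\<alpha>, OF r bnd])
    fix x :: 'a assume x: "x \<in> cube r"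
    have "((\<lambda>p. ?c p * monom_at (?\<alpha> p) x) has_sum f x * g x) (SIGMA n:UNIV. UNIV)"
    proof (rule has_sum_SigmaI[where g = "\<lambda>i. (c i * monom_at (\<alpha> i) x) * g x"])
      have "\<bar>?c p * monom_at (?\<alpha> p) x\<bar> \<le> \<bar>?c p\<bar> * r ^ mdeg (?\<alpha> p)" for p
        unfolding abs_mult by (intro mult_left_mono monom_at_bound x) auto
      from finite_sums_imp_summable(2)[OF bnd this]
      show "(\<lambda>p. ?c p * monom_at (?\<alpha> p) x) summable_on (SIGMA n:UNIV. UNIV)" by simp
      show "((\<lambda>j. ?c (i, j) * monom_at (?\<alpha> (i, j)) x) has_sum c i * monom_at (\<alpha> i) x * g x) UNIV" for i
        using has_sum_cmult_right[OF sd[OF x], of "c i * monom_at (\<alpha> i) x"] by (simp add: mo mult_ac)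
      show "((\<lambda>i. c i * monom_at (\<alpha> i) x * g x) has_sum f x * g x) UNIV"
        using has_sum_cmult_left[OF sc[OF x], of "g x"] by simp
    qed
    then show "((\<lambda>p. ?c p * monom_at (?\<alpha> p) x) has_sum f x * g x) UNIV" by simp
  qed
qed

lemma maj_zero: "0 \<le> r \<Longrightarrow> maj r 0 (\<lambda>x. 0)"
  using maj_const[of r 0] by simp

lemma maj_add:
  assumes "maj r A f" "maj r B g" shows "maj r (A + B) (\<lambda>x. f x + g x)"
proof (rule maj_has_sum[where f = "\<lambda>n. if n = 0 then f else if n = 1 then g else (\<lambda>x. 0)"
      and M = "\<lambda>n. if n = 0 then A else if n = 1 then B else 0"])
  show "maj r (if n = 0 then A else if n = 1 then B else 0) (if n = 0 then f else if n = 1 then g else (\<lambda>x. 0))" for n :: nat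
    using assms maj_zero maj_nonneg(1)[OF assms(1)] by auto
  have AB: "0 \<le> A" "0 \<le> B" using assms maj_nonneg by blast+
  show "(\<Sum>n\<in>F. if n = 0 then A else if n = 1 then B else 0) \<le> A + B" if "finite F" for F :: "nat set"
  proof -
    let ?h = "\<lambda>n::nat. if n = 0 then A else if n = 1 then B else 0"
    have "sum ?h F \<le> sum ?h (F \<union> {0, 1})"
      using that AB by (intro sum_mono2) auto
    also have "\<dots> = sum ?h {0, 1}"
      using that by (intro sum.mono_neutral_right) auto
    finally show ?thesis by simp
  qed
  show "((\<lambda>n. (if n = 0 then f else if n = 1 then g else (\<lambda>x. 0)) x) has_sum f x + g x) (UNIV :: nat set)" for x
    by (rule has_sum_finite_neutralI[where B = "{0,1::nat}"]) auto
qed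

lemma maj_cmult: "maj r A f \<Longrightarrow> maj r (\<bar>k\<bar> * A) (\<lambda>x. k * f x)"
  by (rule maj_mult[OF maj_const[OF maj_nonneg(1)]])

lemma maj_uminus: "maj r A f \<Longrightarrow> maj r A (\<lambda>x. - f x)"
  using maj_cmult[of r A f "-1"] by simp

lemma maj_sum:
  assumes "finite I" "0 \<le> r" "\<And>i. i \<in> I \<Longrightarrow> maj r (M i) (f i)"
  shows "maj r (sum M I) (\<lambda>x. \<Sum>i\<in>I. f i x)"
  using assms by (induction I rule: finite_induct) (auto intro!: maj_add maj_zero)

lemma maj_one: "0 \<le> r \<Longrightarrow> maj r 1 (\<lambda>x. 1)"
  using maj_const[of r 1] by simp

lemma maj_power: "maj r M f \<Longrightarrow> maj r (M ^ n) (\<lambda>x. f x ^ n)"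
  by (induction n) (auto intro!: maj_mult maj_one simp: maj_nonneg(1))

lemma maj_prod:
  assumes "finite I" "0 \<le> r" "\<And>i. i \<in> I \<Longrightarrow> maj r (M i) (f i)"
  shows "maj r (prod M I) (\<lambda>x. \<Prod>i\<in>I. f i x)"
  using assms by (induction I rule: finite_induct) (auto intro!: maj_mult maj_one)

lemma maj_monom_at:
  assumes "0 \<le> r" "\<And>b. b \<in> Basis \<Longrightarrow> maj r \<rho> (\<lambda>x. g x \<bullet> b)"
  shows "maj r (\<rho> ^ mdeg \<alpha>) (\<lambda>x. monom_at \<alpha> (g x))"
  unfolding monom_at_def mdeg_def power_sum using assms by (intro maj_prod maj_power) auto

text \<open>Replacing the variables by functions with majorant \<open>\<rho>\<close> turns each
  monomial into a function with majorant \<open>\<rho>\<close> to the power of its degree. The bound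
  for \<open>f\<close> on the cube of radius \<open>\<rho>\<close> therefore passes to the
  composition unchanged.\<close>

lemma maj_compose:
  assumes f: "maj \<rho> M f" and r: "0 \<le> r" and g: "\<And>b. b \<in> Basis \<Longrightarrow> maj r \<rho> (\<lambda>x. g x \<bullet> b)"
  shows "maj r M (\<lambda>x. f (g x))"
proof -
  obtain c :: "nat \<Rightarrow> real" and \<alpha> where
    bc: "\<And>F. finite F \<Longrightarrow> (\<Sum>j\<in>F. \<bar>c j\<bar> * \<rho> ^ mdeg (\<alpha> j)) \<le> M" and
    sc: "\<And>x. x \<in> cube \<rho> \<Longrightarrow> ((\<lambda>j. c j * monom_at (\<alpha> j) x) has_sum f x) UNIV"
    using f by (rule majE) blast
  show ?thesis
  proof (rule maj_has_sum[where f = "\<lambda>j x. c j * monom_at (\<alpha> j) (g x)" and M = "\<lambda>j. \<bar>c j\<bar> * \<rho> ^ mdeg (\<alpha> j)"])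
    show "maj r (\<bar>c j\<bar> * \<rho> ^ mdeg (\<alpha> j)) (\<lambda>x. c j * monom_at (\<alpha> j) (g x))" for j
      by (intro maj_cmult maj_monom_at r g)
    show "((\<lambda>j. c j * monom_at (\<alpha> j) (g x)) has_sum f (g x)) UNIV" if "x \<in> cube r" for x
      using maj_bound[OF g that] by (intro sc) (auto simp: cube_def)
  qed (use bc in auto)
qed

section \<open>The nonlinear part of a power series and the normalized inverse\<close>

lemma mdeg_eq_0: "mdeg (\<alpha> :: 'a::euclidean_space \<Rightarrow> nat) = 0 \<longleftrightarrow> (\<forall>b\<in>Basis. \<alpha> b = 0)"
  by (simp add: mdeg_def)

lemma monom_at_deg_0: "mdeg \<alpha> = 0 \<Longrightarrow> monom_at \<alpha> x = 1"
  by (simp add: mdeg_eq_0 monom_at_def)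

lemma monom_at_zero: "monom_at \<alpha> (0 :: 'a::euclidean_space) = (if mdeg \<alpha> = 0 then 1 else 0)"
  by (auto simp: mdeg_eq_0 monom_at_def intro!: prod.neutral)

lemma mdeg_1_obtain:
  assumes "mdeg (\<alpha> :: 'a::euclidean_space \<Rightarrow> nat) = 1"
  obtains b where "b \<in> Basis" "\<And>x. monom_at \<alpha> x = x \<bullet> b"
proof -
  obtain b where b: "b \<in> Basis" "\<alpha> b \<noteq> 0"
    using assms mdeg_eq_0 by (metis zero_neq_one)
  have "mdeg \<alpha> = \<alpha> b + sum \<alpha> (Basis - {b})"
    unfolding mdeg_def using b by (simp add: sum.remove)
  with assms b have ab: "\<alpha> b = 1" "sum \<alpha> (Basis - {b}) = 0" by linarith+
  have "monom_at \<alpha> x = (x \<bullet> b) ^ \<alpha> b * (\<Prod>i\<in>Basis - {b}. (x \<bullet> i) ^ \<alpha> i)" for x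
    unfolding monom_at_def using b by (simp add: prod.remove)
  then have "monom_at \<alpha> x = x \<bullet> b" for x
    using ab by simp
  with b that show ?thesis by blast
qed

text \<open>Without its constant term the series has only monomials of degree at least 1, and each
  of these gains a factor \<open>s\<close> when the cube shrinks by \<open>s\<close>.\<close>

lemma maj_shrink:
  assumes "maj r M f" "0 \<le> s" "s \<le> 1"
  shows "maj (s * r) (s * M) (\<lambda>x. f x - f 0)"
  using assms(1)
proof (rule majE)
  fix c :: "nat \<Rightarrow> real" and \<alpha>
  assume a: "0 \<le> r" "\<And>F. finite F \<Longrightarrow> (\<Sum>j\<in>F. \<bar>c j\<bar> * r ^ mdeg (\<alpha> j)) \<le> M"
    "\<And>x. x \<in> cube r \<Longrightarrow> ((\<lambda>j. c j * monom_at (\<alpha> j) x) has_sum f x) UNIV"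
  define c' where "c' j = (if mdeg (\<alpha> j) = 0 then 0 else c j)" for j
  have p: "(s * r) ^ n \<le> s * r ^ n" if "n \<noteq> 0" for n
  proof -
    have "s ^ n \<le> s ^ 1" using assms that by (intro power_decreasing) auto
    then show ?thesis using a(1) by (simp add: power_mult_distrib mult_right_mono)
  qed
  show ?thesis
  proof (rule majI[where c = c' and \<alpha> = \<alpha>])
    fix F :: "nat set" assume F: "finite F"
    have "(\<Sum>j\<in>F. \<bar>c' j\<bar> * (s * r) ^ mdeg (\<alpha> j)) \<le> (\<Sum>j\<in>F. s * (\<bar>c j\<bar> * r ^ mdeg (\<alpha> j)))"
    proof (rule sum_mono)
      fix j
      show "\<bar>c' j\<bar> * (s * r) ^ mdeg (\<alpha> j) \<le> s * (\<bar>c j\<bar> * r ^ mdeg (\<alpha> j))"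
        using mult_left_mono[OF p[of "mdeg (\<alpha> j)"], of "\<bar>c j\<bar>"] assms a(1) by (auto simp: c'_def mult_ac)
    qed
    also have "\<dots> \<le> s * M"
      unfolding sum_distrib_left[symmetric] using a(2)[OF F] assms by (intro mult_left_mono)
    finally show "(\<Sum>j\<in>F. \<bar>c' j\<bar> * (s * r) ^ mdeg (\<alpha> j)) \<le> s * M" .
  next
    fix x :: 'a assume "x \<in> cube (s * r)"
    then have x: "x \<in> cube r"
      using cube_mono[of "s * r" r] assms a(1) by (auto simp: mult_left_le_one_le)
    have "((\<lambda>j. c j * monom_at (\<alpha> j) x + - (c j * monom_at (\<alpha> j) 0)) has_sum f x + - f 0) UNIV"
      by (intro has_sum_add has_sum_uminusI a(3) x zero_in_cube a(1))
    moreover have "c j * monom_at (\<alpha> j) x + - (c j * monom_at (\<alpha> j) 0) = c' j * monom_at (\<alpha> j) x" for j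
      by (auto simp: c'_def monom_at_zero monom_at_deg_0)
    ultimately show "((\<lambda>j. c' j * monom_at (\<alpha> j) x) has_sum f x - f 0) UNIV" by simp
  qed (use assms a(1) in simp)
qed

text \<open>Majorant form of the mean value bound for powers, by induction with \<open>f ^ Suc n - g
  ^ Suc n = f * (f ^ n - g ^ n) + (f - g) * g ^ n\<close>. For \<open>n = 0\<close> the truncated
  exponent is harmless because of the factor \<open>n\<close>.\<close>

lemma maj_power_diff:
  assumes "maj q \<rho> f" "maj q \<rho> g" "maj q d (\<lambda>x. f x - g x)"
  shows "maj q (real n * \<rho> ^ (n - 1) * d) (\<lambda>x. f x ^ n - g x ^ n)"
proof (induction n)
  case 0 then show ?case using maj_zero maj_nonneg(1)[OF assms(1)] by simp
next
  case (Suc n)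
  have "maj q (\<rho> * (real n * \<rho> ^ (n - 1) * d) + d * \<rho> ^ n) (\<lambda>x. f x * (f x ^ n - g x ^ n) + (f x - g x) * g x ^ n)"
    by (intro maj_add maj_mult assms Suc maj_power)
  moreover have "\<rho> * (real n * \<rho> ^ (n - 1) * d) + d * \<rho> ^ n = real (Suc n) * \<rho> ^ (Suc n - 1) * d"
    by (cases n) (auto simp: algebra_simps)
  moreover have "(\<lambda>x. f x * (f x ^ n - g x ^ n) + (f x - g x) * g x ^ n) = (\<lambda>x. f x ^ Suc n - g x ^ Suc n)"
    by (auto simp: algebra_simps)
  ultimately show ?case by simp
qed

lemma maj_prod_power_diff:
  assumes "finite I" "0 \<le> q" "\<And>i. i \<in> I \<Longrightarrow> maj q \<rho> (f i)" "\<And>i. i \<in> I \<Longrightarrow> maj q \<rho> (g i)"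
    "\<And>i. i \<in> I \<Longrightarrow> maj q d (\<lambda>x. f i x - g i x)"
  shows "maj q (real (sum n I) * \<rho> ^ (sum n I - 1) * d) (\<lambda>x. (\<Prod>i\<in>I. f i x ^ n i) - (\<Prod>i\<in>I. g i x ^ n i))"
  using assms
proof (induction I rule: finite_induct)
  case empty then show ?case using maj_zero by simp
next
  case (insert i I)
  let ?A = "\<lambda>x. \<Prod>i\<in>I. f i x ^ n i" and ?B = "\<lambda>x. \<Prod>i\<in>I. g i x ^ n i"
  have A: "maj q (\<rho> ^ sum n I) ?A"
    unfolding power_sum using insert by (intro maj_prod maj_power) auto
  have IH: "maj q (real (sum n I) * \<rho> ^ (sum n I - 1) * d) (\<lambda>x. ?A x - ?B x)"
    using insert by auto
  have "maj q ((real (n i) * \<rho> ^ (n i - 1) * d) * \<rho> ^ sum n I + \<rho> ^ n i * (real (sum n I) * \<rho> ^ (sum n I - 1) * d))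
    (\<lambda>x. (f i x ^ n i - g i x ^ n i) * ?A x + g i x ^ n i * (?A x - ?B x))"
    by (intro maj_add maj_mult A IH maj_power maj_power_diff) (use insert in auto)
  moreover have "real a * \<rho> ^ (a - 1) * d * \<rho> ^ b + \<rho> ^ a * (real b * \<rho> ^ (b - 1) * d) = real (a + b) * \<rho> ^ (a + b - 1) * d" for a b
    by (cases a; cases b) (auto simp: algebra_simps power_add)
  moreover have "(\<lambda>x. (f i x ^ n i - g i x ^ n i) * ?A x + g i x ^ n i * (?A x - ?B x))
     = (\<lambda>x. f i x ^ n i * ?A x - g i x ^ n i * ?B x)"
    by (auto simp: algebra_simps)
  ultimately show ?case using insert(1,2) by (simp del: of_nat_sum of_nat_add)
qed

lemma maj_monom_at_diff:
  assumes "0 \<le> q" "\<And>b. b \<in> Basis \<Longrightarrow> maj q \<rho> (\<lambda>\<xi>. x \<xi> \<bullet> b)" "\<And>b. b \<in> Basis \<Longrightarrow> maj q \<rho> (\<lambda>\<xi>. y \<xi> \<bullet> b)"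
    "\<And>b. b \<in> Basis \<Longrightarrow> maj q d (\<lambda>\<xi>. x \<xi> \<bullet> b - y \<xi> \<bullet> b)"
  shows "maj q (real (mdeg \<alpha>) * \<rho> ^ (mdeg \<alpha> - 1) * d) (\<lambda>\<xi>. monom_at \<alpha> (x \<xi>) - monom_at \<alpha> (y \<xi>))"
  unfolding monom_at_def mdeg_def using assms by (intro maj_prod_power_diff) auto

lemma nat_le_two_power: "real n \<le> 2 ^ (n - 1)"
proof (cases n)
  case (Suc m)
  then show ?thesis using of_nat_mono[of "Suc m" "2 ^ m"] by (simp add: Suc_leI less_exp)
qed simp

text \<open>In degree at least 2 the powers of 1/2 absorb the factor \<open>n\<close> and still
  leave one factor \<open>s\<close>. This spare factor is what makes the nonlinear part a
  contraction.\<close>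

lemma mult_power_pred_le: "0 \<le> s \<Longrightarrow> s \<le> 1/2 \<Longrightarrow> 2 \<le> n \<Longrightarrow> real n * s ^ (n - 1) \<le> 2 * s"
proof -
  assume s: "0 \<le> s" "s \<le> 1/2" and n: "2 \<le> n"
  obtain m where m: "n = Suc (Suc m)" using n by (metis add_2_eq_Suc le_Suc_ex)
  have "real n * s ^ (n - 1) = s * (real n * s ^ m)" by (simp add: m)
  also have "\<dots> \<le> s * (2 ^ (n - 1) * (1/2) ^ m)"
    using s by (intro mult_left_mono mult_mono nat_le_two_power power_mono) auto
  also have "\<dots> = 2 * s" by (simp add: m field_simps)
  finally show ?thesis .
qed

text \<open>The non-linear part of a power series is a contraction near the origin.\<close>

lemma maj_nonlinear_part:
  fixes f :: "'a::euclidean_space \<Rightarrow> real"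
  assumes f: "maj r M f" and r: "0 < r"
  obtains D where "(f has_derivative D) (at 0)"
    "\<And>s q d (x :: 'c::euclidean_space \<Rightarrow> 'a) y. \<lbrakk>0 \<le> s; s \<le> 1/2; 0 \<le> q;
      \<And>b. b \<in> Basis \<Longrightarrow> maj q (s * r) (\<lambda>\<xi>. x \<xi> \<bullet> b); \<And>b. b \<in> Basis \<Longrightarrow> maj q (s * r) (\<lambda>\<xi>. y \<xi> \<bullet> b);
      \<And>b. b \<in> Basis \<Longrightarrow> maj q d (\<lambda>\<xi>. x \<xi> \<bullet> b - y \<xi> \<bullet> b)\<rbrakk>
      \<Longrightarrow> maj q (2 * M / r * s * d) (\<lambda>\<xi>. (f (x \<xi>) - D (x \<xi>)) - (f (y \<xi>) - D (y \<xi>)))"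
proof -
  obtain c :: "nat \<Rightarrow> real" and \<alpha> where
    bc: "\<And>F. finite F \<Longrightarrow> (\<Sum>j\<in>F. \<bar>c j\<bar> * r ^ mdeg (\<alpha> j)) \<le> M" and
    sc: "\<And>x. x \<in> cube r \<Longrightarrow> ((\<lambda>j. c j * monom_at (\<alpha> j) x) has_sum f x) UNIV"
    using f by (rule majE) blast
  have M: "0 \<le> M" using f maj_nonneg by blast
  define lin where "lin j x = (if mdeg (\<alpha> j) = 1 then c j * monom_at (\<alpha> j) x else 0)" for j x
  define D where "D x = (\<Sum>\<^sub>\<infinity>j. lin j x)" for x
  have lin: "linear (lin j)" for j
  proof (cases "mdeg (\<alpha> j) = 1")
    case True
    then obtain b where "\<And>x. monom_at (\<alpha> j) x = x \<bullet> b" by (rule mdeg_1_obtain) blast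
    then show ?thesis using True
      by (auto simp: lin_def[abs_def] linear_iff inner_add_left algebra_simps)
  qed (auto simp: lin_def[abs_def] linear_iff)
  have sl: "(\<lambda>j. lin j x) summable_on UNIV" for x
  proof -
    have "\<bar>lin j x\<bar> \<le> norm x / r * (\<bar>c j\<bar> * r ^ mdeg (\<alpha> j))" for j
    proof (cases "mdeg (\<alpha> j) = 1")
      case True
      then obtain b where b: "b \<in> Basis" "\<And>x. monom_at (\<alpha> j) x = x \<bullet> b" by (rule mdeg_1_obtain) blast
      then show ?thesis using True r mult_left_mono[OF Basis_le_norm[OF b(1), of x], of "\<bar>c j\<bar>"]
        by (simp add: lin_def abs_mult mult.commute[of "norm x"])
    qed (use r in \<open>auto simp: lin_def\<close>)
    then show ?thesis
    proof (rule finite_sums_imp_summable(2)[where M = "norm x / r * M", rotated])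
      fix F :: "nat set" assume "finite F"
      then show "(\<Sum>j\<in>F. norm x / r * (\<bar>c j\<bar> * r ^ mdeg (\<alpha> j))) \<le> norm x / r * M"
        unfolding sum_distrib_left[symmetric] using bc r by (intro mult_left_mono) auto
    qed
  qed
  then have hD: "((\<lambda>j. lin j x) has_sum D x) UNIV" for x
    unfolding D_def by simp
  have linD: "linear D"
  proof (rule linearI)
    show "D (x + y) = D x + D y" for x y
      using has_sum_unique[OF hD has_sum_add[OF hD hD, of x y, folded linear_add[OF lin]]] .
    show "D (k *\<^sub>R x) = k *\<^sub>R D x" for k x
      using has_sum_unique[OF hD, of "k *\<^sub>R x" "k * D x"] has_sum_cmult_right[OF hD, of k x]
      by (simp add: linear_scale[OF lin])
  qed
  have diff: "maj q (2 * M / r * s * d) (\<lambda>\<xi>. (f (x \<xi>) - D (x \<xi>)) - (f (y \<xi>) - D (y \<xi>)))"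
    if s: "0 \<le> s" "s \<le> 1/2" and q: "0 \<le> q"
     and x: "\<And>b. b \<in> Basis \<Longrightarrow> maj q (s * r) (\<lambda>\<xi>. x \<xi> \<bullet> b)"
     and y: "\<And>b. b \<in> Basis \<Longrightarrow> maj q (s * r) (\<lambda>\<xi>. y \<xi> \<bullet> b)"
     and xy: "\<And>b. b \<in> Basis \<Longrightarrow> maj q d (\<lambda>\<xi>. x \<xi> \<bullet> b - y \<xi> \<bullet> b)"
   for s q d and x y :: "'e::euclidean_space \<Rightarrow> 'a"
  proof (rule maj_has_sum)
    define c' where "c' j = (if mdeg (\<alpha> j) < 2 then 0 else c j)" for j
    let ?n = "\<lambda>j. mdeg (\<alpha> j)"
    show "maj q (\<bar>c' j\<bar> * (real (?n j) * (s * r) ^ (?n j - 1) * d))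
       (\<lambda>\<xi>. c' j * (monom_at (\<alpha> j) (x \<xi>) - monom_at (\<alpha> j) (y \<xi>)))" for j
      by (intro maj_cmult maj_monom_at_diff q x y xy)
    obtain b0 :: 'a where "b0 \<in> Basis" using nonempty_Basis by blast
    then have d: "0 \<le> d" using xy maj_nonneg by blast
    have t: "\<bar>c' j\<bar> * (real (?n j) * (s * r) ^ (?n j - 1) * d) \<le> (2 * s * d / r) * (\<bar>c j\<bar> * r ^ ?n j)" for j
    proof (cases "?n j < 2")
      case False
      then have "real (?n j) * s ^ (?n j - 1) \<le> 2 * s" using mult_power_pred_le s by auto
      then have "\<bar>c j\<bar> * r ^ (?n j - 1) * d * (real (?n j) * s ^ (?n j - 1)) \<le> \<bar>c j\<bar> * r ^ (?n j - 1) * d * (2 * s)"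
        using r d by (intro mult_left_mono) auto
      moreover have "r ^ ?n j = r * r ^ (?n j - 1)" using False by (cases "?n j") auto
      ultimately show ?thesis using False r by (simp add: c'_def power_mult_distrib mult_ac)
    qed (use s d r in \<open>simp add: c'_def\<close>)
    show "(\<Sum>j\<in>F. \<bar>c' j\<bar> * (real (?n j) * (s * r) ^ (?n j - 1) * d)) \<le> 2 * M / r * s * d" if F: "finite F" for F
    proof -
      have "(\<Sum>j\<in>F. \<bar>c' j\<bar> * (real (?n j) * (s * r) ^ (?n j - 1) * d)) \<le> (2 * s * d / r) * (\<Sum>j\<in>F. \<bar>c j\<bar> * r ^ ?n j)"
        unfolding sum_distrib_left by (intro sum_mono t)
      also have "\<dots> \<le> (2 * s * d / r) * M"
        using bc[OF F] s d r by (intro mult_left_mono) auto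
      finally show ?thesis by (simp add: mult_ac)
    qed
    show "((\<lambda>j. c' j * (monom_at (\<alpha> j) (x \<xi>) - monom_at (\<alpha> j) (y \<xi>))) has_sum
       f (x \<xi>) - D (x \<xi>) - (f (y \<xi>) - D (y \<xi>))) UNIV" if "\<xi> \<in> cube q" for \<xi>
    proof -
      have "s * r \<le> r" using s r by simp
      then have "x \<xi> \<in> cube r" "y \<xi> \<in> cube r"
        using maj_bound[OF x that] maj_bound[OF y that] \<open>s * r \<le> r\<close> by (force simp: cube_def)+
      then have "((\<lambda>j. (c j * monom_at (\<alpha> j) (x \<xi>) - lin j (x \<xi>)) - (c j * monom_at (\<alpha> j) (y \<xi>) - lin j (y \<xi>))) has_sum
         f (x \<xi>) - D (x \<xi>) - (f (y \<xi>) - D (y \<xi>))) UNIV"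
        unfolding diff_conv_add_uminus by (intro has_sum_add has_sum_uminusI sc hD)
      moreover have "(c j * monom_at (\<alpha> j) (x \<xi>) - lin j (x \<xi>)) - (c j * monom_at (\<alpha> j) (y \<xi>) - lin j (y \<xi>))
         = c' j * (monom_at (\<alpha> j) (x \<xi>) - monom_at (\<alpha> j) (y \<xi>))" for j
        by (cases "?n j = 0") (auto simp: lin_def c'_def algebra_simps monom_at_deg_0)
      ultimately show ?thesis by simp
    qed
  qed
  have "(f has_derivative D) (at 0)"
  proof (rule has_derivativeI)
    show "bounded_linear D" using linD by (simp add: linear_conv_bounded_linear)
    have D0: "D 0 = 0" using linD linear_0 by blast
    have "\<bar>(f x - f 0) - D x\<bar> / norm x \<le> 2 * M / r * (norm x / r)" if "norm x \<le> r / 2" "x \<noteq> 0" for x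
    proof -
      \<comment> \<open>Constant curves at radius 0, with \<open>s = norm x / r\<close> and
        \<open>d = norm x\<close>: the remainder is of the order of the square of
        \<open>norm x\<close>.\<close>
      have "maj 0 (2 * M / r * (norm x / r) * norm x) (\<lambda>\<xi> :: real. (f x - D x) - (f 0 - D 0))"
        by (rule diff) (use that r in \<open>auto simp: field_simps intro!: maj_mono[OF maj_const] Basis_le_norm\<close>)
      then have "\<bar>(f x - D x) - (f 0 - D 0)\<bar> \<le> 2 * M / r * (norm x / r) * norm x"
        by (rule maj_bound[where x = 0]) (simp add: cube_def)
      then show ?thesis using that by (simp add: D0 field_simps)
    qed
    moreover have "eventually (\<lambda>x. norm x \<le> r / 2 \<and> x \<noteq> 0) (at (0::'a))"
      using r by (auto simp: eventually_at dist_norm intro!: exI[of _ "r / 2"])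
    ultimately have ev: "eventually (\<lambda>x. norm (\<bar>(f x - f 0) - D x\<bar> / norm x) \<le> 2 * M / r * (norm x / r)) (at 0)"
      by (auto elim!: eventually_mono)
    have "((\<lambda>x. 2 * M / r * (norm x / r)) \<longlongrightarrow> 2 * M / r * (0 / r)) (at 0)"
      by (intro tendsto_intros tendsto_norm_zero) (use r in auto)
    then have "((\<lambda>x. \<bar>(f x - f 0) - D x\<bar> / norm x) \<longlongrightarrow> 0) (at 0)"
      by (intro Lim_null_comparison[OF ev]) simp
    then show "((\<lambda>y. ((f y - f 0) - D (y - 0)) /\<^sub>R norm (y - 0)) \<longlongrightarrow> 0) (at 0)"
      by (subst tendsto_norm_zero_iff[symmetric]) (simp add: divide_inverse mult.commute abs_mult)
  qed
  with diff that show ?thesis by blast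
qed

lemma geometric_half_bound:
  fixes q :: real
  assumes "0 \<le> q" "finite F" shows "(\<Sum>n\<in>F. q / 2 ^ n) \<le> 2 * q"
proof -
  obtain N where N: "F \<subseteq> {..<N}" using finite_nat_iff_bounded assms(2) by blast
  have "(\<Sum>n\<in>F. q / 2 ^ n) \<le> (\<Sum>n<N. q / 2 ^ n)"
    using assms N by (intro sum_mono2) auto
  also have "\<dots> = 2 * q - 2 * q / 2 ^ N"
    by (induction N) (auto simp: field_simps)
  also have "\<dots> \<le> 2 * q" using assms by simp
  finally show ?thesis .
qed

text \<open>Picard iteration
  \<open>X (Suc n) \<eta> = \<eta> - (F (X n \<eta>) - X n \<eta>)\<close>, carried out on
  majorants: the increments have majorants \<open>q / 2 ^ n\<close>, so the iterates keep majorants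
  below \<open>2 * q\<close> and the limit is again a majorized series.\<close>

lemma maj_inverse_normalized:
  fixes F :: "'a::euclidean_space \<Rightarrow> 'a"
  assumes r: "0 < r" and maj: "\<And>b. b \<in> Basis \<Longrightarrow> maj r M (\<lambda>x. F x \<bullet> b)"
    and F0: "F 0 = 0" and der: "(F has_derivative (\<lambda>x. x)) (at 0)"
  obtains G q where "0 < q" "\<And>b. b \<in> Basis \<Longrightarrow> maj q (2 * q) (\<lambda>\<eta>. G \<eta> \<bullet> b)" "G 0 = 0"
    "\<And>\<eta>. \<eta> \<in> cube q \<Longrightarrow> F (G \<eta>) = \<eta>"
proof -
  define h where "h b x = F x \<bullet> b - x \<bullet> b" for b x
  have contr: "maj q (2 * M / r * s * d) (\<lambda>\<xi>. h b (x \<xi>) - h b (y \<xi>))"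
    if b: "b \<in> Basis" and s: "0 \<le> s" "s \<le> 1/2" and q: "0 \<le> q"
     and x: "\<And>b. b \<in> Basis \<Longrightarrow> maj q (s * r) (\<lambda>\<xi>. x \<xi> \<bullet> b)"
     and y: "\<And>b. b \<in> Basis \<Longrightarrow> maj q (s * r) (\<lambda>\<xi>. y \<xi> \<bullet> b)"
     and xy: "\<And>b. b \<in> Basis \<Longrightarrow> maj q d (\<lambda>\<xi>. x \<xi> \<bullet> b - y \<xi> \<bullet> b)"
   for b s q d and x y :: "'a \<Rightarrow> 'a"
  proof (rule maj_nonlinear_part[OF maj[OF b] r])
    fix D
    assume D: "((\<lambda>x. F x \<bullet> b) has_derivative D) (at 0)" and
     *: "\<And>s q d (x :: 'a \<Rightarrow> 'a) y. \<lbrakk>0 \<le> s; s \<le> 1/2; 0 \<le> q;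
      \<And>b. b \<in> Basis \<Longrightarrow> maj q (s * r) (\<lambda>\<xi>. x \<xi> \<bullet> b); \<And>b. b \<in> Basis \<Longrightarrow> maj q (s * r) (\<lambda>\<xi>. y \<xi> \<bullet> b);
      \<And>b. b \<in> Basis \<Longrightarrow> maj q d (\<lambda>\<xi>. x \<xi> \<bullet> b - y \<xi> \<bullet> b)\<rbrakk>
      \<Longrightarrow> maj q (2 * M / r * s * d) (\<lambda>\<xi>. (F (x \<xi>) \<bullet> b - D (x \<xi>)) - (F (y \<xi>) \<bullet> b - D (y \<xi>)))"
    have "((\<lambda>x. F x \<bullet> b) has_derivative (\<lambda>x. x \<bullet> b)) (at 0)"
      using der by (rule has_derivative_inner_left)
    then have "D = (\<lambda>x. x \<bullet> b)" using D has_derivative_unique by blast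
    then show ?thesis unfolding h_def using *[OF s q x y xy] by simp
  qed
  obtain b0 :: 'a where "b0 \<in> Basis" using nonempty_Basis by blast
  then have M: "0 \<le> M" using maj maj_nonneg by blast
  \<comment> \<open>Makes the contraction factor \<open>2 * M / r * s\<close> at most 1/2;
    \<open>M + 1\<close> avoids a division by 0.\<close>
  define s where "s = min (1/2) (r / (4 * (M + 1)))"
  have s: "0 < s" "s \<le> 1/2" using r M unfolding s_def by (simp_all only: min.cobounded1) simp
  have "s \<le> r / (4 * (M + 1))" by (simp add: s_def)
  then have "s * (4 * (M + 1)) \<le> r" using M by (simp add: field_simps)
  then have "4 * M * s \<le> r" using s by (simp add: algebra_simps)
  then have half: "2 * M / r * s \<le> 1/2" using r by (simp add: field_simps)
  \<comment> \<open>The iterates are majorized by \<open>2 * q = s * r\<close>, the range in which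
    the contraction estimate applies.\<close>
  define q where "q = s * r / 2"
  have q: "0 < q" "s * r = 2 * q" using s r by (auto simp: q_def)
  define X where "X = rec_nat (\<lambda>_. 0 :: 'a) (\<lambda>_ x \<eta>. \<eta> - (F (x \<eta>) - x \<eta>))"
  have X0: "X 0 \<eta> = 0" and XS: "X (Suc n) \<eta> = \<eta> - (F (X n \<eta>) - X n \<eta>)" for n \<eta>
    by (auto simp: X_def)
  have XSb: "X (Suc n) \<eta> \<bullet> b = \<eta> \<bullet> b - h b (X n \<eta>)" for n \<eta> b
    by (simp add: XS h_def inner_diff_left)
  have main: "(\<forall>b\<in>Basis. maj q (2 * q - 2 * q / 2 ^ n) (\<lambda>\<eta>. X n \<eta> \<bullet> b)) \<and>
      (\<forall>b\<in>Basis. maj q (q / 2 ^ n) (\<lambda>\<eta>. X (Suc n) \<eta> \<bullet> b - X n \<eta> \<bullet> b))" for n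
  proof (induction n)
    case 0
    then show ?case using q maj_zero[of q] by (auto simp: XSb X0 h_def F0 maj_coord)
  next
    case (Suc n)
    have size: "maj q (2 * q - 2 * q / 2 ^ Suc n) (\<lambda>\<eta>. X (Suc n) \<eta> \<bullet> b)" if b: "b \<in> Basis" for b
    proof -
      have "maj q ((2 * q - 2 * q / 2 ^ n) + q / 2 ^ n) (\<lambda>\<eta>. X n \<eta> \<bullet> b + (X (Suc n) \<eta> \<bullet> b - X n \<eta> \<bullet> b))"
        using Suc b by (intro maj_add) auto
      then show ?thesis by (simp add: field_simps)
    qed
    have "maj q (q / 2 ^ Suc n) (\<lambda>\<eta>. X (Suc (Suc n)) \<eta> \<bullet> b - X (Suc n) \<eta> \<bullet> b)" if b: "b \<in> Basis" for b
    proof -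
      have le: "2 * q - 2 * q / 2 ^ k \<le> s * r" for k :: nat using q by simp
      have "maj q (2 * M / r * s * (q / 2 ^ n)) (\<lambda>\<eta>. h b (X (Suc n) \<eta>) - h b (X n \<eta>))"
        using s q Suc by (intro contr b maj_mono[OF size _ _ le] maj_mono[OF bspec[OF conjunct1[OF Suc]] _ _ le]) auto
      then have "maj q (q / 2 ^ Suc n) (\<lambda>\<eta>. h b (X (Suc n) \<eta>) - h b (X n \<eta>))"
        by (rule maj_mono) (use q mult_right_mono[OF half, of "q / 2 ^ n"] in auto)
      from maj_uminus[OF this] show ?thesis by (simp add: XSb algebra_simps)
    qed
    with size show ?case by blast
  qed
  define g where "g b \<eta> = (\<Sum>\<^sub>\<infinity>n. X (Suc n) \<eta> \<bullet> b - X n \<eta> \<bullet> b)" for b \<eta>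
  define G where "G \<eta> = (\<Sum>b\<in>Basis. g b \<eta> *\<^sub>R b)" for \<eta>
  have Gb: "G \<eta> \<bullet> b = g b \<eta>" if "b \<in> Basis" for b \<eta>
    using that by (simp add: G_def inner_sum_left inner_Basis if_distrib cong: if_cong)
  have hs: "((\<lambda>n. X (Suc n) \<eta> \<bullet> b - X n \<eta> \<bullet> b) has_sum g b \<eta>) UNIV" if "b \<in> Basis" "\<eta> \<in> cube q" for b \<eta>
  proof -
    have "\<bar>X (Suc n) \<eta> \<bullet> b - X n \<eta> \<bullet> b\<bar> \<le> q / 2 ^ n" for n
      using maj_bound[OF bspec[OF conjunct2[OF main]], OF that] .
    from finite_sums_imp_summable(2)[OF geometric_half_bound this] q show ?thesis
      unfolding g_def by simp
  qed
  have majG: "maj q (2 * q) (\<lambda>\<eta>. G \<eta> \<bullet> b)" if "b \<in> Basis" for b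
  proof (rule maj_has_sum[where f = "\<lambda>n \<eta>. X (Suc n) \<eta> \<bullet> b - X n \<eta> \<bullet> b"])
    show "maj q (q / 2 ^ n) (\<lambda>\<eta>. X (Suc n) \<eta> \<bullet> b - X n \<eta> \<bullet> b)" for n using main that by blast
    show "(\<Sum>n\<in>F. q / 2 ^ n) \<le> 2 * q" if "finite F" for F
      using geometric_half_bound q that by auto
  qed (use hs that Gb in auto)
  have lim: "(\<lambda>n. X n \<eta>) \<longlonglongrightarrow> G \<eta>" if \<eta>: "\<eta> \<in> cube q" for \<eta>
  proof (rule tendsto_componentwise1 | subst tendsto_componentwise_iff)
    show "\<forall>b\<in>Basis. ((\<lambda>n. X n \<eta> \<bullet> b) \<longlonglongrightarrow> G \<eta> \<bullet> b)"
    proof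
      fix b :: 'a assume b: "b \<in> Basis"
      have "(\<lambda>n. \<Sum>i<n. X (Suc i) \<eta> \<bullet> b - X i \<eta> \<bullet> b) \<longlonglongrightarrow> g b \<eta>"
        using has_sum_imp_sums[OF hs[OF b \<eta>]] by (simp add: sums_def)
      moreover have "(\<Sum>i<n. X (Suc i) \<eta> \<bullet> b - X i \<eta> \<bullet> b) = X n \<eta> \<bullet> b" for n
        by (subst sum_lessThan_telescope) (simp add: X0)
      ultimately show "(\<lambda>n. X n \<eta> \<bullet> b) \<longlonglongrightarrow> G \<eta> \<bullet> b" by (simp add: Gb b)
    qed
  qed
  have "F (G \<eta>) = \<eta>" if \<eta>: "\<eta> \<in> cube q" for \<eta>
  proof (rule euclidean_eqI)
    fix b :: 'a assume b: "b \<in> Basis"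
    \<comment> \<open>The limit of the fixed point equation is taken pointwise; the continuity of
      \<open>h b\<close> comes from the contraction estimate at radius 0.\<close>
    have "\<bar>h b (X n \<eta>) - h b (G \<eta>)\<bar> \<le> 1/2 * norm (X n \<eta> - G \<eta>)" for n
    proof -
      have "maj 0 (2 * M / r * s * norm (X n \<eta> - G \<eta>)) (\<lambda>\<xi>::'a. h b (X n \<eta>) - h b (G \<eta>))"
      proof (rule contr[OF b])
        fix b :: 'a assume b: "b \<in> Basis"
        have "\<bar>X n \<eta> \<bullet> b\<bar> \<le> 2 * q - 2 * q / 2 ^ n"
          using maj_bound[OF bspec[OF conjunct1[OF main] b] \<eta>] .
        then have "\<bar>X n \<eta> \<bullet> b\<bar> \<le> 2 * q"
            by (rule order_trans) (use q in simp)
          then have "\<bar>X n \<eta> \<bullet> b\<bar> \<le> s * r" using q by simp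
        then show "maj 0 (s * r) (\<lambda>\<xi>::'a. X n \<eta> \<bullet> b)"
          by (intro maj_mono[OF maj_const]) auto
        show "maj 0 (s * r) (\<lambda>\<xi>::'a. G \<eta> \<bullet> b)"
          using maj_bound[OF majG[OF b] \<eta>] q by (intro maj_mono[OF maj_const]) auto
        show "maj 0 (norm (X n \<eta> - G \<eta>)) (\<lambda>\<xi>::'a. X n \<eta> \<bullet> b - G \<eta> \<bullet> b)"
          using Basis_le_norm[OF b, of "X n \<eta> - G \<eta>"] by (intro maj_mono[OF maj_const]) (auto simp: inner_diff_left)
      qed (use s in auto)
      then have "\<bar>h b (X n \<eta>) - h b (G \<eta>)\<bar> \<le> 2 * M / r * s * norm (X n \<eta> - G \<eta>)"
        by (rule maj_bound[where x = 0]) (simp add: cube_def)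
      also have "\<dots> \<le> 1/2 * norm (X n \<eta> - G \<eta>)" using half by (rule mult_right_mono) simp
      finally show ?thesis .
    qed
    then have "eventually (\<lambda>n. norm (h b (X n \<eta>) - h b (G \<eta>)) \<le> 1/2 * norm (X n \<eta> - G \<eta>)) sequentially" by simp
    moreover have "(\<lambda>n. 1/2 * norm (X n \<eta> - G \<eta>)) \<longlonglongrightarrow> 0"
      by (intro tendsto_mult_right_zero tendsto_norm_zero LIM_zero lim \<eta>)
    ultimately have "(\<lambda>n. h b (X n \<eta>) - h b (G \<eta>)) \<longlonglongrightarrow> 0"
      by (rule Lim_null_comparison)
    then have "(\<lambda>n. h b (X n \<eta>)) \<longlonglongrightarrow> h b (G \<eta>)" by (rule LIM_zero_cancel)
    then have "(\<lambda>n. X (Suc n) \<eta> \<bullet> b) \<longlonglongrightarrow> \<eta> \<bullet> b - h b (G \<eta>)"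
      unfolding XSb by (intro tendsto_intros)
    moreover have "(\<lambda>n. X (Suc n) \<eta> \<bullet> b) \<longlonglongrightarrow> G \<eta> \<bullet> b"
      by (rule tendsto_inner[OF LIMSEQ_Suc[OF lim[OF \<eta>]] tendsto_const])
    ultimately have "G \<eta> \<bullet> b = \<eta> \<bullet> b - h b (G \<eta>)" using LIMSEQ_unique by blast
    then show "F (G \<eta>) \<bullet> b = \<eta> \<bullet> b" by (simp add: h_def)
  qed
  moreover have "G 0 = 0"
  proof -
    have "X n 0 = 0" for n by (induction n) (auto simp: X0 XS F0)
    then show ?thesis by (simp add: G_def g_def)
  qed
  ultimately show ?thesis by (intro that[OF q(1) majG])
qed

section \<open>Analytic maps\<close>

definition ana :: "('a::euclidean_space \<Rightarrow> 'b::euclidean_space) \<Rightarrow> 'a \<Rightarrow> bool" where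
  "ana f a \<longleftrightarrow> (\<forall>b\<in>Basis. \<exists>r M. 0 < r \<and> maj r M (\<lambda>x. f (a + x) \<bullet> b))"

lemma anaI:
  assumes "0 < r" "\<And>b. b \<in> Basis \<Longrightarrow> maj r (M b) (\<lambda>x. f (a + x) \<bullet> b)"
  shows "ana f a"
  using assms unfolding ana_def by blast

lemma ana_uniform:
  assumes "ana f a"
  obtains r M where "0 < r" "0 \<le> M" "\<And>b. b \<in> Basis \<Longrightarrow> maj r M (\<lambda>x. f (a + x) \<bullet> b)"
proof -
  obtain r M where rM: "\<And>b. b \<in> Basis \<Longrightarrow> 0 < r b \<and> maj (r b) (M b) (\<lambda>x. f (a + x) \<bullet> b)"
    using assms unfolding ana_def by metis
  define r0 M0 where "r0 = Min (r ` Basis)" and "M0 = Max (M ` Basis)"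
  have 1: "0 < r0" using rM by (auto simp: r0_def)
  have 2: "maj r0 M0 (\<lambda>x. f (a + x) \<bullet> b)" if "b \<in> Basis" for b
    by (rule maj_mono[OF conjunct2[OF rM[OF that]]]) (use 1 that in \<open>auto simp: r0_def M0_def\<close>)
  moreover have "0 \<le> M0"
    using 2 maj_nonneg SOME_Basis by blast
  ultimately show ?thesis using that 1 by blast
qed

lemma ana_cong:
  assumes "ana f a" and "eventually (\<lambda>x. f x = g x) (nhds a)"
  shows "ana g a"
proof -
  obtain r M where r: "0 < r" "\<And>b. b \<in> Basis \<Longrightarrow> maj r M (\<lambda>x. f (a + x) \<bullet> b)"
    using ana_uniform[OF assms(1)] by metis
  obtain e where e: "0 < e" "\<And>x. dist x a < e \<Longrightarrow> f x = g x"
    using assms(2) by (auto simp: eventually_nhds_metric)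
  \<comment> \<open>The cube of radius \<open>s\<close> lies in the ball of radius \<open>e\<close>,
    since the Euclidean norm is at most the sum of the absolute coordinates.\<close>
  define s where "s = min r (e / (2 * real DIM('a)))"
  have s: "0 < s" "s \<le> r" "s * real DIM('a) < e"
  proof -
    have "s \<le> e / (2 * real DIM('a))" by (simp add: s_def)
    then have "s * real DIM('a) \<le> e / 2" by (simp add: field_simps)
    then show "s * real DIM('a) < e" using e by linarith
  qed (use r e in \<open>auto simp: s_def\<close>)
  have eq: "f (a + x) = g (a + x)" if "x \<in> cube s" for x
  proof (rule e(2))
    have "norm x \<le> (\<Sum>b\<in>Basis. \<bar>x \<bullet> b\<bar>)" by (rule norm_le_l1)
    also have "\<dots> \<le> (\<Sum>b\<in>(Basis::'a set). s)" using that by (intro sum_mono) (auto simp: cube_def)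
    also have "\<dots> < e" using s by (simp add: mult.commute)
    finally show "dist (a + x) a < e" by (simp add: dist_norm)
  qed
  have "maj s M (\<lambda>x. g (a + x) \<bullet> b)" if "b \<in> Basis" for b
    by (rule maj_cong[OF maj_mono[OF r(2)[OF that]]]) (use s eq in auto)
  then show ?thesis by (rule anaI[OF s(1)])
qed

lemma ana_const: "ana (\<lambda>x. k) a"
  by (rule anaI[where r = 1], simp, rule maj_const) simp

lemma ana_bounded_linear:
  fixes f :: "'a::euclidean_space \<Rightarrow> 'b::euclidean_space"
  assumes "bounded_linear f" shows "ana f a"
proof (rule anaI)
  fix b :: 'b assume "b \<in> Basis"
  interpret bounded_linear f by fact
  have "maj 1 (\<bar>f a \<bullet> b\<bar> + (\<Sum>i\<in>Basis. \<bar>f i \<bullet> b\<bar> * 1)) (\<lambda>x. f a \<bullet> b + (\<Sum>i\<in>Basis. (f i \<bullet> b) * (x \<bullet> i)))"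
    by (intro maj_add maj_sum maj_const maj_cmult maj_coord) auto
  moreover have "f (a + x) \<bullet> b = f a \<bullet> b + (\<Sum>i\<in>Basis. (f i \<bullet> b) * (x \<bullet> i))" for x
  proof -
    have "f x = f (\<Sum>i\<in>Basis. (x \<bullet> i) *\<^sub>R i)" by (simp add: euclidean_representation)
    then show ?thesis by (simp add: add sum scale inner_add_left inner_sum_left mult.commute)
  qed
  ultimately show "maj 1 (\<bar>f a \<bullet> b\<bar> + (\<Sum>i\<in>Basis. \<bar>f i \<bullet> b\<bar> * 1)) (\<lambda>x. f (a + x) \<bullet> b)" by simp
qed simp

lemma ana_bounded_bilinear:
  fixes prod :: "'b::euclidean_space \<Rightarrow> 'c::euclidean_space \<Rightarrow> 'd::euclidean_space"
  assumes "bounded_bilinear prod" "ana f a" "ana g a"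
  shows "ana (\<lambda>x. prod (f x) (g x)) a"
proof -
  interpret bounded_bilinear prod by fact
  obtain r M where r: "0 < r" "\<And>b. b \<in> Basis \<Longrightarrow> maj r M (\<lambda>x. f (a + x) \<bullet> b)"
    using ana_uniform[OF assms(2)] by metis
  obtain s N where s: "0 < s" "\<And>b. b \<in> Basis \<Longrightarrow> maj s N (\<lambda>x. g (a + x) \<bullet> b)"
    using ana_uniform[OF assms(3)] by metis
  let ?q = "min r s"
  have "maj ?q (\<Sum>i\<in>Basis. \<Sum>j\<in>Basis. \<bar>prod i j \<bullet> b\<bar> * (M * N))
    (\<lambda>x. \<Sum>i\<in>Basis. \<Sum>j\<in>Basis. (prod i j \<bullet> b) * ((f (a + x) \<bullet> i) * (g (a + x) \<bullet> j)))"
    for b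
    by (intro maj_sum maj_cmult maj_mult maj_mono[OF r(2)] maj_mono[OF s(2)]) (use r s in auto)
  moreover have "prod (f x) (g x) \<bullet> b = (\<Sum>i\<in>Basis. \<Sum>j\<in>Basis. (prod i j \<bullet> b) * ((f x \<bullet> i) * (g x \<bullet> j)))" for x b
  proof -
    have "prod (f x) (g x) = prod (\<Sum>i\<in>Basis. (f x \<bullet> i) *\<^sub>R i) (\<Sum>i\<in>Basis. (g x \<bullet> i) *\<^sub>R i)"
      by (simp add: euclidean_representation)
    also have "\<dots> = (\<Sum>j\<in>Basis. \<Sum>i\<in>Basis. ((f x \<bullet> i) * (g x \<bullet> j)) *\<^sub>R prod i j)"
      by (simp add: sum_left sum_right scaleR_left scaleR_right scaleR_sum_right mult_ac)
    also have "\<dots> = (\<Sum>i\<in>Basis. \<Sum>j\<in>Basis. ((f x \<bullet> i) * (g x \<bullet> j)) *\<^sub>R prod i j)"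
      by (rule sum.swap)
    finally show ?thesis by (simp add: inner_sum_left mult_ac)
  qed
  ultimately show ?thesis
    using r s by (intro anaI[where r = ?q]) auto
qed

lemmas ana_scaleR = ana_bounded_bilinear[OF bounded_bilinear_scaleR]
lemmas ana_inner = ana_bounded_bilinear[OF bounded_bilinear_inner]
lemmas ana_mult = ana_bounded_bilinear[OF bounded_bilinear_mult]

lemma ana_compose:
  assumes f: "ana f (g a)" and g: "ana g a" shows "ana (\<lambda>x. f (g x)) a"
proof -
  obtain r M where r: "0 < r" "\<And>b. b \<in> Basis \<Longrightarrow> maj r M (\<lambda>x. f (g a + x) \<bullet> b)"
    using ana_uniform[OF f] by metis
  obtain s N where s: "0 < s" "0 \<le> N" "\<And>b. b \<in> Basis \<Longrightarrow> maj s N (\<lambda>x. g (a + x) \<bullet> b)"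
    using ana_uniform[OF g] by metis
  \<comment> \<open>Shrinking by \<open>k\<close> brings the majorant of \<open>g - g a\<close>
    below \<open>r\<close>, as substitution into the series of \<open>f\<close> requires.\<close>
  define k where "k = min 1 (r / (N + 1))"
  have k: "0 < k" "k \<le> 1" using r s by (auto simp: k_def)
  have "k \<le> r / (N + 1)" by (simp add: k_def)
  then have kN: "k * N \<le> r" using s k by (simp add: field_simps)
  have G: "maj (k * s) r (\<lambda>x. (g (a + x) - g a) \<bullet> b)" if "b \<in> Basis" for b
    using maj_mono[OF maj_shrink[OF s(3)[OF that], of k] _ _ kN, of "k * s"] k s by (simp add: inner_diff_left)
  have "maj (k * s) M (\<lambda>x. f (g a + (g (a + x) - g a)) \<bullet> b)" if "b \<in> Basis" for b
    by (rule maj_compose[OF r(2)[OF that]]) (use G k s in auto)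
  then show ?thesis using k s by (intro anaI[where r = "k * s"]) auto
qed

lemma ana_linear_compose: "bounded_linear f \<Longrightarrow> ana g a \<Longrightarrow> ana (\<lambda>x. f (g x)) a"
  using ana_compose ana_bounded_linear by blast

lemma ana_ident: "ana (\<lambda>x. x) a"
  by (rule ana_bounded_linear) (rule bounded_linear_ident)

lemma ana_Pair:
  assumes "ana f a" "ana g a" shows "ana (\<lambda>x. (f x, g x)) a"
  using assms unfolding ana_def Basis_prod_def by (auto simp: inner_Pair)

lemma ana_fst: "ana f a \<Longrightarrow> ana (\<lambda>x. fst (f x)) a" by (rule ana_linear_compose[OF bounded_linear_fst])
lemma ana_snd: "ana f a \<Longrightarrow> ana (\<lambda>x. snd (f x)) a" by (rule ana_linear_compose[OF bounded_linear_snd])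

lemma ana_add: assumes "ana f a" "ana g a" shows "ana (\<lambda>x. f x + g x) a"
proof -
  obtain r M where r: "0 < r" "\<And>b. b \<in> Basis \<Longrightarrow> maj r M (\<lambda>x. f (a + x) \<bullet> b)"
    using ana_uniform[OF assms(1)] by metis
  obtain s N where s: "0 < s" "\<And>b. b \<in> Basis \<Longrightarrow> maj s N (\<lambda>x. g (a + x) \<bullet> b)"
    using ana_uniform[OF assms(2)] by metis
  have "maj (min r s) (M + N) (\<lambda>x. f (a + x) \<bullet> b + g (a + x) \<bullet> b)"
    if "b \<in> Basis" for b
    by (intro maj_add maj_mono[OF r(2)] maj_mono[OF s(2)]) (use r s that in auto)
  then show ?thesis
    using r s by (intro anaI[where r = "min r s"]) (auto simp: inner_add_left)
qed

lemma ana_minus: "ana f a \<Longrightarrow> ana (\<lambda>x. - f x) a"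
  by (rule ana_linear_compose[OF bounded_linear_minus[OF bounded_linear_ident]])

lemma ana_diff: "ana f a \<Longrightarrow> ana g a \<Longrightarrow> ana (\<lambda>x. f x - g x) a"
  using ana_add[OF _ ana_minus] by fastforce

lemma ana_sum: "(\<And>i. i \<in> I \<Longrightarrow> ana (f i) a) \<Longrightarrow> ana (\<lambda>x. \<Sum>i\<in>I. f i x) a"
  by (induction I rule: infinite_finite_induct) (auto intro!: ana_const ana_add)

lemma ana_power:
  fixes f :: "'a::euclidean_space \<Rightarrow> 'b::{euclidean_space,real_normed_algebra_1}"
  shows "ana f a \<Longrightarrow> ana (\<lambda>x. f x ^ n) a"
  by (induction n) (auto intro!: ana_const ana_mult)

lemma ana_cnj: "ana f a \<Longrightarrow> ana (\<lambda>x. cnj (f x)) a" by (rule ana_linear_compose[OF bounded_linear_cnj])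
lemma ana_of_real: "ana f a \<Longrightarrow> ana (\<lambda>x. complex_of_real (f x)) a"
  by (rule ana_linear_compose[OF bounded_linear_of_real])

text \<open>Re-expansion at a nearby point \<open>y\<close> is the substitution of
  \<open>(y - a) + x\<close>, whose components have majorant \<open>r / 2 + r / 2\<close>.\<close>

lemma ana_eventually:
  assumes "ana f a" shows "eventually (ana f) (nhds a)"
proof -
  obtain r M where r: "0 < r" "\<And>b. b \<in> Basis \<Longrightarrow> maj r M (\<lambda>x. f (a + x) \<bullet> b)"
    using ana_uniform[OF assms] by metis
  have "ana f y" if "dist y a < r / 2" for y
  proof (rule anaI)
    fix b :: 'b assume b: "b \<in> Basis"
    have "maj (r / 2) M (\<lambda>x. f (a + ((y - a) + x)) \<bullet> b)"
    proof (rule maj_compose[OF r(2)[OF b]])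
      fix i :: 'a assume i: "i \<in> Basis"
      have "\<bar>(y - a) \<bullet> i\<bar> \<le> r / 2"
        using Basis_le_norm[OF i, of "y - a"] that by (simp add: dist_norm)
      then show "maj (r / 2) r (\<lambda>x. (y - a + x) \<bullet> i)"
        unfolding inner_add_left using r
        by (intro maj_mono[OF maj_add[OF maj_const maj_coord[of "r / 2", OF _ i]]]) auto
    qed (use r in auto)
    then show "maj (r / 2) M (\<lambda>x. f (y + x) \<bullet> b)" by simp
  qed (use r in simp)
  then show ?thesis using r by (auto simp: eventually_nhds_metric intro!: exI[of _ "r / 2"])
qed

section \<open>Termwise differentiation\<close>

lemma monom_at_has_derivative:
  "(monom_at \<alpha> has_derivative (\<lambda>h. \<Sum>b\<in>Basis. (h \<bullet> b) * (real (\<alpha> b) * monom_at (\<alpha>(b := \<alpha> b - 1)) x))) (at (x :: 'a::euclidean_space))"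
proof -
  have "((\<lambda>x. \<Prod>b\<in>Basis. (x \<bullet> b) ^ \<alpha> b) has_derivative
     (\<lambda>h. \<Sum>b\<in>Basis. (real (\<alpha> b) * (h \<bullet> b) * (x \<bullet> b) ^ (\<alpha> b - 1)) * (\<Prod>j\<in>Basis - {b}. (x \<bullet> j) ^ \<alpha> j))) (at x)"
    by (rule has_derivative_prod) (auto intro!: derivative_eq_intros)
  moreover have "monom_at (\<alpha>(b := \<alpha> b - 1)) x = (x \<bullet> b) ^ (\<alpha> b - 1) * (\<Prod>j\<in>Basis - {b}. (x \<bullet> j) ^ \<alpha> j)"
    if "b \<in> Basis" for b
    using that by (simp add: monom_at_def prod.remove[of Basis b])
  ultimately show ?thesis
    unfolding monom_at_def[of \<alpha>, abs_def] by (simp add: mult_ac cong: sum.cong)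
qed

lemma has_sum_sum_finite:
  fixes f :: "'i \<Rightarrow> 'j \<Rightarrow> 'a::topological_comm_monoid_add"
  assumes "finite I" "\<And>i. i \<in> I \<Longrightarrow> (f i has_sum s i) A"
  shows "((\<lambda>j. \<Sum>i\<in>I. f i j) has_sum sum s I) A"
  using assms by (induction I rule: finite_induct) (auto intro!: has_sum_add)

text \<open>Halving the radius pays for the factor \<open>n\<close> that differentiation brings into
  a monomial of degree \<open>n\<close>, because \<open>n \<le> 2 ^ (n - 1)\<close>. The summable
  bounds \<open>q\<close> then control the tails of the differentiated series uniformly.\<close>

lemma maj_has_derivative:
  fixes f :: "'a::euclidean_space \<Rightarrow> real"
  assumes f: "maj r M f" and r: "0 < r"
  obtains g where "\<And>b. b \<in> Basis \<Longrightarrow> maj (r / 2) (M / r) (g b)"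
    "\<And>x. (\<And>b. b \<in> Basis \<Longrightarrow> \<bar>x \<bullet> b\<bar> < r / 2) \<Longrightarrow> (f has_derivative (\<lambda>h. \<Sum>b\<in>Basis. (h \<bullet> b) * g b x)) (at x)"
proof -
  obtain c :: "nat \<Rightarrow> real" and \<alpha> where
    bc: "\<And>F. finite F \<Longrightarrow> (\<Sum>j\<in>F. \<bar>c j\<bar> * r ^ mdeg (\<alpha> j)) \<le> M" and
    sc: "\<And>x. x \<in> cube r \<Longrightarrow> ((\<lambda>j. c j * monom_at (\<alpha> j) x) has_sum f x) UNIV"
    using f by (rule majE) blast
  define q where "q j = \<bar>c j\<bar> * r ^ mdeg (\<alpha> j)" for j
  define \<alpha>' where "\<alpha>' b j = (\<alpha> j)(b := \<alpha> j b - 1)" for b j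
  define c' where "c' b j = c j * real (\<alpha> j b)" for b j
  define g where "g b x = (\<Sum>\<^sub>\<infinity>j. c' b j * monom_at (\<alpha>' b j) x)" for b x
  have pw: "real n * (r / 2) ^ (n - 1) \<le> r ^ n / r" for n
  proof (cases n)
    case (Suc m)
    have "real n * (r / 2) ^ (n - 1) = (real n / 2 ^ (n - 1)) * r ^ (n - 1)" by (simp add: power_divide)
    also have "\<dots> \<le> 1 * r ^ (n - 1)"
      using nat_le_two_power[of n] r by (intro mult_right_mono) auto
    finally show ?thesis using Suc r by simp
  qed (use r in auto)
  have dle: "real (\<alpha> j b) \<le> real (mdeg (\<alpha> j))" if "b \<in> Basis" for b j
    using that member_le_sum[of b Basis "\<alpha> j"] by (simp add: mdeg_def del: of_nat_sum)
  have md: "mdeg (\<alpha>' b j) = mdeg (\<alpha> j) - 1" if "b \<in> Basis" "\<alpha> j b \<noteq> 0" for b j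
    using that by (simp add: mdeg_def \<alpha>'_def sum.remove[of Basis b])
  have t: "\<bar>c' b j\<bar> * (r / 2) ^ mdeg (\<alpha>' b j) \<le> q j / r" if b: "b \<in> Basis" for b j
  proof (cases "\<alpha> j b = 0")
    case False
    have "\<bar>c' b j\<bar> * (r / 2) ^ mdeg (\<alpha>' b j) = \<bar>c j\<bar> * (real (\<alpha> j b) * (r / 2) ^ (mdeg (\<alpha> j) - 1))"
      using md[OF b False] by (simp add: c'_def abs_mult)
    also have "\<dots> \<le> \<bar>c j\<bar> * (real (mdeg (\<alpha> j)) * (r / 2) ^ (mdeg (\<alpha> j) - 1))"
      using dle[OF b] r by (intro mult_left_mono mult_right_mono) auto
    also have "\<dots> \<le> \<bar>c j\<bar> * (r ^ mdeg (\<alpha> j) / r)" by (intro mult_left_mono pw) auto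
    finally show ?thesis by (simp add: q_def)
  qed (use r in \<open>simp add: c'_def q_def\<close>)
  have bq: "(\<Sum>j\<in>F. \<bar>c' b j\<bar> * (r / 2) ^ mdeg (\<alpha>' b j)) \<le> M / r" if "finite F" "b \<in> Basis" for F b
  proof -
    have "(\<Sum>j\<in>F. \<bar>c' b j\<bar> * (r / 2) ^ mdeg (\<alpha>' b j)) \<le> (\<Sum>j\<in>F. q j) / r"
      unfolding sum_divide_distrib by (intro sum_mono t that)
    also have "\<dots> \<le> M / r" using bc[OF that(1)] r by (simp add: q_def divide_right_mono)
    finally show ?thesis .
  qed
  have hg: "((\<lambda>j. c' b j * monom_at (\<alpha>' b j) x) has_sum g b x) UNIV" if "b \<in> Basis" "x \<in> cube (r / 2)" for b x
  proof -
    have "\<bar>c' b j * monom_at (\<alpha>' b j) x\<bar> \<le> \<bar>c' b j\<bar> * (r / 2) ^ mdeg (\<alpha>' b j)" for j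
      unfolding abs_mult by (intro mult_left_mono monom_at_bound that) auto
    from finite_sums_imp_summable(2)[OF bq this] that show ?thesis unfolding g_def by simp
  qed
  have 1: "maj (r / 2) (M / r) (g b)" if "b \<in> Basis" for b
    by (rule majI[where c = "c' b" and \<alpha> = "\<alpha>' b"]) (use bq hg that r in auto)
  define S where "S = {x :: 'a. \<forall>b\<in>Basis. \<bar>x \<bullet> b\<bar> < r / 2}"
  define m where "m = - (r / 2)"
  \<comment> \<open>As an open box the region is convex, so that series can be differentiated on it,
    and open, so that the derivative within it is the full derivative.\<close>
  have Sbox: "S = box (\<Sum>b\<in>Basis. m *\<^sub>R b) (\<Sum>b\<in>Basis. (r / 2) *\<^sub>R b)"
  proof -
    have "(\<Sum>b\<in>Basis. k *\<^sub>R b) \<bullet> i = k" if "i \<in> Basis" for k and i :: 'a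
      using that by (simp add: inner_sum_left inner_Basis if_distrib cong: if_cong)
    then have "box (\<Sum>b\<in>Basis. m *\<^sub>R b) (\<Sum>b\<in>Basis. (r / 2) *\<^sub>R b) = {x :: 'a. \<forall>b\<in>Basis. m < x \<bullet> b \<and> x \<bullet> b < r / 2}"
      by (simp add: box_def)
    also have "\<dots> = S" by (auto simp: S_def m_def abs_less_iff)
    finally show ?thesis by simp
  qed
  have Sc: "S \<subseteq> cube (r / 2)" "cube (r / 2) \<subseteq> cube r" using cube_mono[of "r / 2" r] r by (auto simp: S_def cube_def less_imp_le)
  define D where "D j x h = c j * (\<Sum>b\<in>Basis. (h \<bullet> b) * (real (\<alpha> j b) * monom_at (\<alpha>' b j) x))" for j x h
  have D: "D j x h = (\<Sum>b\<in>Basis. (h \<bullet> b) * (c' b j * monom_at (\<alpha>' b j) x))" for j x h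
    by (simp add: D_def c'_def sum_distrib_left mult_ac)
  have Dsum: "((\<lambda>j. D j x h) has_sum (\<Sum>b\<in>Basis. (h \<bullet> b) * g b x)) UNIV" if "x \<in> S" for x h
    unfolding D using that Sc by (intro has_sum_sum_finite has_sum_cmult_right hg) auto
  have Dle: "\<bar>D j x h\<bar> \<le> q j * (real DIM('a) / r * norm h)" if "x \<in> S" for j x h
  proof -
    have "\<bar>D j x h\<bar> \<le> (\<Sum>b\<in>Basis. \<bar>h \<bullet> b\<bar> * \<bar>c' b j * monom_at (\<alpha>' b j) x\<bar>)"
      unfolding D abs_mult[symmetric] by (rule sum_abs)
    also have "\<dots> \<le> (\<Sum>b\<in>(Basis::'a set). norm h * (q j / r))"
    proof (rule sum_mono)
      fix b :: 'a assume b: "b \<in> Basis"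
      have "\<bar>c' b j * monom_at (\<alpha>' b j) x\<bar> \<le> \<bar>c' b j\<bar> * (r / 2) ^ mdeg (\<alpha>' b j)"
        unfolding abs_mult using that Sc by (intro mult_left_mono monom_at_bound) auto
      with t[OF b, of j] show "\<bar>h \<bullet> b\<bar> * \<bar>c' b j * monom_at (\<alpha>' b j) x\<bar> \<le> norm h * (q j / r)"
        by (intro mult_mono Basis_le_norm b) auto
    qed
    finally show ?thesis by (simp add: mult_ac)
  qed
  have qs: "summable q"
    by (rule summable_on_imp_summable, rule finite_sums_imp_summable(2)[where q = q and M = M])
      (use bc r in \<open>auto simp: q_def abs_mult\<close>)
  have "(f has_derivative (\<lambda>h. \<Sum>b\<in>Basis. (h \<bullet> b) * g b x)) (at x)" if x: "x \<in> S" for x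
  proof -
    have "\<exists>G. \<forall>x\<in>S. (\<lambda>n. c n * monom_at (\<alpha> n) x) sums G x \<and> (G has_derivative (\<lambda>h. \<Sum>b\<in>Basis. (h \<bullet> b) * g b x)) (at x within S)"
    proof (rule has_derivative_series[where f' = D])
      show "convex S" unfolding Sbox by (rule convex_box)
      show "((\<lambda>x. c n * monom_at (\<alpha> n) x) has_derivative D n x) (at x within S)" if "x \<in> S" for n x
        unfolding D_def \<alpha>'_def
        by (rule has_derivative_at_withinI) (intro has_derivative_mult_right monom_at_has_derivative)
      fix e :: real assume e: "e > 0"
      define K where "K = real DIM('a) / r"
      have K: "0 < K" using r by (simp add: K_def)
      have "(\<lambda>n. \<Sum>j. q (j + n)) \<longlonglongrightarrow> 0" using qs by (rule suminf_exist_split2)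
      then have "eventually (\<lambda>n. norm (\<Sum>j. q (j + n)) < e / K) sequentially"
        using e K by (auto simp: tendsto_iff dist_norm)
      then show "eventually (\<lambda>n. \<forall>x\<in>S. \<forall>h. norm ((\<Sum>i<n. D i x h) - (\<Sum>b\<in>Basis. (h \<bullet> b) * g b x)) \<le> e * norm h) sequentially"
      proof (eventually_elim, intro ballI allI)
        fix n x h assume n: "norm (\<Sum>j. q (j + n)) < e / K" and x: "x \<in> S"
        have ss: "(\<lambda>j. D j x h) sums (\<Sum>b\<in>Basis. (h \<bullet> b) * g b x)"
          using has_sum_imp_sums[OF Dsum[OF x]] .
        have sq: "summable (\<lambda>j. q (j + n) * (K * norm h))"
          using qs by (intro summable_mult2) (simp add: summable_iff_shift)
        have "(\<Sum>b\<in>Basis. (h \<bullet> b) * g b x) - (\<Sum>i<n. D i x h) = (\<Sum>j. D (j + n) x h)"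
          using suminf_minus_initial_segment[OF sums_summable[OF ss], of n] sums_unique[OF ss] by simp
        also have "norm \<dots> \<le> (\<Sum>j. q (j + n) * (K * norm h))"
          using Dle[OF x] by (intro norm_suminf_le sq) (auto simp: K_def)
        also have "\<dots> = (\<Sum>j. q (j + n)) * (K * norm h)"
          using qs by (intro suminf_mult2[symmetric]) (simp add: summable_iff_shift)
        also have "\<dots> \<le> (e / K) * (K * norm h)"
          using n K by (intro mult_right_mono) auto
        finally show "norm ((\<Sum>i<n. D i x h) - (\<Sum>b\<in>Basis. (h \<bullet> b) * g b x)) \<le> e * norm h"
          using K by (simp add: norm_minus_commute)
      qed
    next
      show "x \<in> S" by fact
      show "(\<lambda>n. c n * monom_at (\<alpha> n) x) sums f x"
        using x Sc by (intro has_sum_imp_sums sc) auto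
    qed
    then obtain G where G: "\<And>x. x \<in> S \<Longrightarrow> (\<lambda>n. c n * monom_at (\<alpha> n) x) sums G x"
      "\<And>x. x \<in> S \<Longrightarrow> (G has_derivative (\<lambda>h. \<Sum>b\<in>Basis. (h \<bullet> b) * g b x)) (at x within S)" by blast
    have "G y = f y" if "y \<in> S" for y
      using sums_unique2[OF G(1)[OF that] has_sum_imp_sums[OF sc]] that Sc by auto
    then have *: "(f has_derivative (\<lambda>h. \<Sum>b\<in>Basis. (h \<bullet> b) * g b x)) (at x within S)"
      by (intro has_derivative_transform[OF x _ G(2)[OF x]]) simp
    have "open S" unfolding Sbox by (rule open_box)
    from * show ?thesis unfolding at_within_open[OF x \<open>open S\<close>] .
  qed
  then show ?thesis by (intro that[OF 1]) (auto simp: S_def)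
qed

lemma ana_has_derivative:
  assumes "ana f a"
  obtains G where "\<And>v. ana (\<lambda>x. G x v) a" "eventually (\<lambda>x. (f has_derivative G x) (at x)) (nhds a)"
proof -
  obtain r M where r: "0 < r" "\<And>b. b \<in> Basis \<Longrightarrow> maj r M (\<lambda>x. f (a + x) \<bullet> b)"
    using ana_uniform[OF assms] by metis
  define Q where "Q b g \<longleftrightarrow> (\<forall>i\<in>Basis. maj (r / 2) (M / r) (g i)) \<and>
     (\<forall>x. (\<forall>i\<in>Basis. \<bar>x \<bullet> i\<bar> < r / 2) \<longrightarrow>
       ((\<lambda>x. f (a + x) \<bullet> b) has_derivative (\<lambda>h. \<Sum>i\<in>Basis. (h \<bullet> i) * g i x)) (at x))" for b and g
  have "\<exists>g. Q b g" if "b \<in> Basis" for b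
  proof (rule maj_has_derivative[OF r(2)[OF that] r(1)])
    fix g assume "\<And>b. b \<in> Basis \<Longrightarrow> maj (r / 2) (M / r) (g b)"
      "\<And>x. (\<And>b. b \<in> Basis \<Longrightarrow> \<bar>x \<bullet> b\<bar> < r / 2) \<Longrightarrow>
         ((\<lambda>x. f (a + x) \<bullet> b) has_derivative (\<lambda>h. \<Sum>b\<in>Basis. (h \<bullet> b) * g b x)) (at x)"
    then have "Q b g" unfolding Q_def by blast
    then show ?thesis by blast
  qed
  then obtain g where Q: "\<And>b. b \<in> Basis \<Longrightarrow> Q b (g b)" by metis
  define G where "G x h = (\<Sum>b\<in>Basis. (\<Sum>i\<in>Basis. (h \<bullet> i) * g b i (x - a)) *\<^sub>R b)" for x h
  have "ana (\<lambda>x. G x v) a" for v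
  proof (rule anaI)
    fix b :: 'b assume b: "b \<in> Basis"
    have "G (a + x) v \<bullet> b = (\<Sum>i\<in>Basis. (v \<bullet> i) * g b i x)" for x
      using b by (simp add: G_def inner_sum_left inner_Basis if_distrib cong: if_cong)
    moreover have "maj (r / 2) (\<Sum>i\<in>Basis. \<bar>v \<bullet> i\<bar> * (M / r)) (\<lambda>x. \<Sum>i\<in>Basis. (v \<bullet> i) * g b i x)"
      using Q[OF b] r by (intro maj_sum maj_cmult) (auto simp: Q_def)
    ultimately show "maj (r / 2) (\<Sum>i\<in>Basis. \<bar>v \<bullet> i\<bar> * (M / r)) (\<lambda>x. G (a + x) v \<bullet> b)" by simp
  qed (use r in simp)
  moreover have "(f has_derivative G y) (at y)" if "dist y a < r / 2" for y
  proof -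
    have y: "\<bar>(y - a) \<bullet> i\<bar> < r / 2" if "i \<in> Basis" for i
      using Basis_le_norm[OF that, of "y - a"] \<open>dist y a < r / 2\<close> by (simp add: dist_norm)
    have "((\<lambda>x. f x \<bullet> b) has_derivative (\<lambda>h. G y h \<bullet> b)) (at y)" if b: "b \<in> Basis" for b
    proof -
      have "((\<lambda>x. f (a + x) \<bullet> b) has_derivative (\<lambda>h. \<Sum>i\<in>Basis. (h \<bullet> i) * g b i (y - a))) (at (y - a))"
        using Q[OF b] y unfolding Q_def by blast
      then have "((\<lambda>x. f (a + (x - a)) \<bullet> b) has_derivative (\<lambda>h. \<Sum>i\<in>Basis. (h \<bullet> i) * g b i (y - a))) (at y)"
        by (rule has_derivative_compose[rotated]) (auto intro!: derivative_eq_intros)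
      moreover have "G y h \<bullet> b = (\<Sum>i\<in>Basis. (h \<bullet> i) * g b i (y - a))" for h
        using b by (simp add: G_def inner_sum_left inner_Basis if_distrib cong: if_cong)
      ultimately show ?thesis by simp
    qed
    then show ?thesis by (subst has_derivative_componentwise_within) blast
  qed
  then have "eventually (\<lambda>x. (f has_derivative G x) (at x)) (nhds a)"
    unfolding eventually_nhds_metric using r by (auto intro!: exI[of _ "r / 2"])
  ultimately show ?thesis using that by blast
qed

lemma ana_differentiable: assumes "ana f a" shows "f differentiable (at a)"
  by (rule ana_has_derivative[OF assms]) (auto simp: differentiable_def dest: eventually_nhds_x_imp_x)

lemma ana_isCont: "ana f a \<Longrightarrow> isCont f a"
  using ana_differentiable differentiable_imp_continuous_within by blast

lemma ana_frechet_derivative: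
  assumes "ana f a" shows "ana (\<lambda>x. frechet_derivative f (at x) v) a"
proof (rule ana_has_derivative[OF assms])
  fix G assume G: "\<And>v. ana (\<lambda>x. G x v) a" "eventually (\<lambda>x. (f has_derivative G x) (at x)) (nhds a)"
  have "eventually (\<lambda>x. G x v = frechet_derivative f (at x) v) (nhds a)"
    using G(2) by eventually_elim (metis frechet_derivative_at)
  then show ?thesis by (rule ana_cong[OF G(1)])
qed

section \<open>Comparison with smooth and real-analytic maps\<close>

lemma ana_imp_Ck_on:
  assumes "\<And>x. x \<in> U \<Longrightarrow> ana f x" shows "Ck_on k f U"
  using assms
proof (induction k arbitrary: f)
  case 0
  then show ?case by (auto intro!: continuous_at_imp_continuous_on ana_isCont)
next
  case (Suc k)
  then show ?case by (auto intro!: ana_differentiable Suc.IH ana_frechet_derivative)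
qed

lemma open_ana: "open {x. ana f x}"
  unfolding open_dist
proof
  fix x assume "x \<in> {x. ana f x}"
  then show "\<exists>e>0. \<forall>y. dist y x < e \<longrightarrow> y \<in> {x. ana f x}"
    using ana_eventually[of f x] by (auto simp: eventually_nhds_metric)
qed

lemma ana_imp_smooth_map:
  assumes "\<And>x. x \<in> S \<Longrightarrow> ana f x" shows "smooth_map S f"
  unfolding smooth_map_def
proof
  fix x assume "x \<in> S"
  then show "\<exists>U g. open U \<and> x \<in> U \<and> (\<forall>k. Ck_on k g U) \<and> (\<forall>y\<in>S \<inter> U. g y = f y)"
    using assms open_ana[of f] by (intro exI[of _ "{x. ana f x}"] exI[of _ f]) (auto intro: ana_imp_Ck_on)
qed

text \<open>Here repeated multi-indices must be merged, since \<open>real_analytic_at\<close> has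
  one coefficient for each multi-index: all \<open>c j\<close> with the same index are added, which
  absolute summability permits.\<close>

lemma ana_imp_real_analytic_at:
  fixes f :: "'a::euclidean_space \<Rightarrow> 'b::euclidean_space"
  assumes "ana f a" shows "real_analytic_at f a"
proof -
  obtain r M where r: "0 < r" "\<And>b. b \<in> Basis \<Longrightarrow> maj r M (\<lambda>x. f (a + x) \<bullet> b)"
    using ana_uniform[OF assms] by metis
  let ?P = "(Basis :: 'a set) \<rightarrow>\<^sub>E (UNIV :: nat set)"
  have "\<exists>C. \<forall>x\<in>cube r. ((\<lambda>\<alpha>. monom_at \<alpha> x * C \<alpha>) has_sum f (a + x) \<bullet> b) ?P" if b: "b \<in> Basis" for b
  proof -
    obtain c :: "nat \<Rightarrow> real" and \<alpha> where
      bc: "\<And>F. finite F \<Longrightarrow> (\<Sum>j\<in>F. \<bar>c j\<bar> * r ^ mdeg (\<alpha> j)) \<le> M" and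
      sc: "\<And>x. x \<in> cube r \<Longrightarrow> ((\<lambda>j. c j * monom_at (\<alpha> j) x) has_sum f (a + x) \<bullet> b) UNIV"
      using r(2)[OF b] by (rule majE) blast
    \<comment> \<open>Two multi-indices that agree on \<open>Basis\<close> may still differ as
      functions; the restriction identifies them and lands in
      \<open>Basis \<rightarrow>\<^sub>E UNIV\<close>.\<close>
    define \<kappa> where "\<kappa> j = restrict (\<alpha> j) Basis" for j
    have \<kappa>P: "\<kappa> j \<in> ?P" for j by (simp add: \<kappa>_def)
    have m\<kappa>: "monom_at (\<alpha> j) x = monom_at (\<kappa> j) x" "mdeg (\<alpha> j) = mdeg (\<kappa> j)" for j x
      by (simp_all add: monom_at_def mdeg_def \<kappa>_def)
    define C where "C \<beta> = (\<Sum>\<^sub>\<infinity>j\<in>{j. \<kappa> j = \<beta>}. c j)" for \<beta>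
    have hC: "(c has_sum C \<beta>) {j. \<kappa> j = \<beta>}" for \<beta>
    proof -
      \<comment> \<open>Over one fibre of \<open>\<kappa>\<close> the weight
        \<open>r ^ mdeg \<beta>\<close> is a nonzero constant, so it can be divided out.\<close>
      have "(\<lambda>j. c j * r ^ mdeg (\<alpha> j)) summable_on UNIV"
        by (rule finite_sums_imp_summable(2)[OF bc]) (use r in \<open>auto simp: abs_mult\<close>)
      then have "(\<lambda>j. c j * r ^ mdeg (\<alpha> j)) summable_on {j. \<kappa> j = \<beta>}"
        by (rule summable_on_subset) auto
      then have "(\<lambda>j. (c j * r ^ mdeg (\<alpha> j)) * (1 / r ^ mdeg \<beta>)) summable_on {j. \<kappa> j = \<beta>}"
        by (rule summable_on_cmult_left)
      moreover have "((\<lambda>j. (c j * r ^ mdeg (\<alpha> j)) * (1 / r ^ mdeg \<beta>)) summable_on {j. \<kappa> j = \<beta>})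
          = (c summable_on {j. \<kappa> j = \<beta>})"
        by (rule summable_on_cong) (use r m\<kappa> in auto)
      ultimately show ?thesis unfolding C_def by simp
    qed
    have "((\<lambda>\<beta>. monom_at \<beta> x * C \<beta>) has_sum f (a + x) \<bullet> b) ?P" if x: "x \<in> cube r" for x
    proof (rule has_sum_SigmaD)
      have bij: "bij_betw (\<lambda>j. (\<kappa> j, j)) UNIV (SIGMA \<beta>:?P. {j. \<kappa> j = \<beta>})"
        by (rule bij_betwI[where g = snd]) (use \<kappa>P in auto)
      have "((\<lambda>j. (\<lambda>(\<beta>, j). monom_at \<beta> x * c j) (\<kappa> j, j)) has_sum f (a + x) \<bullet> b) UNIV"
        using sc[OF x] by (simp add: m\<kappa> mult.commute)
      then show "((\<lambda>(\<beta>, j). monom_at \<beta> x * c j) has_sum f (a + x) \<bullet> b) (SIGMA \<beta>:?P. {j. \<kappa> j = \<beta>})"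
        by (subst (asm) has_sum_reindex_bij_betw[OF bij])
      show "((\<lambda>j. (\<lambda>(\<beta>, j). monom_at \<beta> x * c j) (\<beta>, j)) has_sum monom_at \<beta> x * C \<beta>) {j. \<kappa> j = \<beta>}" for \<beta>
        using has_sum_cmult_right[OF hC] by simp
    qed
    then show ?thesis by blast
  qed
  then obtain C where C: "\<And>b x. b \<in> Basis \<Longrightarrow> x \<in> cube r \<Longrightarrow> ((\<lambda>\<alpha>. monom_at \<alpha> x * C b \<alpha>) has_sum f (a + x) \<bullet> b) ?P"
    by metis
  have "((\<lambda>\<alpha>. (\<Prod>i\<in>Basis. ((x - a) \<bullet> i) ^ \<alpha> i) *\<^sub>R (\<Sum>b\<in>Basis. C b \<alpha> *\<^sub>R b)) has_sum f x) ?P" if "x \<in> ball a r" for x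
  proof -
    have x: "x - a \<in> cube r"
    proof -
      have "norm (x - a) < r" using that by (simp add: dist_norm norm_minus_commute)
      then show ?thesis using Basis_le_norm[of _ "x - a"] by (force simp: cube_def)
    qed
    have "((\<lambda>\<alpha>. \<Sum>b\<in>Basis. (monom_at \<alpha> (x - a) * C b \<alpha>) *\<^sub>R b) has_sum (\<Sum>b\<in>Basis. (f (a + (x - a)) \<bullet> b) *\<^sub>R b)) ?P"
      by (intro has_sum_sum_finite has_sum_bounded_linear[OF bounded_linear_scaleR_left, unfolded o_def] C x) auto
    then show ?thesis by (simp add: euclidean_representation monom_at_def scaleR_sum_right)
  qed
  then show ?thesis unfolding real_analytic_at_def using r(1)
    by (intro exI[of _ "\<lambda>\<alpha>. \<Sum>b\<in>Basis. C b \<alpha> *\<^sub>R b"] exI[of _ r]) blast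
qed

lemma ana_imp_real_analytic_map:
  assumes "\<And>x. x \<in> S \<Longrightarrow> ana f x" shows "real_analytic_map S f"
  unfolding real_analytic_map_def
proof
  fix x assume "x \<in> S"
  then show "\<exists>U g. open U \<and> x \<in> U \<and> (\<forall>y\<in>U. real_analytic_at g y) \<and> (\<forall>y\<in>S \<inter> U. g y = f y)"
    using assms open_ana[of f] by (intro exI[of _ "{x. ana f x}"] exI[of _ f]) (auto intro: ana_imp_real_analytic_at)
qed

section \<open>The analytic inverse function theorem, reciprocals and square roots\<close>

theorem ana_local_inverse:
  fixes f :: "'a::euclidean_space \<Rightarrow> 'a"
  assumes f: "ana f a" and der: "(f has_derivative D) (at a)" and inj: "inj D"
  obtains g where "ana g (f a)" "g (f a) = a" "eventually (\<lambda>y. f (g y) = y) (nhds (f a))"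
proof -
  have linD: "linear D" using der has_derivative_linear by blast
  obtain B where B: "linear B" "B \<circ> D = id"
    using linear_injective_left_inverse[OF linD inj] by blast
  have injB: "inj B"
  proof -
    have "surj D" using linear_injective_imp_surjective[OF linD inj] by simp
    then show ?thesis using B(2) by (auto simp: inj_def o_def id_def fun_eq_iff) (metis surjD)
  qed
  have bB: "bounded_linear B" using B(1) by (simp add: linear_conv_bounded_linear)
  \<comment> \<open>Translation and the inverse \<open>B\<close> of the derivative reduce to a map
    that fixes 0 and has the identity as derivative there.\<close>
  define F where "F x = B (f (a + x) - f a)" for x
  have "ana (\<lambda>x. B (f x - f a)) a"
    by (intro ana_linear_compose[OF bB] ana_diff f ana_const)
  then obtain r M where r: "0 < r" "\<And>b. b \<in> Basis \<Longrightarrow> maj r M (\<lambda>x. F x \<bullet> b)"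
    unfolding F_def by (rule ana_uniform) blast
  have "((\<lambda>x. a + x) has_derivative (\<lambda>x. x)) (at 0)"
    by (auto intro!: derivative_eq_intros)
  from has_derivative_compose[OF this, of f D] have der': "((\<lambda>x. f (a + x)) has_derivative D) (at 0)"
    using der by simp
  have "(F has_derivative (\<lambda>x. B (D x - 0))) (at 0)"
    unfolding F_def by (intro bounded_linear.has_derivative[OF bB] has_derivative_diff der' has_derivative_const)
  then have "(F has_derivative (\<lambda>x. x)) (at 0)"
    using B(2) by (simp add: o_def id_def fun_eq_iff)
  moreover have "F 0 = 0" using B(1) linear_0 by (auto simp: F_def)
  ultimately obtain G q where G: "0 < q" "\<And>b. b \<in> Basis \<Longrightarrow> maj q (2 * q) (\<lambda>\<eta>. G \<eta> \<bullet> b)" "G 0 = 0"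
    "\<And>\<eta>. \<eta> \<in> cube q \<Longrightarrow> F (G \<eta>) = \<eta>"
    using maj_inverse_normalized[OF r] by metis
  define g where "g y = a + G (B (y - f a))" for y
  have "ana G 0" by (rule anaI[OF G(1)]) (use G(2) in simp)
  have B0: "B 0 = 0" using B(1) linear_0 by blast
  show ?thesis
  proof
    have "ana (\<lambda>y. G (B (y - f a))) (f a)"
    proof (rule ana_compose[where f = G])
      show "ana G (B (f a - f a))" using \<open>ana G 0\<close> by (simp add: B0)
      show "ana (\<lambda>y. B (y - f a)) (f a)" by (rule ana_linear_compose[OF bB ana_diff[OF ana_ident ana_const]])
    qed
    then show "ana g (f a)" unfolding g_def by (rule ana_add[OF ana_const])
    show "g (f a) = a" by (simp add: g_def B0 G(3))
    have "((\<lambda>y. B (y - f a)) \<longlongrightarrow> B (f a - f a)) (nhds (f a))"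
      by (intro bounded_linear.tendsto[OF bB] tendsto_intros filterlim_ident)
    then have "eventually (\<lambda>y. norm (B (y - f a)) < q) (nhds (f a))"
      using G(1) by (auto simp: tendsto_iff dist_norm B0)
    then show "eventually (\<lambda>y. f (g y) = y) (nhds (f a))"
    proof eventually_elim
      case (elim y)
      have "B (y - f a) \<in> cube q"
        using elim Basis_le_norm[of _ "B (y - f a)"] by (force simp: cube_def)
      then have "B (f (g y) - f a) = B (y - f a)"
        using G(4) by (simp add: g_def F_def)
      then show ?case using injB by (simp add: inj_eq)
    qed
  qed
qed

text \<open>The local inverse of \<open>(x, y) \<mapsto> (x, x * y)\<close> is
  \<open>(x, y) \<mapsto> (x, y / x)\<close>, so the inverse function theorem supplies
  reciprocals.\<close>

lemma ana_inverse_real_at: assumes "x0 \<noteq> 0" shows "ana (inverse :: real \<Rightarrow> real) x0"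
proof -
  let ?f = "\<lambda>(x :: real, y). (x, x * y)"
  have 1: "ana ?f (x0, inverse x0)"
    unfolding split_def by (intro ana_Pair ana_mult ana_fst ana_snd ana_ident)
  have 2: "(?f has_derivative (\<lambda>(h, k). (h, x0 * k + h * inverse x0))) (at (x0, inverse x0))"
    unfolding split_def by (auto intro!: derivative_eq_intros)
  have 3: "inj (\<lambda>(h, k). (h, x0 * k + h * inverse x0))"
    using assms by (auto simp: inj_def)
  obtain g where g: "ana g (x0, 1)" "eventually (\<lambda>y. ?f (g y) = y) (nhds (x0, 1))"
    by (rule ana_local_inverse[OF 1 2 3]) (use assms in auto)
  have "ana (\<lambda>x. snd (g (x, 1))) x0"
    by (rule ana_snd[OF ana_compose[OF g(1) ana_Pair[OF ana_ident ana_const]]])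
  moreover have "eventually (\<lambda>x. snd (g (x, 1)) = inverse x) (nhds x0)"
  proof -
    have "((\<lambda>x. (x, 1)) \<longlongrightarrow> (x0, 1)) (nhds x0)"
      by (rule tendsto_Pair[OF filterlim_ident tendsto_const])
    from eventually_compose_filterlim[OF g(2) this]
    show ?thesis
    proof eventually_elim
      case (elim x)
      then have "x * snd (g (x, 1)) = 1" by (auto simp: split_def prod_eq_iff)
      then show ?case by (metis inverse_unique)
    qed
  qed
  ultimately show ?thesis by (rule ana_cong)
qed

text \<open>A local inverse of squaring, identified with the square root by its positivity near
  \<open>x0\<close>.\<close>

lemma ana_sqrt_at: assumes "0 < x0" shows "ana sqrt x0"
proof -
  have 1: "ana (\<lambda>x::real. x ^ 2) (sqrt x0)" by (intro ana_power ana_ident)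
  have 2: "((\<lambda>x::real. x ^ 2) has_derivative (\<lambda>h. 2 * sqrt x0 * h)) (at (sqrt x0))"
    by (auto intro!: derivative_eq_intros)
  have 3: "inj (\<lambda>h. 2 * sqrt x0 * h)" using assms by (auto simp: inj_def)
  obtain g where g: "ana g x0" "g x0 = sqrt x0" "eventually (\<lambda>y. (g y) ^ 2 = y) (nhds x0)"
    by (rule ana_local_inverse[OF 1 2 3]) (use assms in auto)
  have "isCont g x0" using g(1) by (rule ana_isCont)
  then have "eventually (\<lambda>y. 0 < g y) (nhds x0)"
    using assms g(2) by (intro order_tendstoD(1)[of g "g x0"]) (auto simp: isCont_def tendsto_nhds_iff)
  with g(3) have "eventually (\<lambda>y. g y = sqrt y) (nhds x0)"
    by eventually_elim (metis real_sqrt_unique less_imp_le)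
  then show ?thesis by (rule ana_cong[OF g(1)])
qed

lemma ana_inverse:
  fixes f :: "'a::euclidean_space \<Rightarrow> real"
  shows "ana f a \<Longrightarrow> f a \<noteq> 0 \<Longrightarrow> ana (\<lambda>x. inverse (f x)) a"
  by (rule ana_compose[OF ana_inverse_real_at])

lemma ana_norm:
  assumes "ana f a" "f a \<noteq> 0" shows "ana (\<lambda>x. norm (f x)) a"
proof -
  have "ana (\<lambda>x. sqrt (f x \<bullet> f x)) a"
    using assms by (intro ana_compose[OF ana_sqrt_at] ana_inner) auto
  then show ?thesis by (simp add: norm_eq_sqrt_inner)
qed

lemma ana_sgn:
  assumes "ana f a" "f a \<noteq> 0" shows "ana (\<lambda>x. sgn (f x)) a"
  unfolding sgn_div_norm using assms by (intro ana_scaleR ana_inverse ana_norm) auto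

section \<open>The winding estimate\<close>

text \<open>A quadratic polynomial in \<open>c\<close>. Put
  \<open>L = 4 * v * b\<^sup>2 * D\<close>. The coefficient of \<open>c\<^sup>2\<close> is at least
  \<open>L\<close> and that of \<open>c\<close> lies between 0 and \<open>2 * L\<close>, so the part
  depending on \<open>c\<close> is at least \<open>- L\<close>: for negative \<open>c\<close> it
  exceeds \<open>L * ((c + 1)\<^sup>2 - 1)\<close>, up to equality. The constant term is at least
  \<open>L + (1 - s) * D\<^sup>2\<close>, and \<open>D \<ge> 1 - s\<close>.\<close>

lemma winding_form_lower_bound_pos:
  fixes s v c :: real
  assumes s: "0 \<le> v" "v \<le> s" "s < 1" and c: "-1 \<le> c" "c \<le> 1"
  defines "b \<equiv> s - v" and "D \<equiv> 1 + 2 * s - s * (2 + s) * v\<^sup>2" and "w \<equiv> 1 - s\<^sup>2 * v\<^sup>2"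
  shows "(1 - s) ^ 3 \<le> 4 * v * b * (b * s * (1 - v\<^sup>2) + (1 - s * v) * D) * c\<^sup>2 + 4 * b\<^sup>2 * v * (D + w) * c
     + ((1 - v\<^sup>2) * (D\<^sup>2 + b\<^sup>2 * (1 - s * v)\<^sup>2) - 2 * b\<^sup>2 * w * (1 + v\<^sup>2))"
proof -
  have b: "0 \<le> b" "b \<le> 1 - v" using s by (auto simp: b_def)
  have sv: "0 \<le> s * v" "s * v \<le> v" "v\<^sup>2 \<le> v" "v \<le> 1"
    using s by (auto simp: mult_left_le_one_le power2_eq_square)
  have v2: "v\<^sup>2 \<le> 1" using sv by linarith
  have "D - w - 2 * b = 2 * v * (1 - s * v)" by (simp add: b_def D_def w_def power2_eq_square algebra_simps)
  moreover have "0 \<le> 2 * v * (1 - s * v)" using s sv by (intro mult_nonneg_nonneg) auto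
  ultimately have D: "w + 2 * b \<le> D" by linarith
  have "(s * v)\<^sup>2 \<le> s\<^sup>2" using sv s by (intro power_mono) (auto simp: mult_left_le)
  moreover have "s\<^sup>2 \<le> s" using s by (auto simp: power2_eq_square mult_left_le_one_le)
  ultimately have w: "1 - s \<le> w" by (simp add: w_def power_mult_distrib)
  have Dpos: "1 - s \<le> D" "0 \<le> w" "0 \<le> D" "2 * b \<le> D" "w \<le> D" using D w b s by linarith+
  have K2: "4 * v * b\<^sup>2 * D \<le> 4 * v * b * (b * s * (1 - v\<^sup>2) + (1 - s * v) * D)"
  proof -
    have "b * D \<le> (1 - s * v) * D" using b sv Dpos by (intro mult_right_mono) auto
    moreover have "0 \<le> b * s * (1 - v\<^sup>2)" using b s v2 by auto
    ultimately have "b * D \<le> b * s * (1 - v\<^sup>2) + (1 - s * v) * D" by linarith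
    then have "4 * v * b * (b * D) \<le> 4 * v * b * (b * s * (1 - v\<^sup>2) + (1 - s * v) * D)"
      using s b by (intro mult_left_mono) auto
    then show ?thesis by (simp add: power2_eq_square mult_ac)
  qed
  have K1: "0 \<le> 4 * b\<^sup>2 * v * (D + w)" "4 * b\<^sup>2 * v * (D + w) \<le> 8 * v * b\<^sup>2 * D"
  proof -
    show "0 \<le> 4 * b\<^sup>2 * v * (D + w)" using s Dpos by auto
    have "4 * b\<^sup>2 * v * (D + w) \<le> 4 * b\<^sup>2 * v * (D + D)" using s Dpos by (intro mult_left_mono) auto
    then show "4 * b\<^sup>2 * v * (D + w) \<le> 8 * v * b\<^sup>2 * D" by (simp add: mult_ac)
  qed
  have quad: "- (4 * v * b\<^sup>2 * D) \<le> 4 * v * b * (b * s * (1 - v\<^sup>2) + (1 - s * v) * D) * c\<^sup>2 + 4 * b\<^sup>2 * v * (D + w) * c"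
  proof -
    define L where "L = 4 * v * b\<^sup>2 * D"
    have L: "0 \<le> L" using s Dpos by (simp add: L_def)
    have "L * c\<^sup>2 \<le> 4 * v * b * (b * s * (1 - v\<^sup>2) + (1 - s * v) * D) * c\<^sup>2"
      using K2 by (intro mult_right_mono) (auto simp: L_def)
    moreover have "- L - L * c\<^sup>2 \<le> 4 * b\<^sup>2 * v * (D + w) * c"
    proof (cases "0 \<le> c")
      case True
      then have "0 \<le> 4 * b\<^sup>2 * v * (D + w) * c" by (rule mult_nonneg_nonneg[OF K1(1)])
      moreover have "0 \<le> L * c\<^sup>2" using L by simp
      ultimately show ?thesis using L by linarith
    next
      case False
      then have "(2 * L) * c \<le> 4 * b\<^sup>2 * v * (D + w) * c"
        using K1 by (intro mult_right_mono_neg) (auto simp: L_def)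
      moreover have "0 \<le> L * (c + 1)\<^sup>2" using L by simp
      ultimately show ?thesis by (simp add: power2_eq_square algebra_simps)
    qed
    ultimately show ?thesis by (simp add: L_def)
  qed
  have G0: "4 * v * b\<^sup>2 * D + (1 - s) * D\<^sup>2 \<le> (1 - v\<^sup>2) * (D\<^sup>2 + b\<^sup>2 * (1 - s * v)\<^sup>2) - 2 * b\<^sup>2 * w * (1 + v\<^sup>2)"
  proof -
    have e1: "(1 - v\<^sup>2) * D\<^sup>2 = (1 - s) * (1 + v) * D\<^sup>2 + b * (1 + v) * D\<^sup>2"
      by (simp add: b_def power2_eq_square algebra_simps)
    have e2: "(1 - s) * D\<^sup>2 \<le> (1 - s) * (1 + v) * D\<^sup>2"
      using s by (intro mult_right_mono) (auto simp: mult_le_cancel_left1)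
    have e3: "b * (1 + v) * (D * (w + 2 * b)) \<le> b * (1 + v) * D\<^sup>2"
      unfolding power2_eq_square using b s D Dpos by (intro mult_left_mono) auto
    have e4: "2 * b\<^sup>2 * w * (1 + v\<^sup>2) \<le> b * (1 + v) * (D * w)"
    proof -
      have "(b * w) * ((2 * b) * (1 + v\<^sup>2)) \<le> (b * w) * (D * (1 + v))"
        using b s sv Dpos by (intro mult_left_mono mult_mono) auto
      then show ?thesis by (simp add: power2_eq_square mult_ac)
    qed
    have e5: "4 * v * b\<^sup>2 * D \<le> b * (1 + v) * (D * (2 * b))"
    proof -
      have "(2 * b\<^sup>2 * D) * (2 * v) \<le> (2 * b\<^sup>2 * D) * (1 + v)"
        using sv Dpos by (intro mult_left_mono) auto
      then show ?thesis by (simp add: power2_eq_square mult_ac)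
    qed
    have e6: "0 \<le> (1 - v\<^sup>2) * (b\<^sup>2 * (1 - s * v)\<^sup>2)" using v2 by auto
    have e7: "(1 - v\<^sup>2) * (D\<^sup>2 + b\<^sup>2 * (1 - s * v)\<^sup>2) = (1 - v\<^sup>2) * D\<^sup>2 + (1 - v\<^sup>2) * (b\<^sup>2 * (1 - s * v)\<^sup>2)"
      by (simp add: distrib_left)
    have e8: "b * (1 + v) * (D * (w + 2 * b)) = b * (1 + v) * (D * w) + b * (1 + v) * (D * (2 * b))"
      by (simp add: algebra_simps)
    show ?thesis using e1 e2 e3 e4 e5 e6 e7 e8 by linarith
  qed
  have "(1 - s) * (1 - s)\<^sup>2 \<le> (1 - s) * D\<^sup>2"
    using s Dpos by (intro mult_left_mono power_mono) auto
  moreover have "(1 - s) ^ 3 = (1 - s) * (1 - s)\<^sup>2" by (simp add: power3_eq_cube power2_eq_square)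
  ultimately show ?thesis using quad G0 by linarith
qed

text \<open>The case of negative parameters, with \<open>\<sigma> = - s\<close>, \<open>y = - v\<close>.\<close>

lemma winding_form_lower_bound_neg:
  fixes \<sigma> y c :: real
  assumes s: "0 \<le> y" "y \<le> \<sigma>" "\<sigma> < 1/3" and c: "-1 \<le> c" "c \<le> 1"
  defines "b \<equiv> \<sigma> - y" and "D \<equiv> 1 - 2 * \<sigma> + \<sigma> * (2 - \<sigma>) * y\<^sup>2" and "w \<equiv> 1 - \<sigma>\<^sup>2 * y\<^sup>2"
  shows "8/9 * (1 - 3 * \<sigma>)\<^sup>2 \<le> 4 * y * b * (b * \<sigma> * (1 - y\<^sup>2) + (1 - \<sigma> * y) * D) * c\<^sup>2 - 4 * b\<^sup>2 * y * (D + w) * c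
     + ((1 - y\<^sup>2) * (D\<^sup>2 + b\<^sup>2 * (1 - \<sigma> * y)\<^sup>2) - 2 * b\<^sup>2 * w * (1 + y\<^sup>2))"
proof -
  \<comment> \<open>Chosen with \<open>b + y + d = 1 - 2 * \<sigma> \<le> D\<close>, so that
    \<open>D\<^sup>2\<close> leaves room for \<open>d\<^sup>2\<close>. The final factor 8/9 is the
    minimum of \<open>1 - y\<^sup>2\<close> for \<open>y \<le> 1/3\<close>.\<close>
  define d where "d = 1 - 3 * \<sigma>"
  have b: "0 \<le> b" "b \<le> 1/3" "b + y = \<sigma>" using s by (auto simp: b_def)
  have y: "y \<le> 1/3" using s by linarith
  have y2: "0 \<le> y\<^sup>2" "y\<^sup>2 \<le> 1/9" using power_mono[OF y s(1), of 2] by (auto simp: power2_eq_square)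
  have sy: "0 \<le> \<sigma> * y" "\<sigma> * y \<le> 1/9"
    using mult_mono[of \<sigma> "1/3" y "1/3"] s y by auto
  have t: "0 \<le> \<sigma> * (2 - \<sigma>) * y\<^sup>2" "\<sigma> * (2 - \<sigma>) * y\<^sup>2 \<le> 2 * \<sigma>"
  proof -
    show "0 \<le> \<sigma> * (2 - \<sigma>) * y\<^sup>2" using s by (intro mult_nonneg_nonneg) auto
    have "(\<sigma> * (2 - \<sigma>)) * y\<^sup>2 \<le> (\<sigma> * 2) * 1" using s y2 by (intro mult_mono) auto
    then show "\<sigma> * (2 - \<sigma>) * y\<^sup>2 \<le> 2 * \<sigma>" by simp
  qed
  have D: "1 - 2 * \<sigma> \<le> D" "D \<le> 1" "1/3 \<le> D" using t s unfolding D_def by linarith+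
  have "0 \<le> (\<sigma> * y)\<^sup>2" "(\<sigma> * y)\<^sup>2 \<le> 1" using sy power_mono[of "\<sigma> * y" 1 2] by auto
  then have w: "0 \<le> w" "w \<le> 1" by (auto simp: w_def power_mult_distrib)
  define K where "K = 4 * b\<^sup>2 * y * (D + w)"
  have K: "0 \<le> K" "K \<le> 8 * b\<^sup>2 * y"
  proof -
    show "0 \<le> K" using s D w by (simp add: K_def)
    have "4 * b\<^sup>2 * y * (D + w) \<le> 4 * b\<^sup>2 * y * 2" using s D w by (intro mult_left_mono) auto
    then show "K \<le> 8 * b\<^sup>2 * y" by (simp add: K_def mult_ac)
  qed
  \<comment> \<open>With this the part depending on \<open>c\<close> is at least
    \<open>1/2 * K * ((c - 1)\<^sup>2 - 1)\<close>, and half of \<open>K\<close> is at most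
    \<open>4 * b\<^sup>2 * y\<close>, which the constant term provides.\<close>
  have K2: "1/2 * K \<le> 4 * y * b * (b * \<sigma> * (1 - y\<^sup>2) + (1 - \<sigma> * y) * D)"
  proof -
    define Q R where "Q = b * \<sigma> * (1 - y\<^sup>2)" and "R = (1 - \<sigma> * y) * D"
    have "b * w \<le> b" using b w by (simp add: mult_left_le)
    also have "b \<le> D" using b D by linarith
    finally have 1: "b * w \<le> D" .
    have "b * D \<le> 1/3 * D" using b D by (intro mult_right_mono) auto
    with 1 have 2: "b * D + b * w \<le> 4/3 * D" by linarith
    have 3: "8/9 * D \<le> R" unfolding R_def using sy D by (intro mult_right_mono) auto
    have 4: "0 \<le> Q" unfolding Q_def using b s y2 by auto
    have "4/3 * D \<le> 2 * (8/9 * D)" using D by simp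
    also have "\<dots> \<le> 2 * (Q + R)" using 3 4 by argo
    finally have "b * D + b * w \<le> 2 * (Q + R)" using 2 by linarith
    then have "b * (D + w) \<le> 2 * (b * \<sigma> * (1 - y\<^sup>2) + (1 - \<sigma> * y) * D)"
      unfolding Q_def R_def by (simp add: distrib_left)
    then have "(2 * y * b) * (b * (D + w)) \<le> (2 * y * b) * (2 * (b * \<sigma> * (1 - y\<^sup>2) + (1 - \<sigma> * y) * D))"
      using s b by (intro mult_left_mono) auto
    also have "\<dots> = 4 * y * b * (b * \<sigma> * (1 - y\<^sup>2) + (1 - \<sigma> * y) * D)" by simp
    also have "(2 * y * b) * (b * (D + w)) = 1/2 * K" by (simp add: K_def power2_eq_square)
    finally show ?thesis .
  qed
  have quad: "- (1/2 * K) \<le> 4 * y * b * (b * \<sigma> * (1 - y\<^sup>2) + (1 - \<sigma> * y) * D) * c\<^sup>2 - K * c"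
  proof -
    have "1/2 * K * c\<^sup>2 \<le> 4 * y * b * (b * \<sigma> * (1 - y\<^sup>2) + (1 - \<sigma> * y) * D) * c\<^sup>2"
      using K2 by (intro mult_right_mono) auto
    moreover have "0 \<le> K * (c - 1)\<^sup>2" using K by simp
    ultimately show ?thesis by (simp add: power2_eq_square algebra_simps)
  qed
  have G0: "4 * b\<^sup>2 * y + 8/9 * d\<^sup>2 \<le> (1 - y\<^sup>2) * (D\<^sup>2 + b\<^sup>2 * (1 - \<sigma> * y)\<^sup>2) - 2 * b\<^sup>2 * w * (1 + y\<^sup>2)"
  proof -
    have d: "0 \<le> d" "b + y + d \<le> D" using s D b by (auto simp: d_def)
    have "(b + y)\<^sup>2 + d\<^sup>2 \<le> (b + y + d)\<^sup>2"
      using mult_nonneg_nonneg[of "b + y" d] b s d by (simp add: power2_eq_square algebra_simps)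
    also have "\<dots> \<le> D\<^sup>2" using d b s by (intro power_mono) auto
    finally have D2: "(b + y)\<^sup>2 + d\<^sup>2 \<le> D\<^sup>2" .
    have B2: "b\<^sup>2 * (1 - 2 * (\<sigma> * y)) \<le> b\<^sup>2 * (1 - \<sigma> * y)\<^sup>2"
    proof (rule mult_left_mono)
      have "(1 - \<sigma> * y)\<^sup>2 = 1 - 2 * (\<sigma> * y) + (\<sigma> * y)\<^sup>2" by (simp add: power2_eq_square algebra_simps)
      then show "1 - 2 * (\<sigma> * y) \<le> (1 - \<sigma> * y)\<^sup>2" by simp
    qed simp
    have "(1 - y\<^sup>2) * ((b + y)\<^sup>2 + d\<^sup>2 + b\<^sup>2 * (1 - 2 * (\<sigma> * y))) \<le> (1 - y\<^sup>2) * (D\<^sup>2 + b\<^sup>2 * (1 - \<sigma> * y)\<^sup>2)"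
      using D2 B2 y2 by (intro mult_left_mono) auto
    moreover have "2 * b\<^sup>2 * w * (1 + y\<^sup>2) \<le> 2 * b\<^sup>2 * 1 * (1 + y\<^sup>2)"
      using w y2 by (intro mult_right_mono mult_left_mono) auto
    moreover have "8/9 * d\<^sup>2 \<le> (1 - y\<^sup>2) * d\<^sup>2" using y2 by (intro mult_right_mono) auto
    moreover have "4 * b\<^sup>2 * y \<le> (1 - y\<^sup>2) * ((b + y)\<^sup>2 + b\<^sup>2 * (1 - 2 * (\<sigma> * y))) - 2 * b\<^sup>2 * (1 + y\<^sup>2)"
    proof -
      have "(1 - y\<^sup>2) * ((b + y)\<^sup>2 + b\<^sup>2 * (1 - 2 * (\<sigma> * y))) - 2 * b\<^sup>2 * (1 + y\<^sup>2) - 4 * b\<^sup>2 * y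
         = 2 * b * y * (1 - 2 * b - \<sigma> * b) + y\<^sup>2 * (1 - (b + y)\<^sup>2 - 3 * b\<^sup>2 + 2 * b\<^sup>2 * (\<sigma> * y))"
        by (simp add: power2_eq_square algebra_simps)
      moreover have "0 \<le> 2 * b * y * (1 - 2 * b - \<sigma> * b)"
      proof -
        have "\<sigma> * b \<le> 1/3 * (1/3)" using s b by (intro mult_mono) auto
        then show ?thesis using b s by (intro mult_nonneg_nonneg) auto
      qed
      moreover have "0 \<le> y\<^sup>2 * (1 - (b + y)\<^sup>2 - 3 * b\<^sup>2 + 2 * b\<^sup>2 * (\<sigma> * y))"
      proof -
        have "b\<^sup>2 \<le> (1/3)\<^sup>2" "(b + y)\<^sup>2 \<le> (1/3)\<^sup>2" using b s by (intro power_mono; simp)+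
        moreover have "0 \<le> 2 * b\<^sup>2 * (\<sigma> * y)" using sy by simp
        ultimately show ?thesis by (intro mult_nonneg_nonneg) (auto simp: power2_eq_square)
      qed
      ultimately show ?thesis by linarith
    qed
    ultimately show ?thesis by (simp add: distrib_left)
  qed
  show ?thesis using quad G0 K unfolding K_def d_def by linarith
qed

text \<open>Multiplying out leaves the real numbers \<open>cnj A * A\<close> and
  \<open>cnj B * B\<close>, combined with \<open>cnj B * E\<close> and
  \<open>cnj A * (v * e)\<close>. The terms containing \<open>cnj B * B\<close> collect into the
  factor \<open>1 - v\<^sup>2\<close>, and \<open>cmod e = 1\<close> eliminates the imaginary part
  of \<open>e\<close>.\<close>

lemma winding_form_eq:
  fixes s v b D :: real and e :: complex
  assumes e: "cmod e = 1"
  defines "c \<equiv> Re e"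
  defines "A \<equiv> 1 - v * e" and "B \<equiv> D + b * cnj e + s * v * b * e"
    and "E \<equiv> - b * cnj e + s * v * b * e"
  shows "Re (cnj (A * B) * (A * B + 2 * A * E + 2 * B * (v * e)))
     = (1 - v\<^sup>2) * (D\<^sup>2 + b\<^sup>2 * (1 - s * v)\<^sup>2 + 2 * D * b * (1 + s * v) * c + 4 * b\<^sup>2 * s * v * c\<^sup>2)
       - 2 * b * (1 - s * v) * (D * c + b * (1 + s * v)) * (1 + v\<^sup>2 - 2 * v * c)"
proof -
  define d where "d = Im e"
  have e': "e = Complex c d" by (simp add: c_def d_def complex_eq_iff)
  have cd: "d\<^sup>2 = 1 - c\<^sup>2" using e by (simp add: e' cmod_def)
  have nA: "Re (cnj A * A) = 1 + v\<^sup>2 - 2 * v * c"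
    using cd by (simp add: A_def e' power2_eq_square algebra_simps)
  have nB: "Re (cnj B * B) = D\<^sup>2 + b\<^sup>2 * (1 - s * v)\<^sup>2 + 2 * D * b * (1 + s * v) * c + 4 * b\<^sup>2 * s * v * c\<^sup>2"
  proof -
    have "Re (cnj B * B) = (D + b * (1 + s * v) * c)\<^sup>2 + (b * (1 - s * v))\<^sup>2 * d\<^sup>2"
      by (simp add: B_def e' power2_eq_square algebra_simps)
    then show ?thesis unfolding cd by (simp add: power2_eq_square algebra_simps)
  qed
  have BE: "Re (cnj B * E) = - b * (1 - s * v) * (D * c + b * (1 + s * v))"
  proof -
    have "Re (cnj B * E) = - b * (1 - s * v) * (D * c + b * (1 + s * v) * (c\<^sup>2 + d\<^sup>2))"
      by (simp add: B_def E_def e' power2_eq_square algebra_simps)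
    then show ?thesis unfolding cd by simp
  qed
  have AV: "Re (cnj A * (v * e)) = v * c - v\<^sup>2"
  proof -
    have "Re (cnj A * (v * e)) = v * c - v\<^sup>2 * (c\<^sup>2 + d\<^sup>2)"
      by (simp add: A_def e' power2_eq_square algebra_simps)
    then show ?thesis unfolding cd by simp
  qed
  have rA: "cnj A * A = of_real (Re (cnj A * A))" and rB: "cnj B * B = of_real (Re (cnj B * B))"
    by (simp_all add: complex_eq_iff)
  have "cnj (A * B) * (A * B + 2 * A * E + 2 * B * (v * e))
     = (cnj A * A) * (cnj B * B) + 2 * ((cnj A * A) * (cnj B * E)) + 2 * ((cnj B * B) * (cnj A * (v * e)))"
    by (simp add: algebra_simps)
  also have "Re \<dots> = Re (cnj A * A) * Re (cnj B * B) + 2 * (Re (cnj A * A) * Re (cnj B * E)) + 2 * (Re (cnj B * B) * Re (cnj A * (v * e)))"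
    by (subst rA, subst (2) rA, subst rB, subst (2) rB) (simp del: complex_cnj_mult)
  also have "\<dots> = (1 - v\<^sup>2) * Re (cnj B * B) + 2 * Re (cnj A * A) * Re (cnj B * E)"
    unfolding nA AV by (simp add: algebra_simps)
  finally show ?thesis unfolding nA nB BE by (simp add: algebra_simps)
qed

text \<open>Write \<open>e = z1 z2 / cnj (z1 z2)\<close> and \<open>u = |z2|^2\<close>. The components of \<open>zmap\<close> below are the conjugate of
  \<open>cnj z1 * WA\<close> and \<open>(1 + t u)^N * z2 * WB\<close>. If \<open>Z1, Z2\<close> are these components, then along a vector tangent to the
  sphere \<open>cnj Z1 dZ2 - Z2 d(cnj Z1) = (1 + t u)^N cnj z1 z2 (x WT + \<i> y WP)\<close> with \<open>x, y\<close> real. An acute angle between \<open>WT\<close> and \<open>WP\<close>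
  therefore makes the projectivized map an immersion. Up to a bounded error, \<open>WT\<close> is a positive multiple of \<open>WA WB\<close> when \<open>N\<close> is large, whence the lower bound on \<open>Re (cnj (WA WB) WP)\<close>.\<close>

definition WA :: "real \<Rightarrow> real \<Rightarrow> complex \<Rightarrow> complex" where
  "WA s u e = 1 - s * u * e"

definition WB :: "real \<Rightarrow> real \<Rightarrow> complex \<Rightarrow> complex" where
  "WB s u e = (1 + 2 * s - s ^ 3 * (2 + s) * u\<^sup>2) + s * (1 - u) * cnj e + s ^ 3 * u * (1 - u) * e"

definition WP :: "real \<Rightarrow> real \<Rightarrow> complex \<Rightarrow> complex" where
  "WP s u e = WA s u e * WB s u e + 2 * WA s u e * (- s * (1 - u) * cnj e + s ^ 3 * u * (1 - u) * e)
     + 2 * WB s u e * (s * u * e)"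

text \<open>The two lower bounds proved above, taken at \<open>t = 1\<close>. Both decrease as
  \<open>\<bar>s\<bar>\<close> grows, so these values serve all intermediate times.\<close>

definition winding_gap :: "real \<Rightarrow> real" where
  "winding_gap \<tau> = (if 0 \<le> \<tau> then (1 - \<tau>) ^ 3 else 8/9 * (1 + 3 * \<tau>)\<^sup>2)"

lemma winding_gap_pos: "- (1/3) < \<tau> \<Longrightarrow> \<tau> < 1 \<Longrightarrow> 0 < winding_gap \<tau>"
  by (auto simp: winding_gap_def)

lemma winding_gap_le:
  assumes \<tau>: "- (1/3) < \<tau>" "\<tau> < 1" and t: "0 \<le> t" "t \<le> 1" and u: "0 \<le> u" "u \<le> 1" and e: "cmod e = 1"
  shows "winding_gap \<tau> \<le> Re (cnj (WA (t * \<tau>) u e * WB (t * \<tau>) u e) * WP (t * \<tau>) u e)"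
proof -
  define s where "s = t * \<tau>"
  define v where "v = s * u"
  define b where "b = s - v"
  define D where "D = 1 + 2 * s - s * (2 + s) * v\<^sup>2"
  define c where "c = Re e"
  have c: "-1 \<le> c" "c \<le> 1" using complex_Re_le_cmod[of e] complex_Re_le_cmod[of "- e"] e by (auto simp: c_def)
  have A: "WA s u e = 1 - v * e" by (simp add: WA_def v_def)
  have B: "WB s u e = D + b * cnj e + s * v * b * e"
    by (simp add: WB_def D_def b_def v_def power3_eq_cube power2_eq_square algebra_simps)
  have P: "WP s u e = WA s u e * WB s u e + 2 * WA s u e * (- b * cnj e + s * v * b * e) + 2 * WB s u e * (v * e)"
    by (simp add: WP_def b_def v_def power3_eq_cube algebra_simps)
  have eq: "Re (cnj (WA s u e * WB s u e) * WP s u e) = 4 * v * b * (b * s * (1 - v\<^sup>2) + (1 - s * v) * D) * c\<^sup>2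
      + 4 * b\<^sup>2 * v * (D + (1 - s\<^sup>2 * v\<^sup>2)) * c
      + ((1 - v\<^sup>2) * (D\<^sup>2 + b\<^sup>2 * (1 - s * v)\<^sup>2) - 2 * b\<^sup>2 * (1 - s\<^sup>2 * v\<^sup>2) * (1 + v\<^sup>2))" (is "_ = ?R")
  proof -
    have "Re (cnj (WA s u e * WB s u e) * WP s u e)
      = (1 - v\<^sup>2) * (D\<^sup>2 + b\<^sup>2 * (1 - s * v)\<^sup>2 + 2 * D * b * (1 + s * v) * c + 4 * b\<^sup>2 * s * v * c\<^sup>2)
       - 2 * b * (1 - s * v) * (D * c + b * (1 + s * v)) * (1 + v\<^sup>2 - 2 * v * c)"
      unfolding P A B c_def by (rule winding_form_eq[OF e])
    \<comment> \<open>The unmatched term is a multiple of \<open>s - v - b\<close>, which is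
      0.\<close>
    also have "\<dots> = ?R + 4 * b * v * (s - v - b) * D * c"
      by (simp add: power2_eq_square algebra_simps)
    finally show ?thesis by (simp add: b_def)
  qed
  have "winding_gap \<tau> \<le> ?R"
  proof (cases "0 \<le> \<tau>")
    case True
    then have s: "0 \<le> s" "s \<le> \<tau>" using t by (auto simp: s_def mult_left_le_one_le)
    then have v: "0 \<le> v" "v \<le> s" using u by (auto simp: v_def mult_left_le)
    have "(1 - \<tau>) ^ 3 \<le> (1 - s) ^ 3" using s \<tau> by (intro power_mono) auto
    also have "\<dots> \<le> ?R"
      unfolding b_def D_def by (rule winding_form_lower_bound_pos) (use s v c \<tau> in auto)
    finally show ?thesis using True by (simp add: winding_gap_def)
  next
    case False
    have s: "- s \<le> - \<tau>" "0 \<le> - s" using t False by (auto simp: s_def mult_le_0_iff mult_le_cancel_right2)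
    then have v: "0 \<le> - v" "- v \<le> - s" using u by (auto simp: v_def mult_le_0_iff mult_le_cancel_left1)
    have "8/9 * (1 + 3 * \<tau>)\<^sup>2 \<le> 8/9 * (1 - 3 * (- s))\<^sup>2" using s \<tau> by (intro mult_left_mono power_mono) auto
    also have "\<dots> \<le> 4 * (- v) * (- s - - v) * ((- s - - v) * (- s) * (1 - (- v)\<^sup>2) + (1 - (- s) * (- v)) * (1 - 2 * (- s) + (- s) * (2 - (- s)) * (- v)\<^sup>2)) * c\<^sup>2
       - 4 * (- s - - v)\<^sup>2 * (- v) * ((1 - 2 * (- s) + (- s) * (2 - (- s)) * (- v)\<^sup>2) + (1 - (- s)\<^sup>2 * (- v)\<^sup>2)) * c
     + ((1 - (- v)\<^sup>2) * ((1 - 2 * (- s) + (- s) * (2 - (- s)) * (- v)\<^sup>2)\<^sup>2 + (- s - - v)\<^sup>2 * (1 - (- s) * (- v))\<^sup>2) - 2 * (- s - - v)\<^sup>2 * (1 - (- s)\<^sup>2 * (- v)\<^sup>2) * (1 + (- v)\<^sup>2))"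
      by (rule winding_form_lower_bound_neg) (use s v c \<tau> in auto)
    also have "\<dots> = ?R"
      unfolding b_def D_def by (simp add: power2_eq_square algebra_simps)
    finally show ?thesis using False by (simp add: winding_gap_def)
  qed
  then have "winding_gap \<tau> \<le> Re (cnj (WA s u e * WB s u e) * WP s u e)" unfolding eq .
  then show ?thesis unfolding s_def .
qed

text \<open>\<open>s * WQ s u e\<close> is \<open>WA\<close> times the derivative of
  \<open>WB\<close> in \<open>u\<close>, minus \<open>WB\<close> times that of \<open>WA\<close>,
  with \<open>e\<close> held fixed. In the same way \<open>WP\<close> collects the derivatives in
  the argument of \<open>e\<close>.\<close>

definition WQ :: "real \<Rightarrow> real \<Rightarrow> complex \<Rightarrow> complex" where
  "WQ s u e = WA s u e * (- 2 * s\<^sup>2 * (2 + s) * u - cnj e + s\<^sup>2 * (1 - 2 * u) * e) + e * WB s u e"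

text \<open>The factor \<open>N * t / (1 + t * u)\<close> is the logarithmic derivative of
  \<open>(1 + t * u) ^ N\<close> in \<open>u\<close>, and \<open>2 * u * (1 - u)\<close> is the rate
  of change of \<open>u\<close> per unit of \<open>x\<close>.\<close>

definition WT :: "nat \<Rightarrow> real \<Rightarrow> real \<Rightarrow> real \<Rightarrow> complex \<Rightarrow> complex" where
  "WT N t s u e = WA s u e * WB s u e
     + 2 * u * (1 - u) * (s * WQ s u e + N * t / (1 + t * u) * (WA s u e * WB s u e))"

text \<open>Crude constants from the triangle inequality, with 2 as bound for \<open>WA\<close> and
  8 for \<open>WB\<close>; their use is that they do not depend on \<open>s\<close>,
  \<open>u\<close> and \<open>e\<close>.\<close>

lemma cmod_WA_WB_WQ_WP:
  assumes s: "\<bar>s\<bar> \<le> 1" and u: "0 \<le> u" "u \<le> 1" and e: "cmod e = 1"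
  shows "cmod (WQ s u e) \<le> 40" "cmod (WP s u e) \<le> 80"
proof -
  have s3: "\<bar>s\<bar> ^ n \<le> 1" for n using s by (simp add: power_le_one)
  have m: "cmod (x * y) \<le> a * b" if "cmod x \<le> a" "cmod y \<le> b" for x y a b
    unfolding norm_mult by (rule mult_mono[OF that order_trans[OF norm_ge_zero that(1)] norm_ge_zero])
  have pm: "cmod (of_real r * y) \<le> k * a" if "\<bar>r\<bar> \<le> k" "cmod y \<le> a" for r k y a
    using that by (simp add: norm_mult mult_mono)
  have su: "\<bar>s * u\<bar> \<le> 1" "\<bar>s * (1 - u)\<bar> \<le> 1" "\<bar>s ^ 3 * u * (1 - u)\<bar> \<le> 1" "\<bar>s ^ 3 * (2 + s) * u\<^sup>2\<bar> \<le> 3"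
    "\<bar>- 2 * s\<^sup>2 * (2 + s) * u\<bar> \<le> 6" "\<bar>s\<^sup>2 * (1 - 2 * u)\<bar> \<le> 1"
  proof -
    have "\<bar>s\<bar> * u \<le> 1 * 1" "\<bar>s\<bar> * (1 - u) \<le> 1 * 1" using s u by (intro mult_mono; simp)+
    then show "\<bar>s * u\<bar> \<le> 1" "\<bar>s * (1 - u)\<bar> \<le> 1" using u by (simp_all add: abs_mult)
    have "\<bar>s\<bar> ^ 3 * u * (1 - u) \<le> 1 * 1 * 1" using s3 u by (intro mult_mono) auto
    then show "\<bar>s ^ 3 * u * (1 - u)\<bar> \<le> 1" using u by (simp add: abs_mult power_abs)
    have "\<bar>s\<bar> ^ 3 * (2 + s) * u\<^sup>2 \<le> 1 * 3 * 1" using s3 u s by (intro mult_mono power_le_one) auto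
    then show "\<bar>s ^ 3 * (2 + s) * u\<^sup>2\<bar> \<le> 3" using s by (simp add: abs_mult power_abs)
    have "2 * \<bar>s\<bar>\<^sup>2 * (2 + s) * u \<le> 2 * 1 * 3 * 1" using s3[of 2] u s by (intro mult_mono) auto
    then show "\<bar>- 2 * s\<^sup>2 * (2 + s) * u\<bar> \<le> 6" using s u by (simp add: abs_mult)
    have "\<bar>s\<bar>\<^sup>2 * \<bar>1 - 2 * u\<bar> \<le> 1 * 1" using s3[of 2] u by (intro mult_mono) auto
    then show "\<bar>s\<^sup>2 * (1 - 2 * u)\<bar> \<le> 1" by (simp add: abs_mult)
  qed
  have e1: "cmod e \<le> 1" "cmod (cnj e) \<le> 1" using e by auto
  have A: "cmod (WA s u e) \<le> 2"
  proof -
    have "cmod (1 - of_real (s * u) * e) \<le> cmod 1 + cmod (of_real (s * u) * e)" by (rule norm_triangle_ineq4)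
    also have "\<dots> \<le> 1 + 1 * 1" by (intro add_mono pm su e1) auto
    finally show ?thesis by (simp add: WA_def)
  qed
  have B: "cmod (WB s u e) \<le> 8"
  proof -
    have "cmod (of_real (1 + 2 * s - s ^ 3 * (2 + s) * u\<^sup>2) + of_real (s * (1 - u)) * cnj e + of_real (s ^ 3 * u * (1 - u)) * e)
        \<le> cmod (of_real (1 + 2 * s - s ^ 3 * (2 + s) * u\<^sup>2)) + cmod (of_real (s * (1 - u)) * cnj e) + cmod (of_real (s ^ 3 * u * (1 - u)) * e)"
      by (intro order_trans[OF norm_triangle_ineq] add_mono norm_triangle_ineq order_refl)
    also have "\<dots> \<le> 6 + 1 * 1 + 1 * 1"
    proof (intro add_mono pm su e1)
      have "\<bar>1 + 2 * s - s ^ 3 * (2 + s) * u\<^sup>2\<bar> \<le> 1 + 2 * \<bar>s\<bar> + \<bar>s ^ 3 * (2 + s) * u\<^sup>2\<bar>" by linarith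
      then show "cmod (of_real (1 + 2 * s - s ^ 3 * (2 + s) * u\<^sup>2)) \<le> 6"
        unfolding norm_of_real using s su(4) by linarith
    qed
    finally show ?thesis by (simp add: WB_def)
  qed
  define X where "X = of_real (- 2 * s\<^sup>2 * (2 + s) * u) - cnj e + of_real (s\<^sup>2 * (1 - 2 * u)) * e"
  have X: "cmod X \<le> 6 + 1 + 1 * 1"
    unfolding X_def
    by (intro order_trans[OF norm_triangle_ineq] order_trans[OF norm_triangle_ineq4] add_mono pm su e1)
      (unfold norm_of_real, rule su)
  have "cmod (WA s u e * X + e * WB s u e) \<le> 2 * (6 + 1 + 1 * 1) + 1 * 8"
    by (intro order_trans[OF norm_triangle_ineq] add_mono m A B X e1)
  then show "cmod (WQ s u e) \<le> 40" by (simp add: WQ_def X_def)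
  have E: "cmod (of_real (- (s * (1 - u))) * cnj e + of_real (s ^ 3 * u * (1 - u)) * e) \<le> 1 * 1 + 1 * 1"
    by (intro order_trans[OF norm_triangle_ineq] add_mono pm e1) (use su in auto)
  have "cmod (WA s u e * WB s u e + 2 * WA s u e * (of_real (- (s * (1 - u))) * cnj e + of_real (s ^ 3 * u * (1 - u)) * e)
     + 2 * WB s u e * (of_real (s * u) * e)) \<le> 2 * 8 + (2 * 2) * (1 * 1 + 1 * 1) + (2 * 8) * (1 * 1)"
    by (intro order_trans[OF norm_triangle_ineq] add_mono m A B E pm su e1) auto
  then show "cmod (WP s u e) \<le> 80" by (simp add: WP_def)
qed

text \<open>Since \<open>\<bar>t * \<tau>\<bar> \<le> t\<close>, the term with \<open>WQ\<close> can
  spoil the angle by at most \<open>40 * 80 * t\<close>. The power factor contributes at least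
  \<open>N * t / 2\<close> times the gap, whence 6400 as twice 3200. Both sides carry the factor
  \<open>t\<close>, so one \<open>N\<close> serves all times.\<close>

lemma WT_WP_pos:
  assumes \<tau>: "- (1/3) < \<tau>" "\<tau> < 1" and N: "6400 \<le> N * winding_gap \<tau>"
    and t: "0 \<le> t" "t \<le> 1" and u: "0 \<le> u" "u \<le> 1" and e: "cmod e = 1"
  shows "0 < Re (cnj (WT N t (t * \<tau>) u e) * WP (t * \<tau>) u e)"
proof -
  let ?s = "t * \<tau>"
  define G where "G = Re (cnj (WA ?s u e * WB ?s u e) * WP ?s u e)"
  define Q where "Q = Re (cnj (WQ ?s u e) * WP ?s u e)"
  have gap: "winding_gap \<tau> \<le> G" unfolding G_def by (rule winding_gap_le[OF \<tau> t u e])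
  have gpos: "0 < G" using gap winding_gap_pos[OF \<tau>] by linarith
  have st: "\<bar>?s\<bar> \<le> t" using \<tau> t by (auto simp: abs_mult intro!: mult_left_le)
  then have s1: "\<bar>?s\<bar> \<le> 1" using t by linarith
  have "\<bar>Q\<bar> \<le> cmod (cnj (WQ ?s u e) * WP ?s u e)" unfolding Q_def by (rule abs_Re_le_cmod)
  also have "\<dots> \<le> 40 * 80"
    unfolding norm_mult using cmod_WA_WB_WQ_WP[OF s1 u e] by (intro mult_mono) auto
  finally have Q: "\<bar>Q\<bar> \<le> 3200" by simp
  have "\<bar>?s * Q\<bar> \<le> t * 3200" unfolding abs_mult using st Q t by (intro mult_mono) auto
  moreover have "t * 3200 \<le> N * t / (1 + t * u) * G"
  proof -
    have tu: "0 \<le> t * u" "t * u \<le> 1" using t u by (auto simp: mult_le_one)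
    have "6400 \<le> N * G" using N gap mult_left_mono[OF gap, of "real N"] by linarith
    then have "t * (3200 * (1 + t * u)) \<le> t * (N * G)" using tu t by (intro mult_left_mono) auto
    then show ?thesis using tu by (simp add: field_simps)
  qed
  ultimately have "0 \<le> ?s * Q + N * t / (1 + t * u) * G" by linarith
  then have "0 \<le> 2 * u * (1 - u) * (?s * Q + N * t / (1 + t * u) * G)" using u by auto
  moreover have "Re (cnj (WT N t ?s u e) * WP ?s u e) = G + 2 * u * (1 - u) * (?s * Q + N * t / (1 + t * u) * G)"
  proof -
    define k where "k = N * t / (1 + t * u)"
    define A where "A = WA ?s u e * WB ?s u e"
    have T: "WT N t ?s u e = A + of_real (2 * u * (1 - u)) * (of_real ?s * WQ ?s u e + of_real k * A)"
      by (simp add: WT_def k_def A_def)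
    have "cnj (WT N t ?s u e) * WP ?s u e = cnj A * WP ?s u e
       + of_real (2 * u * (1 - u)) * (of_real ?s * (cnj (WQ ?s u e) * WP ?s u e) + of_real k * (cnj A * WP ?s u e))"
      unfolding T by (simp add: algebra_simps del: of_real_mult of_real_diff)
    also have "Re \<dots> = G + (2 * u * (1 - u)) * (?s * Q + k * G)"
      unfolding G_def Q_def A_def plus_complex.sel times_complex.sel by simp
    finally show ?thesis by (simp add: k_def)
  qed
  ultimately show ?thesis using gpos by linarith
qed

section \<open>The polynomial family and its immersion property\<close>

definition zsnd :: "complex \<Rightarrow> complex \<Rightarrow> complex \<Rightarrow> complex" where
  "zsnd s z1 z2 = (1 + 2 * s - s ^ 3 * (2 + s) * (z2 * cnj z2) ^ 2) * z2 + s * cnj z1 ^ 2 * cnj z2 + s ^ 3 * z1 ^ 2 * z2 ^ 3"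

definition zmap :: "real \<Rightarrow> nat \<Rightarrow> real \<Rightarrow> C2 \<Rightarrow> C2" where
  "zmap \<tau> N t z =
     (fst z - complex_of_real (t * \<tau>) * cnj (fst z) * cnj (snd z) ^ 2,
      (1 + complex_of_real t * (snd z * cnj (snd z))) ^ N * zsnd (complex_of_real (t * \<tau>)) (fst z) (snd z))"

definition zsnd' :: "complex \<Rightarrow> complex \<Rightarrow> complex \<Rightarrow> complex \<Rightarrow> complex \<Rightarrow> complex" where
  "zsnd' s z1 z2 v1 v2 = (- 2 * s ^ 3 * (2 + s) * (z2 * cnj z2) * (z2 * cnj v2 + v2 * cnj z2)) * z2
      + (1 + 2 * s - s ^ 3 * (2 + s) * (z2 * cnj z2) ^ 2) * v2
      + s * (2 * cnj z1 * cnj v1 * cnj z2 + cnj z1 ^ 2 * cnj v2) + s ^ 3 * (2 * z1 * v1 * z2 ^ 3 + 3 * z1 ^ 2 * z2 ^ 2 * v2)"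

definition zmap' :: "real \<Rightarrow> nat \<Rightarrow> real \<Rightarrow> C2 \<Rightarrow> C2 \<Rightarrow> C2" where
  "zmap' \<tau> N t z v =
     (fst v - complex_of_real (t * \<tau>) * (cnj (fst v) * cnj (snd z) ^ 2 + 2 * cnj (fst z) * cnj (snd z) * cnj (snd v)),
      (1 + complex_of_real t * (snd z * cnj (snd z))) ^ N * zsnd' (complex_of_real (t * \<tau>)) (fst z) (snd z) (fst v) (snd v)
      + (of_nat N * (complex_of_real t * (snd z * cnj (snd v) + snd v * cnj (snd z))) * (1 + complex_of_real t * (snd z * cnj (snd z))) ^ (N - 1))
        * zsnd (complex_of_real (t * \<tau>)) (fst z) (snd z))"

lemma zmap_has_derivative: "(zmap \<tau> N t has_derivative zmap' \<tau> N t z) (at z)"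
  unfolding zmap_def zmap'_def zsnd_def zsnd'_def
  by (rule has_derivative_eq_rhs, (rule derivative_intros has_derivative_cnj)+)
    (auto simp: fun_eq_iff algebra_simps power2_eq_square power3_eq_cube)

lemma S3_inner: "(z \<bullet> v = 0) \<longleftrightarrow> fst z * cnj (fst v) + cnj (fst z) * fst v + (snd z * cnj (snd v) + cnj (snd z) * snd v) = 0"
  for z v :: C2
  by (auto simp: inner_prod_def inner_complex_def complex_eq_iff algebra_simps)

lemma S3_iff: "z \<in> S3 \<longleftrightarrow> fst z * cnj (fst z) + snd z * cnj (snd z) = 1"
  by (simp only: S3_def split_def mem_Collect_eq complex_norm_square[symmetric] of_real_add[symmetric] of_real_eq_1_iff)

text \<open>Turns the derivative of a power into the power times its logarithmic derivative; for
  \<open>N = 0\<close> both sides vanish.\<close>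

lemma power_pred: "x \<noteq> 0 \<Longrightarrow> of_nat N * y * x ^ (N - 1) = x ^ N * (of_nat N * y / x)" for x y :: complex
  by (cases N) auto

text \<open>Here \<open>a1 = v1 / z1\<close> and \<open>a2 = v2 / z2\<close> are logarithmic
  derivatives and \<open>ca1\<close>, \<open>ca2\<close> their conjugates, rewritten by tangency and
  \<open>x + \<i> * y = a2 - ca1\<close>. Then \<open>u'\<close> and \<open>h\<close> are the
  derivatives of \<open>u\<close> and of \<open>log e\<close>; the first is a multiple of
  \<open>x\<close> and the second of \<open>y\<close>, which is why the bracket splits.\<close>

lemma winding_bracket:
  fixes e e' a1 s \<nu> :: complex and x y u :: complex
  defines "A \<equiv> 1 - s * u * e" and "B \<equiv> (1 + 2 * s - s ^ 3 * (2 + s) * u\<^sup>2) + s * (1 - u) * e' + s ^ 3 * u * (1 - u) * e"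
  defines "ca1 \<equiv> - a1 - 2 * u * x" and "a2 \<equiv> - a1 - 2 * u * x + x + \<i> * y" and "ca2 \<equiv> a1 + x - \<i> * y"
  defines "u' \<equiv> u * (a2 + ca2)" and "h \<equiv> a1 + a2 - ca1 - ca2"
  shows "A * (a2 * B + (- 2 * s ^ 3 * (2 + s) * u * u' + s * (- u' - (1 - u) * h) * e' + s ^ 3 * ((1 - 2 * u) * u' + u * (1 - u) * h) * e) + \<nu> * u' * B)
     - B * (ca1 - s * u * e * (a1 + 2 * a2))
   = x * (A * B + 2 * u * (1 - u) * (s * (A * (- 2 * s\<^sup>2 * (2 + s) * u - e' + s\<^sup>2 * (1 - 2 * u) * e) + e * B) + \<nu> * (A * B)))
     + \<i> * y * (A * B + 2 * A * (- s * (1 - u) * e' + s ^ 3 * u * (1 - u) * e) + 2 * B * (s * u * e))"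
proof -
  have u': "u' = 2 * u * (1 - u) * x" by (simp add: u'_def a2_def ca2_def algebra_simps)
  have h: "h = 2 * \<i> * y" by (simp add: h_def a2_def ca2_def ca1_def algebra_simps)
  have i: "ca1 - s * u * e * (a1 + 2 * a2) = ca1 * A - s * e * (u' + u * h)"
    unfolding u' h by (simp add: A_def ca1_def a2_def algebra_simps)
  have d: "a2 = ca1 + x + \<i> * y" by (simp add: a2_def ca1_def)
  show ?thesis unfolding i unfolding u' h d
    by (simp add: algebra_simps power2_eq_square power3_eq_cube)
qed

text \<open>The differential of the normalized map kills \<open>v\<close> when the differential of
  \<open>zmap\<close> sends it to a real multiple of the value. Off the two axis circles,
  eliminating \<open>c\<close> gives \<open>x * WT + \<i> * y * WP = 0\<close>, and the acute angle
  forces \<open>x = y = 0\<close>. Then \<open>a1\<close> is imaginary and also equal to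
  \<open>- c\<close>, hence 0. The axis circles are treated directly.\<close>

lemma zmap_immersion:
  assumes \<tau>: "- (1/3) < \<tau>" "\<tau> < 1" and N: "6400 \<le> N * winding_gap \<tau>" and t: "0 \<le> t" "t \<le> 1"
    and z: "z \<in> S3" and tan: "z \<bullet> v = 0" and eq: "zmap' \<tau> N t z v = c *\<^sub>R zmap \<tau> N t z"
  shows "v = 0"
proof -
  define s where "s = t * \<tau>"
  obtain z1 z2 where z12: "z = (z1, z2)" by (cases z)
  obtain v1 v2 where v12: "v = (v1, v2)" by (cases v)
  have st: "\<bar>s\<bar> \<le> \<bar>\<tau>\<bar>" unfolding s_def abs_mult using t by (intro mult_left_le_one_le) auto
  have s: "\<bar>s\<bar> < 1" using st \<tau> by linarith
  have s': "- (1/3) < s"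
  proof (cases "t = 0")
    case False
    then have "t * (- (1/3)) < t * \<tau>" using t \<tau> by (intro mult_strict_left_mono) auto
    then show ?thesis using t by (simp add: s_def)
  qed (simp add: s_def)
  define D where "D u = 1 + 2 * s - s ^ 3 * (2 + s) * u\<^sup>2" for u :: real
  have sph: "z1 * cnj z1 + z2 * cnj z2 = 1" using z by (simp add: S3_iff z12)
  have tan': "z1 * cnj v1 + cnj z1 * v1 + (z2 * cnj v2 + cnj z2 * v2) = 0"
    using tan unfolding S3_inner z12 v12 fst_conv snd_conv .
  have n: "(cmod z1)\<^sup>2 + (cmod z2)\<^sup>2 = 1" using z by (simp add: S3_def z12)
  have rho: "z1 * cnj z1 = of_real ((cmod z1)\<^sup>2)" "z2 * cnj z2 = of_real ((cmod z2)\<^sup>2)"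
    by (simp_all only: complex_norm_square)
  define u where "u = (cmod z2)\<^sup>2"
  have uu: "z2 * cnj z2 = of_real u" "z1 * cnj z1 = of_real (1 - u)"
    using sph rho by (auto simp: u_def algebra_simps)
  have u: "0 \<le> u" "u \<le> 1"
    using n zero_le_power2[of "cmod z1"] unfolding u_def by (simp, linarith)
  define k where "k = 1 + t * u"
  have kpos: "0 < k" using t u by (simp add: k_def add_pos_nonneg)
  define \<nu> where "\<nu> = N * t / k"
  define u' where "u' = z2 * cnj v2 + v2 * cnj z2"
  define Z1 where "Z1 = z1 - s * cnj z1 * cnj z2 ^ 2"
  define Y2 where "Y2 = D u * z2 + s * cnj z1 ^ 2 * cnj z2 + s ^ 3 * z1 ^ 2 * z2 ^ 3"
  define d1 where "d1 = v1 - s * (cnj v1 * cnj z2 ^ 2 + 2 * cnj z1 * cnj z2 * cnj v2)"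
  define e2 where "e2 = (- 2 * s ^ 3 * (2 + s) * u * u') * z2 + D u * v2
         + s * (2 * cnj z1 * cnj v1 * cnj z2 + cnj z1 ^ 2 * cnj v2) + s ^ 3 * (2 * z1 * v1 * z2 ^ 3 + 3 * z1 ^ 2 * z2 ^ 2 * v2)"
  have zm: "zmap \<tau> N t z = (Z1, of_real (k ^ N) * Y2)"
    unfolding zmap_def zsnd_def z12 fst_conv snd_conv uu s_def[symmetric]
    by (simp add: Z1_def Y2_def D_def k_def)
  have zm': "zmap' \<tau> N t z v = (d1, of_real (k ^ N) * (e2 + \<nu> * u' * Y2))"
  proof -
    have k: "1 + complex_of_real t * complex_of_real u = of_real k" by (simp add: k_def)
    have k0: "complex_of_real k \<noteq> 0" using kpos by simp
    show ?thesis
      unfolding zmap'_def zsnd_def zsnd'_def z12 v12 fst_conv snd_conv uu s_def[symmetric] k u'_def[symmetric] power_pred[OF k0]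
      by (simp add: d1_def e2_def Y2_def D_def \<nu>_def algebra_simps)
  qed
  have kN: "complex_of_real (k ^ N) \<noteq> 0" using kpos by simp
  have E1: "d1 = c * Z1" and E2: "e2 + \<nu> * u' * Y2 = c * Y2"
  proof -
    have "d1 = c *\<^sub>R Z1" and *: "of_real (k ^ N) * (e2 + \<nu> * u' * Y2) = c *\<^sub>R (of_real (k ^ N) * Y2)"
      using eq unfolding zm zm' by (simp_all add: prod_eq_iff)
    then show "d1 = c * Z1" by (simp add: scaleR_conv_of_real)
    show "e2 + \<nu> * u' * Y2 = c * Y2"
      using * unfolding mult_scaleR_right[symmetric] mult_left_cancel[OF kN] by (simp add: scaleR_conv_of_real)
  qed
  consider "z2 = 0" | "z1 = 0" | "z1 \<noteq> 0" "z2 \<noteq> 0" by blast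
  then show ?thesis
  proof cases
    case 1
    then have u0: "u = 0" "u' = 0" by (auto simp: u_def u'_def)
    have z1: "z1 * cnj z1 = 1" using sph 1 by simp
    have n1: "cmod z1 = 1" by (rule power2_eq_imp_eq) (use n 1 in simp_all)
    have v1: "v1 = c * z1" using E1 1 by (simp add: d1_def Z1_def)
    have "of_real c * (z1 * cnj z1) * 2 = 0" using tan' 1 by (simp add: v1 algebra_simps)
    then have "c = 0" using z1 by simp
    then have v10: "v1 = 0" using v1 by simp
    have "D 0 * v2 + s * cnj z1 ^ 2 * cnj v2 = 0"
      using E2 1 v10 u0 by (simp add: e2_def Y2_def mult.assoc)
    then have "D 0 * v2 = - (s * cnj z1 ^ 2 * cnj v2)" by (simp add: add_eq_0_iff2)
    then have "\<bar>1 + 2 * s\<bar> * cmod v2 = \<bar>s\<bar> * cmod v2"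
      by (metis (no_types, opaque_lifting) D_def complex_mod_cnj diff_zero mult.right_neutral mult_zero_right norm_minus_cancel norm_mult norm_of_real norm_power power_one n1 zero_power2)
    \<comment> \<open>The lower end of the parameter range enters here: for negative
      \<open>s\<close> this inequality says \<open>- (1/3) < s\<close>.\<close>
    moreover have "\<bar>s\<bar> < \<bar>1 + 2 * s\<bar>" using s' s by linarith
    ultimately have "v2 = 0" by simp
    then show ?thesis using v10 by (simp add: v12 zero_prod_def)
  next
    case 2
    then have u1: "u = 1" using n by (simp add: u_def)
    have z2: "z2 * cnj z2 = 1" using sph 2 by simp
    have n2: "cmod z2 = 1" by (rule power2_eq_imp_eq) (use n 2 in simp_all)
    have "v1 = s * (cnj v1 * cnj z2 ^ 2)" using E1 2 by (simp add: d1_def Z1_def)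
    then have "cmod v1 = \<bar>s\<bar> * cmod v1"
      by (metis complex_mod_cnj mult.right_neutral norm_mult norm_of_real norm_power power_one n2)
    then have v1: "v1 = 0" using s by auto
    have u'0: "u' = 0" using tan' 2 by (simp add: u'_def mult.commute)
    have "D 1 * v2 = c * (D 1 * z2)" using E2 2 v1 u1 u'0 by (simp add: e2_def Y2_def)
    moreover have "D 1 \<noteq> 0"
    proof -
      \<comment> \<open>The factorization shows that the upper end \<open>s = 1\<close> of the range
        is a zero of \<open>D 1\<close>.\<close>
      have "D 1 = (1 - s) * (1 + s) ^ 3" by (simp add: D_def power3_eq_cube power2_eq_square algebra_simps)
      then show ?thesis using s s' by simp
    qed
    ultimately have v2: "v2 = c * z2" by simp
    have z20: "z2 \<noteq> 0" using n2 by auto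
    have "c = 0" using u'0 v2 z20 by (auto simp: u'_def mult.commute mult.left_commute)
    then show ?thesis using v2 v1 by (simp add: v12 zero_prod_def)
  next
    case 3
    define a1 a2 where "a1 = v1 / z1" and "a2 = v2 / z2"
    have v: "v1 = z1 * a1" "v2 = z2 * a2" using 3 by (auto simp: a1_def a2_def)
    define e where "e = z1 * z2 / (cnj z1 * cnj z2)"
    have e1: "cmod e = 1" using 3 by (simp add: e_def norm_divide norm_mult)
    have e': "cnj e = cnj z1 * cnj z2 / (z1 * z2)" by (simp add: e_def)
    define x y where "x = Re (a2 - cnj a1)" and "y = Im (a2 - cnj a1)"
    have xy: "a2 = cnj a1 + of_real x + \<i> * of_real y" by (simp add: x_def y_def complex_eq_iff)
    have cxy: "cnj a2 = a1 + of_real x - \<i> * of_real y" by (simp add: xy)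
    have "(1 - of_real u) * (a1 + cnj a1) + of_real u * (a2 + cnj a2) = 0"
    proof -
      have "z1 * cnj v1 + cnj z1 * v1 + (z2 * cnj v2 + cnj z2 * v2) = (z1 * cnj z1) * (a1 + cnj a1) + (z2 * cnj z2) * (a2 + cnj a2)"
        by (simp add: v algebra_simps)
      then show ?thesis using tan' unfolding uu by simp
    qed
    then have ca1: "cnj a1 = - a1 - 2 * of_real u * of_real x"
    proof -
      assume a: "(1 - of_real u) * (a1 + cnj a1) + of_real u * (a2 + cnj a2) = 0"
      have "(1 - of_real u) * (a1 + cnj a1) + of_real u * (a2 + cnj a2) = a1 + cnj a1 + 2 * of_real u * of_real x"
        unfolding cxy xy by (simp add: algebra_simps)
      with a have b: "a1 + cnj a1 + 2 * of_real u * of_real x = 0" by simp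
      have "cnj a1 = (a1 + cnj a1 + 2 * of_real u * of_real x) - a1 - 2 * of_real u * of_real x" by simp
      then show ?thesis unfolding b by simp
    qed
    have a2: "a2 = - a1 - 2 * of_real u * of_real x + of_real x + \<i> * of_real y"
      by (subst xy) (simp add: ca1)
    define A where "A = WA s u e"
    define B where "B = WB s u e"
    have sph': "1 - complex_of_real u = z1 * cnj z1" "complex_of_real u = z2 * cnj z2" using uu by simp_all
    have ue: "of_real u * e * cnj z1 = z1 * z2 ^ 2" "(1 - of_real u) * cnj e * z2 = cnj z1 ^ 2 * cnj z2"
      "of_real u * (1 - of_real u) * e * z2 = z1 ^ 2 * z2 ^ 3"
      unfolding sph'(1) unfolding sph'(2) e' e_def using 3 by (auto simp: field_simps power2_eq_square power3_eq_cube)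
    have R1: "cnj Z1 = cnj z1 * A"
    proof -
      have "cnj z1 * A = cnj z1 - s * (of_real u * e * cnj z1)" by (simp add: A_def WA_def algebra_simps)
      then show ?thesis unfolding ue by (simp add: Z1_def mult.assoc)
    qed
    have R2: "Y2 = z2 * B"
    proof -
      have "z2 * B = D u * z2 + s * ((1 - of_real u) * cnj e * z2) + s ^ 3 * (of_real u * (1 - of_real u) * e * z2)"
        by (simp add: B_def WB_def D_def algebra_simps)
      then show ?thesis unfolding ue by (simp add: Y2_def mult.assoc)
    qed
    have R3: "cnj d1 = cnj z1 * (cnj a1 - s * u * e * (a1 + 2 * a2))"
    proof -
      have "cnj z1 * (cnj a1 - s * u * e * (a1 + 2 * a2)) = cnj z1 * cnj a1 - s * (of_real u * e * cnj z1) * (a1 + 2 * a2)"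
        by (simp add: algebra_simps)
      then show ?thesis unfolding ue by (simp add: d1_def v algebra_simps power2_eq_square)
    qed
    define h where "h = a1 + a2 - cnj a1 - cnj a2"
    have u'eq: "u' = of_real u * (a2 + cnj a2)"
      unfolding u'_def v uu(1)[symmetric] by (simp add: algebra_simps)
    have t1: "(1 - of_real u) * (2 * cnj a1 + cnj a2) = a2 * (1 - of_real u) + (- u' - (1 - of_real u) * h)"
      unfolding u'eq h_def unfolding cxy unfolding a2 ca1 by (simp add: algebra_simps)
    have t2: "of_real u * (1 - of_real u) * (2 * a1 + 3 * a2) = a2 * (of_real u * (1 - of_real u)) + ((1 - 2 * of_real u) * u' + of_real u * (1 - of_real u) * h)"
      unfolding u'eq h_def unfolding cxy unfolding a2 ca1 by (simp add: algebra_simps)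
    have R4: "e2 = z2 * (a2 * B + (- 2 * s ^ 3 * (2 + s) * u * u' + s * (- u' - (1 - u) * h) * cnj e + s ^ 3 * ((1 - 2 * u) * u' + u * (1 - u) * h) * e))"
    proof -
      have "e2 = (- 2 * s ^ 3 * (2 + s) * u * u') * z2 + D u * (z2 * a2)
         + s * ((cnj z1 ^ 2 * cnj z2) * (2 * cnj a1 + cnj a2)) + s ^ 3 * ((z1 ^ 2 * z2 ^ 3) * (2 * a1 + 3 * a2))"
        unfolding e2_def v by (simp add: algebra_simps power2_eq_square power3_eq_cube)
      also have "\<dots> = z2 * ((- 2 * s ^ 3 * (2 + s) * u * u') + D u * a2
         + s * cnj e * ((1 - of_real u) * (2 * cnj a1 + cnj a2)) + s ^ 3 * e * (of_real u * (1 - of_real u) * (2 * a1 + 3 * a2)))"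
        unfolding ue[symmetric] by (simp add: algebra_simps)
      finally show ?thesis unfolding t1 t2 B_def WB_def D_def by (simp add: algebra_simps)
    qed
    \<comment> \<open>As \<open>c\<close> is real, it survives the conjugation of the first
      equation, and the cross difference eliminates it.\<close>
    have "cnj Z1 * (e2 + \<nu> * u' * Y2) - Y2 * cnj d1 = 0"
      unfolding E1 E2 by simp
    moreover have "cnj Z1 * (e2 + \<nu> * u' * Y2) - Y2 * cnj d1 = cnj z1 * z2 *
        (A * (a2 * B + (- 2 * s ^ 3 * (2 + s) * u * u' + s * (- u' - (1 - u) * h) * cnj e + s ^ 3 * ((1 - 2 * u) * u' + u * (1 - u) * h) * e) + \<nu> * u' * B)
     - B * (cnj a1 - s * u * e * (a1 + 2 * a2)))"
      unfolding R1 R2 R3 R4 by (simp add: algebra_simps)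
    ultimately have "A * (a2 * B + (- 2 * s ^ 3 * (2 + s) * u * u' + s * (- u' - (1 - u) * h) * cnj e + s ^ 3 * ((1 - 2 * u) * u' + u * (1 - u) * h) * e) + \<nu> * u' * B)
     - B * (cnj a1 - s * u * e * (a1 + 2 * a2)) = 0"
      using 3 by simp
    moreover have "A * (a2 * B + (- 2 * s ^ 3 * (2 + s) * u * u' + s * (- u' - (1 - u) * h) * cnj e + s ^ 3 * ((1 - 2 * u) * u' + u * (1 - u) * h) * e) + \<nu> * u' * B)
     - B * (cnj a1 - s * u * e * (a1 + 2 * a2)) = of_real x * WT N t s u e + \<i> * of_real y * WP s u e"
      using winding_bracket[where e = e and e' = "cnj e" and ?a1.0 = a1 and s = "of_real s" and \<nu> = "of_real \<nu>"
          and x = "of_real x" and y = "of_real y" and u = "of_real u", folded a2, folded ca1, folded cxy, folded u'eq, folded h_def]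
      by (simp add: A_def B_def WT_def WP_def WQ_def WA_def WB_def \<nu>_def k_def)
    ultimately have XY: "of_real x * WT N t s u e + \<i> * of_real y * WP s u e = 0" by simp
    define T P where "T = WT N t s u e" and "P = WP s u e"
    have pos: "0 < Re (cnj T * P)"
      unfolding T_def P_def s_def by (rule WT_WP_pos[OF \<tau> N t u e1])
    \<comment> \<open>Since \<open>cnj T * T\<close> is real, the imaginary part of this product
      isolates \<open>y * Re (cnj T * P)\<close>.\<close>
    have "cnj T * (of_real x * T + \<i> * of_real y * P) = 0" using XY by (simp add: T_def P_def)
    then have *: "of_real x * (cnj T * T) + \<i> * (of_real y * (cnj T * P)) = 0" by (simp add: algebra_simps)
    have "Im (cnj T * T) = 0" by simp
    with arg_cong[OF *, of Im] have "y * Re (cnj T * P) = 0" by (simp del: complex_cnj_mult)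
    with pos have y0: "y = 0" by simp
    have "T \<noteq> 0" using pos by auto
    with XY y0 have x0: "x = 0" by (simp add: T_def)
    have a20: "a2 = - a1" "cnj a1 = - a1" using a2 ca1 x0 y0 by simp_all
    have "cnj d1 = - a1 * cnj Z1" unfolding R3 R1 a20 A_def WA_def by (simp add: algebra_simps)
    then have "of_real c * cnj Z1 = - a1 * cnj Z1" by (simp add: E1)
    moreover have "cnj Z1 \<noteq> 0"
    proof -
      have "cmod (of_real (s * u) * e) < 1"
        using s u e1 mult_left_le[of u "\<bar>s\<bar>"] by (simp add: norm_mult abs_mult)
      then have "A \<noteq> 0" by (auto simp: A_def WA_def)
      then show ?thesis using R1 3 by simp
    qed
    ultimately have "of_real c = - a1" by (rule mult_right_cancel[THEN iffD1, rotated])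
    then have "a1 = of_real (- c)" by simp
    then have "cnj a1 = a1" by simp
    with a20 have "a1 = 0" by simp
    then show ?thesis using a20 v by (simp add: v12 zero_prod_def)
  qed
qed

text \<open>Comparing moduli in the first component gives \<open>z1 = 0\<close>, as
  \<open>\<bar>s\<bar> < 1\<close> and \<open>cmod z2 \<le> 1\<close>; there the second component is
  \<open>z2\<close> times a positive real.\<close>

lemma zmap_nonzero:
  assumes \<tau>: "- (1/3) < \<tau>" "\<tau> < 1" and t: "0 \<le> t" "t \<le> 1" and z: "z \<in> S3"
  shows "zmap \<tau> N t z \<noteq> 0"
proof
  assume 0: "zmap \<tau> N t z = 0"
  define s where "s = t * \<tau>"
  obtain z1 z2 where z12: "z = (z1, z2)" by (cases z)
  have st: "\<bar>s\<bar> \<le> \<bar>\<tau>\<bar>" unfolding s_def abs_mult using t by (intro mult_left_le_one_le) auto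
  have s: "\<bar>s\<bar> < 1" using st \<tau> by linarith
  have n: "(cmod z1)\<^sup>2 + (cmod z2)\<^sup>2 = 1" using z by (simp add: S3_def z12)
  then have "(cmod z2)\<^sup>2 \<le> 1" using zero_le_power2[of "cmod z1"] by linarith
  have "z1 = s * cnj z1 * cnj z2 ^ 2" using 0 by (simp add: zmap_def zsnd_def z12 s_def zero_prod_def)
  then have "cmod z1 = \<bar>s\<bar> * cmod z1 * (cmod z2)\<^sup>2" by (metis complex_mod_cnj norm_mult norm_of_real norm_power)
  also have "\<dots> \<le> \<bar>s\<bar> * cmod z1 * 1" using \<open>(cmod z2)\<^sup>2 \<le> 1\<close> by (intro mult_left_mono) auto
  finally have "(1 - \<bar>s\<bar>) * cmod z1 \<le> 0" by (simp add: left_diff_distrib)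
  then have z1: "z1 = 0" using s by (simp add: mult_le_0_iff)
  then have z2: "z2 * cnj z2 = 1" using z by (simp add: S3_iff z12)
  have "(1 + t) ^ N * ((1 + 2 * s - s ^ 3 * (2 + s)) * z2) = 0"
    using 0 z1 z2 by (simp add: zmap_def zsnd_def z12 s_def zero_prod_def)
  moreover have "1 + 2 * s - s ^ 3 * (2 + s) = (1 - s) * (1 + s) ^ 3" by (simp add: power3_eq_cube algebra_simps)
  ultimately have "complex_of_real ((1 + t) ^ N * ((1 - s) * (1 + s) ^ 3)) * z2 = 0" by simp
  moreover have "0 < (1 + t) ^ N * ((1 - s) * (1 + s) ^ 3)"
    using s t by (intro mult_pos_pos zero_less_power) auto
  moreover have "z2 \<noteq> 0" using z2 by auto
  ultimately show False by (metis mult_eq_0_iff of_real_eq_0_iff less_irrefl)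
qed

text \<open>With \<open>w = z1 * z2\<close> the complex expression is \<open>\<i> * k * X\<close>,
  and \<open>X\<close> is real because its coefficients at \<open>w\<close> and \<open>cnj w\<close>
  agree, and so do those at their cubes. The cubic ones agree by the relation between
  \<open>\<tau>\<close>, \<open>p\<close> and \<open>q\<close>.\<close>

lemma zmap_legendrian:
  fixes p q :: real
  assumes z: "z \<in> S3" and s: "p - q = \<tau> * (p + 3 * q)"
  shows "Re (fst (zmap \<tau> N 1 z) * snd (zmap' \<tau> N 1 z (\<i> * p * fst z, \<i> * q * snd z))
           - snd (zmap \<tau> N 1 z) * fst (zmap' \<tau> N 1 z (\<i> * p * fst z, \<i> * q * snd z))) = 0"
proof -
  obtain z1 z2 where z12: "z = (z1, z2)" by (cases z)
  define u where "u = (cmod z2)\<^sup>2"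
  have uu: "z2 * cnj z2 = of_real u" "z1 * cnj z1 = of_real (1 - u)"
  proof -
    show 1: "z2 * cnj z2 = of_real u" by (simp only: u_def complex_norm_square)
    have "z1 * cnj z1 = 1 - z2 * cnj z2" using z by (simp add: S3_iff z12 eq_diff_eq)
    then show "z1 * cnj z1 = of_real (1 - u)" unfolding 1 by simp
  qed
  define D where "D = 1 + 2 * \<tau> - \<tau> ^ 3 * (2 + \<tau>) * u\<^sup>2"
  define k where "k = (1 + u) ^ N"
  define m where "m = p + 3 * q"
  have qp: "q - p = - (\<tau> * m)" using s by (simp add: m_def)
  have "3 * p + q = m + 2 * (p - q)" "3 * p + 5 * q = 2 * m + (p - q)" by (simp_all add: m_def)
  then have pq: "3 * p + q = m * (1 + 2 * \<tau>)" "3 * p + 5 * q = m * (2 + \<tau>)"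
    using s by (simp_all add: m_def algebra_simps)
  define w where "w = z1 * z2"
  define a where "a = D * (q - p) - \<tau> ^ 4 * (3 * p + 5 * q) * (1 - u) * u\<^sup>2"
  define b where "b = \<tau> * (3 * p + q) * (1 - u) + \<tau> * (p + 3 * q) * D * u"
  \<comment> \<open>The sum \<open>a + b\<close> is \<open>\<tau> * m * (1 - u)\<close> times the
    defect in the equation that defines \<open>D\<close>, which explains the form of
    \<open>D\<close>.\<close>
  have ab: "a = - b" unfolding a_def b_def qp pq m_def[symmetric] D_def by (simp add: algebra_simps power2_eq_square power3_eq_cube power4_eq_xxxx)
  have l: "z1 * cnj z1 ^ 2 * cnj z2 = (1 - u) * cnj w" "cnj z1 * cnj z2 ^ 2 * z2 = u * cnj w"
    "cnj z1 * cnj z2 ^ 2 * (z1 ^ 2 * z2 ^ 3) = (1 - u) * u\<^sup>2 * w"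
  proof -
    have "z1 * cnj z1 ^ 2 * cnj z2 = (z1 * cnj z1) * cnj w" "cnj z1 * cnj z2 ^ 2 * z2 = (z2 * cnj z2) * cnj w"
     "cnj z1 * cnj z2 ^ 2 * (z1 ^ 2 * z2 ^ 3) = (z1 * cnj z1) * (z2 * cnj z2)\<^sup>2 * w"
      by (simp_all add: w_def power2_eq_square power3_eq_cube mult_ac)
    then show "z1 * cnj z1 ^ 2 * cnj z2 = (1 - u) * cnj w" "cnj z1 * cnj z2 ^ 2 * z2 = u * cnj w"
    "cnj z1 * cnj z2 ^ 2 * (z1 ^ 2 * z2 ^ 3) = (1 - u) * u\<^sup>2 * w" unfolding uu by simp_all
  qed
  \<comment> \<open>The modulus of \<open>z2\<close> is constant along the circle, so the derivative
    of the power factor drops out.\<close>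
  have u'0: "z2 * cnj (\<i> * q * z2) + \<i> * q * z2 * cnj z2 = 0" by (simp add: algebra_simps)
  define X where "X = (z1 - \<tau> * (cnj z1 * cnj z2 ^ 2)) * (q * D * z2 - \<tau> * (2 * p + q) * (cnj z1 ^ 2 * cnj z2) + \<tau> ^ 3 * (2 * p + 3 * q) * (z1 ^ 2 * z2 ^ 3))
     - (D * z2 + \<tau> * (cnj z1 ^ 2 * cnj z2) + \<tau> ^ 3 * (z1 ^ 2 * z2 ^ 3)) * (p * z1 + \<tau> * (p + 2 * q) * (cnj z1 * cnj z2 ^ 2))"
  have "fst (zmap \<tau> N 1 z) * snd (zmap' \<tau> N 1 z (\<i> * p * fst z, \<i> * q * snd z))
           - snd (zmap \<tau> N 1 z) * fst (zmap' \<tau> N 1 z (\<i> * p * fst z, \<i> * q * snd z)) = \<i> * of_real k * X"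
    unfolding zmap_def zmap'_def zsnd_def zsnd'_def z12 fst_conv snd_conv uu u'0 X_def D_def k_def
    by (simp add: algebra_simps power2_eq_square power3_eq_cube)
  moreover have "X = a * w - b * cnj w + \<tau> ^ 3 * m * w ^ 3 + \<tau> ^ 2 * (p - q) * cnj w ^ 3"
  proof -
    have "X = D * (q - p) * (z1 * z2) - \<tau> * (3 * p + q) * (z1 * cnj z1 ^ 2 * cnj z2) - \<tau> * (p + 3 * q) * D * (cnj z1 * cnj z2 ^ 2 * z2)
      + \<tau> ^ 3 * (p + 3 * q) * (z1 * z2) ^ 3 + \<tau> ^ 2 * (p - q) * (cnj z1 * cnj z2) ^ 3
      - \<tau> ^ 4 * (3 * p + 5 * q) * (cnj z1 * cnj z2 ^ 2 * (z1 ^ 2 * z2 ^ 3))"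
      unfolding X_def by (simp add: algebra_simps power2_eq_square power3_eq_cube power4_eq_xxxx)
    then show ?thesis unfolding l by (simp add: a_def b_def m_def w_def algebra_simps)
  qed
  moreover have "Im (a * w - b * cnj w + \<tau> ^ 3 * m * w ^ 3 + \<tau> ^ 2 * (p - q) * cnj w ^ 3) = 0"
  proof -
    have "\<tau> ^ 2 * (p - q) = \<tau> ^ 3 * m" using s by (simp add: m_def power2_eq_square power3_eq_cube)
    then have "a * w - b * cnj w + \<tau> ^ 3 * m * w ^ 3 + \<tau> ^ 2 * (p - q) * cnj w ^ 3
       = of_real (- b) * (w + cnj w) + of_real (\<tau> ^ 3 * m) * (w ^ 3 + cnj (w ^ 3))"
      unfolding ab by (simp add: algebra_simps flip: of_real_power of_real_mult of_real_diff)
    moreover have "Im (of_real r * (x + cnj x)) = 0" for r x by simp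
    ultimately show ?thesis by (simp only: plus_complex.sel)
  qed
  ultimately show ?thesis by simp
qed

section \<open>Isotopies of the sphere\<close>

text \<open>The derivative of the right inverse \<open>g\<close> is injective, since
  \<open>D\<close> after it is the identity, so \<open>g\<close> has a right inverse
  \<open>h\<close> of its own. Near \<open>a\<close>, \<open>h = f g h = f\<close>, and
  \<open>g\<close> is a left inverse too.\<close>

theorem ana_local_inverse_two_sided:
  fixes f :: "'a::euclidean_space \<Rightarrow> 'a"
  assumes f: "ana f a" and der: "(f has_derivative D) (at a)" and inj: "inj D"
  obtains g where "ana g (f a)" "g (f a) = a" "eventually (\<lambda>y. f (g y) = y) (nhds (f a))"
    "eventually (\<lambda>x. g (f x) = x) (nhds a)"
proof -
  obtain g where g: "ana g (f a)" "g (f a) = a" and fg: "eventually (\<lambda>y. f (g y) = y) (nhds (f a))"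
    using ana_local_inverse[OF f der inj] by blast
  obtain E where E: "(g has_derivative E) (at (f a))"
    using ana_differentiable[OF g(1)] by (auto simp: differentiable_def)
  have "((\<lambda>y. f (g y)) has_derivative (\<lambda>v. D (E v))) (at (f a))"
    by (rule has_derivative_compose[OF E]) (simp add: g(2) der)
  moreover have "((\<lambda>y. f (g y)) has_derivative (\<lambda>v. v)) (at (f a))"
  proof (rule has_derivative_transform_eventually[OF has_derivative_ident])
    show "eventually (\<lambda>x. x = f (g x)) (at (f a))"
      using fg by (auto simp: eventually_at_filter elim: eventually_mono)
  qed (use eventually_nhds_x_imp_x[OF fg] in auto)
  ultimately have "(\<lambda>v. D (E v)) = (\<lambda>v. v)" by (rule has_derivative_unique)
  then have "inj E" by (intro injI) metis
  then obtain h where h: "ana h (g (f a))" "h (g (f a)) = f a" and gh: "eventually (\<lambda>x. g (h x) = x) (nhds (g (f a)))"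
    using ana_local_inverse[OF g(1) E] by blast
  have "eventually (\<lambda>x. f (g (h x)) = h x) (nhds a)"
  proof (rule eventually_compose_filterlim[OF fg])
    show "filterlim h (nhds (f a)) (nhds a)"
      using ana_isCont[OF h(1)] h(2) by (simp add: isCont_def tendsto_nhds_iff g(2))
  qed
  then have "eventually (\<lambda>x. g (f x) = x) (nhds a)"
    using gh unfolding g(2) by eventually_elim simp
  with g fg that show ?thesis by blast
qed

text \<open>Injectivity along the isotopy persists: a double point at a minimal time would, by the
  local inverses at its two preimages, persist for slightly smaller times.\<close>

theorem isotopy_of_immersions:
  fixes \<Psi> :: "real \<times> 'a::euclidean_space \<Rightarrow> 'a"
  assumes dim: "2 \<le> DIM('a)"
    and ana: "\<And>t x. 0 \<le> t \<Longrightarrow> t \<le> 1 \<Longrightarrow> norm x = 1 \<Longrightarrow> ana \<Psi> (t, x)"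
    and nrm: "\<And>t x. 0 \<le> t \<Longrightarrow> t \<le> 1 \<Longrightarrow> norm (\<Psi> (t, x)) = norm x"
    and imm: "\<And>t x D v. 0 \<le> t \<Longrightarrow> t \<le> 1 \<Longrightarrow> norm x = 1 \<Longrightarrow>
       ((\<lambda>x. \<Psi> (t, x)) has_derivative D) (at x) \<Longrightarrow> D v = 0 \<Longrightarrow> v = 0"
    and id: "\<And>x. norm x = 1 \<Longrightarrow> \<Psi> (0, x) = x"
    and t: "0 \<le> t" "t \<le> 1"
  shows "bij_betw (\<lambda>x. \<Psi> (t, x)) (sphere 0 1) (sphere 0 1)"
    and "y \<noteq> 0 \<Longrightarrow> ana (\<lambda>y. inv_into (sphere 0 1) (\<lambda>x. \<Psi> (t, x)) (sgn y)) y"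
proof -
  \<comment> \<open>Keeping time as a coordinate yields local inverses that depend analytically on
    time.\<close>
  define Q where "Q p = (fst p, \<Psi> p)" for p
  let ?S = "sphere (0::'a) 1"
  have loc: "\<exists>g. ana g (Q (t, x)) \<and> g (Q (t, x)) = (t, x) \<and> eventually (\<lambda>y. Q (g y) = y) (nhds (Q (t, x)))
      \<and> eventually (\<lambda>p. g (Q p) = p) (nhds (t, x))" if tx: "0 \<le> t" "t \<le> 1" "norm x = 1" for t x
  proof -
    have A: "ana Q (t, x)"
      unfolding Q_def by (intro ana_Pair ana_fst ana_ident ana[OF tx])
    obtain E where E: "(\<Psi> has_derivative E) (at (t, x))"
      using ana_differentiable[OF ana[OF tx]] by (auto simp: differentiable_def)
    have QD: "(Q has_derivative (\<lambda>v. (fst v, E v))) (at (t, x))"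
      unfolding Q_def by (intro has_derivative_Pair has_derivative_fst has_derivative_ident E)
    have lin: "linear (\<lambda>v. (fst v, E v))" using QD has_derivative_linear by blast
    have ker: "v = 0" if "(fst v, E v) = 0" for v
    proof -
      have v: "fst v = 0" "E v = 0" using that by (auto simp: zero_prod_def)
      have "((\<lambda>x. (t, x)) has_derivative (\<lambda>w. (0, w))) (at x)"
        by (auto intro!: derivative_eq_intros)
      from has_derivative_compose[OF this, of \<Psi> E] E
      have "((\<lambda>x. \<Psi> (t, x)) has_derivative (\<lambda>w. E (0, w))) (at x)" by simp
      moreover have "E (0, snd v) = 0" using v by (metis prod.collapse)
      ultimately have "snd v = 0" by (rule imm[OF tx])
      then show ?thesis using v by (simp add: prod_eq_iff)
    qed
    have "inj (\<lambda>v. (fst v, E v))"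
      unfolding linear_injective_0[OF lin] using ker by blast
    from ana_local_inverse_two_sided[OF A QD this] show ?thesis by blast
  qed
  have cont: "isCont \<Psi> (t, x)" if "0 \<le> t" "t \<le> 1" "norm x = 1" for t x
    using ana[OF that] by (rule ana_isCont)
  define T where "T = {t. 0 \<le> t \<and> t \<le> 1 \<and> (\<exists>x y. norm x = 1 \<and> norm y = 1 \<and> x \<noteq> y \<and> \<Psi> (t, x) = \<Psi> (t, y))}"
  have "T = {}"
  proof (rule ccontr)
    assume ne: "T \<noteq> {}"
    \<comment> \<open>Compactness of the sphere provides a pair with equal images at the infimum of
      the bad times.\<close>
    define t0 where "t0 = Inf T"
    have bdd: "bdd_below T" by (auto simp: T_def intro!: bdd_belowI[of _ 0])
    have "\<exists>t\<in>T. t < t0 + 1 / real (Suc n)" for n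
      using cInf_lessD[OF ne, of "t0 + 1 / real (Suc n)"] by (simp add: t0_def)
    then have "\<exists>t x y. t < t0 + 1 / real (Suc n) \<and> t \<in> T \<and> norm x = 1 \<and> norm y = 1 \<and> x \<noteq> y \<and> \<Psi> (t, x) = \<Psi> (t, y)" for n
      unfolding T_def by blast
    then obtain \<tau> X Y where seq: "\<And>n. \<tau> n < t0 + 1 / real (Suc n)" "\<And>n. \<tau> n \<in> T" "\<And>n. norm (X n) = 1"
      "\<And>n. norm (Y n) = 1" "\<And>n. X n \<noteq> Y n" "\<And>n. \<Psi> (\<tau> n, X n) = \<Psi> (\<tau> n, Y n)"
      by metis
    have "\<tau> \<longlonglongrightarrow> t0"
    proof (rule real_tendsto_sandwich)
      show "eventually (\<lambda>n. t0 \<le> \<tau> n) sequentially" using cInf_lower[OF seq(2) bdd] by (simp add: t0_def)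
      show "eventually (\<lambda>n. \<tau> n \<le> t0 + 1 / real (Suc n)) sequentially" by (intro always_eventually allI less_imp_le seq(1))
      show "(\<lambda>n. t0 + 1 / real (Suc n)) \<longlonglongrightarrow> t0"
        using tendsto_add[OF tendsto_const LIMSEQ_inverse_real_of_nat, of t0] by (simp add: inverse_eq_divide)
    qed simp
    have "compact (?S \<times> ?S)" by (intro compact_Times compact_sphere)
    moreover have "\<forall>n. (X n, Y n) \<in> ?S \<times> ?S" using seq by auto
    ultimately obtain l r where lr: "l \<in> ?S \<times> ?S" "strict_mono r" "((\<lambda>n. (X n, Y n)) \<circ> r) \<longlonglongrightarrow> l"
      unfolding compact_def by meson
    obtain x y where l: "l = (x, y)" by (cases l)
    have xy: "norm x = 1" "norm y = 1" using lr l by auto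
    have lim: "(\<lambda>n. X (r n)) \<longlonglongrightarrow> x" "(\<lambda>n. Y (r n)) \<longlonglongrightarrow> y" "(\<lambda>n. \<tau> (r n)) \<longlonglongrightarrow> t0"
      using tendsto_fst[OF lr(3)] tendsto_snd[OF lr(3)] LIMSEQ_subseq_LIMSEQ[OF \<open>\<tau> \<longlonglongrightarrow> t0\<close> lr(2)]
      by (auto simp: l o_def)
    have t0: "0 \<le> t0" "t0 \<le> 1"
      using LIMSEQ_le_const[OF \<open>\<tau> \<longlonglongrightarrow> t0\<close>, of 0] LIMSEQ_le_const2[OF \<open>\<tau> \<longlonglongrightarrow> t0\<close>, of 1] seq(2)
      by (auto simp: T_def)
    have eq: "\<Psi> (t0, x) = \<Psi> (t0, y)"
    proof (rule LIMSEQ_unique)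
      show "(\<lambda>n. \<Psi> (\<tau> (r n), X (r n))) \<longlonglongrightarrow> \<Psi> (t0, x)"
        by (rule isCont_tendsto_compose[OF cont[OF t0 xy(1)]]) (intro tendsto_Pair lim)
      show "(\<lambda>n. \<Psi> (\<tau> (r n), X (r n))) \<longlonglongrightarrow> \<Psi> (t0, y)"
        unfolding seq(6) by (rule isCont_tendsto_compose[OF cont[OF t0 xy(2)]]) (intro tendsto_Pair lim)
    qed
    \<comment> \<open>Coinciding limits would contradict the local injectivity of \<open>Q\<close>
      at \<open>(t0, x)\<close>.\<close>
    have "x \<noteq> y"
    proof
      assume xeq: "x = y"
      obtain g where g: "eventually (\<lambda>p. g (Q p) = p) (nhds (t0, x))" using loc[OF t0 xy(1)] by blast
      have e: "eventually (\<lambda>n. g (Q (\<tau> (r n), X (r n))) = (\<tau> (r n), X (r n))) sequentially"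
        "eventually (\<lambda>n. g (Q (\<tau> (r n), Y (r n))) = (\<tau> (r n), Y (r n))) sequentially"
        by (rule eventually_compose_filterlim[OF g], use tendsto_Pair[OF lim(3) lim(1)] tendsto_Pair[OF lim(3) lim(2)] xeq in simp)+
      from eventually_happens'[OF sequentially_bot eventually_conj[OF e]] obtain n where
        n: "g (Q (\<tau> (r n), X (r n))) = (\<tau> (r n), X (r n))" "g (Q (\<tau> (r n), Y (r n))) = (\<tau> (r n), Y (r n))"
        by blast
      have "Q (\<tau> (r n), X (r n)) = Q (\<tau> (r n), Y (r n))" using seq(6) by (simp add: Q_def)
      then have "X (r n) = Y (r n)" using n by (metis prod.inject)
      then show False using seq(5) by blast
    qed
    have "t0 \<noteq> 0" using eq id xy \<open>x \<noteq> y\<close> by auto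
    then have "0 < t0" using t0 by simp
    \<comment> \<open>The common value \<open>w\<close> stays fixed while time decreases; the two
      local inverses give distinct preimages of it at times \<open>s n < t0\<close>.\<close>
    define w where "w = \<Psi> (t0, x)"
    obtain g1 where g1: "isCont g1 (t0, w)" "g1 (t0, w) = (t0, x)" "eventually (\<lambda>y. Q (g1 y) = y) (nhds (t0, w))"
      using loc[OF t0 xy(1)] ana_isCont by (auto simp: Q_def w_def)
    obtain g2 where g2: "isCont g2 (t0, w)" "g2 (t0, w) = (t0, y)" "eventually (\<lambda>y. Q (g2 y) = y) (nhds (t0, w))"
      using loc[OF t0 xy(2)] ana_isCont eq by (auto simp: Q_def w_def)
    define s where "s n = t0 * (1 - 1 / real (Suc n))" for n
    have s: "s \<longlonglongrightarrow> t0"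
      using tendsto_mult[OF tendsto_const tendsto_diff[OF tendsto_const LIMSEQ_inverse_real_of_nat], of t0 1]
      by (simp add: s_def[abs_def] inverse_eq_divide)
    have sl: "0 \<le> s n" "s n < t0" "s n \<le> 1" for n
    proof -
      have "0 \<le> 1 - 1 / real (Suc n)" "1 - 1 / real (Suc n) < 1" by simp_all
      then show "0 \<le> s n" "s n < t0" using \<open>0 < t0\<close> by (simp_all add: s_def del: of_nat_Suc)
      then show "s n \<le> 1" using t0 by linarith
    qed
    have sw: "(\<lambda>n. (s n, w)) \<longlonglongrightarrow> (t0, w)" by (intro tendsto_Pair s tendsto_const)
    have lim1: "(\<lambda>n. g1 (s n, w)) \<longlonglongrightarrow> (t0, x)" and lim2: "(\<lambda>n. g2 (s n, w)) \<longlonglongrightarrow> (t0, y)"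
      using isCont_tendsto_compose[OF g1(1) sw] isCont_tendsto_compose[OF g2(1) sw] g1(2) g2(2) by auto
    have "((\<lambda>n. dist (g1 (s n, w)) (g2 (s n, w))) \<longlonglongrightarrow> dist (t0, x) (t0, y))"
      by (intro tendsto_dist lim1 lim2)
    moreover have "0 < dist (t0, x) (t0, y)" using \<open>x \<noteq> y\<close> by simp
    ultimately have "eventually (\<lambda>n. 0 < dist (g1 (s n, w)) (g2 (s n, w))) sequentially"
      by (rule order_tendstoD(1))
    moreover have "eventually (\<lambda>n. Q (g1 (s n, w)) = (s n, w)) sequentially"
      by (rule eventually_compose_filterlim[OF g1(3) sw])
    moreover have "eventually (\<lambda>n. Q (g2 (s n, w)) = (s n, w)) sequentially"
      by (rule eventually_compose_filterlim[OF g2(3) sw])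
    ultimately have "eventually (\<lambda>n. s n \<in> T) sequentially"
    proof eventually_elim
      case (elim n)
      define a b where "a = snd (g1 (s n, w))" and "b = snd (g2 (s n, w))"
      have g: "g1 (s n, w) = (s n, a)" "g2 (s n, w) = (s n, b)"
        using elim by (auto simp: Q_def a_def b_def prod_eq_iff)
      have ab: "\<Psi> (s n, a) = w" "\<Psi> (s n, b) = w" "a \<noteq> b"
        using elim unfolding g by (auto simp: Q_def)
      \<comment> \<open>Preservation of the norm brings the preimages back to the sphere.\<close>
      have "norm w = 1" using nrm[OF t0] xy by (simp add: w_def)
      then have n1: "norm a = 1" "norm b = 1" using nrm[OF sl(1,3), of n a] nrm[OF sl(1,3), of n b] ab by auto
      have "\<Psi> (s n, a) = \<Psi> (s n, b)" using ab by simp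
      with n1 ab(3) sl[of n] show ?case unfolding T_def by blast
    qed
    then obtain n where "s n \<in> T" using eventually_happens'[OF sequentially_bot] by blast
    then have "t0 \<le> s n" unfolding t0_def by (rule cInf_lower[OF _ bdd])
    then show False using sl(2) by (meson not_less)
  qed
  have inj: "inj_on (\<lambda>x. \<Psi> (t, x)) ?S"
  proof (rule inj_onI, rule ccontr)
    fix x y assume "x \<in> ?S" "y \<in> ?S" "\<Psi> (t, x) = \<Psi> (t, y)" "x \<noteq> y"
    then have "t \<in> T" using t unfolding T_def by auto
    with \<open>T = {}\<close> show False by blast
  qed
  let ?I = "(\<lambda>x. \<Psi> (t, x)) ` ?S"
  have sub: "?I \<subseteq> ?S" using nrm[OF t] by auto
  have "continuous_on ?S (\<lambda>x. \<Psi> (t, x))"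
  proof (intro continuous_at_imp_continuous_on ballI)
    fix x assume "x \<in> ?S"
    then have "isCont \<Psi> (t, x)" using cont[OF t] by auto
    then show "isCont (\<lambda>x. \<Psi> (t, x)) x"
      by (intro isCont_o2[where f = "\<lambda>x. (t, x)" and g = \<Psi>] continuous_intros) auto
  qed
  then have "compact ?I" by (intro compact_continuous_image compact_sphere)
  have ev: "eventually (\<lambda>y'. y' \<in> ?S \<longrightarrow> y' \<in> ?I \<and> snd (g (t, y')) \<in> ?S \<and> \<Psi> (t, snd (g (t, y'))) = y') (nhds (\<Psi> (t, x)))"
    if "x \<in> ?S" "eventually (\<lambda>y. Q (g y) = y) (nhds (Q (t, x)))" for x g
  proof -
    have "((\<lambda>y. (t, y)) \<longlongrightarrow> (t, \<Psi> (t, x))) (nhds (\<Psi> (t, x)))"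
      by (rule tendsto_Pair[OF tendsto_const filterlim_ident])
    from eventually_compose_filterlim[OF _ this, of "\<lambda>y. Q (g y) = y"] that(2)
    have "eventually (\<lambda>y. Q (g (t, y)) = (t, y)) (nhds (\<Psi> (t, x)))" by (simp add: Q_def)
    then show ?thesis
    proof eventually_elim
      case (elim y')
      then have "g (t, y') = (t, snd (g (t, y')))" by (auto simp: Q_def prod_eq_iff)
      then have *: "\<Psi> (t, snd (g (t, y'))) = y'" using elim by (metis Q_def snd_conv)
      show ?case
      proof
        assume "y' \<in> ?S"
        then have "snd (g (t, y')) \<in> ?S" using nrm[OF t, of "snd (g (t, y'))"] * by simp
        with * show "y' \<in> ?I \<and> snd (g (t, y')) \<in> ?S \<and> \<Psi> (t, snd (g (t, y'))) = y'" by force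
      qed
    qed
  qed
  \<comment> \<open>The image is open by the local inverses and closed by compactness; connectedness
    of the sphere makes it everything.\<close>
  have "openin (top_of_set ?S) ?I"
  proof (subst openin_subopen, intro ballI)
    fix y assume "y \<in> ?I"
    then obtain x where x: "x \<in> ?S" "y = \<Psi> (t, x)" by blast
    obtain g where "eventually (\<lambda>y. Q (g y) = y) (nhds (Q (t, x)))" using loc[OF t, of x] x by auto
    from ev[OF x(1) this] obtain U where "open U" "y \<in> U" "\<forall>y'\<in>U. y' \<in> ?S \<longrightarrow> y' \<in> ?I"
      unfolding eventually_nhds x(2) by blast
    then show "\<exists>V. openin (top_of_set ?S) V \<and> y \<in> V \<and> V \<subseteq> ?I"
      using sub \<open>y \<in> ?I\<close> by (intro exI[of _ "?S \<inter> U"]) (auto simp: openin_open)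
  qed
  moreover have "closedin (top_of_set ?S) ?I"
    using \<open>compact ?I\<close> sub by (intro closed_subset compact_imp_closed)
  moreover have "?I \<noteq> {}" using dim by (auto simp: sphere_eq_empty)
  ultimately have "?I = ?S"
    using connected_sphere[OF dim, of 0 1] unfolding connected_clopen by blast
  with inj show bij: "bij_betw (\<lambda>x. \<Psi> (t, x)) ?S ?S" by (simp add: bij_betw_def)
  show "ana (\<lambda>y. inv_into ?S (\<lambda>x. \<Psi> (t, x)) (sgn y)) y" if "y \<noteq> 0"
  proof -
    have sy: "sgn y \<in> ?S" using that by (simp add: norm_sgn)
    then obtain x where x: "x \<in> ?S" "sgn y = \<Psi> (t, x)" using \<open>?I = ?S\<close> by blast
    obtain g where g: "ana g (t, sgn y)" and e: "eventually (\<lambda>y. Q (g y) = y) (nhds (Q (t, x)))"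
      using loc[OF t, of x] x by (auto simp: Q_def)
    \<comment> \<open>Composition with \<open>sgn\<close> extends the inverse to a 0-homogeneous map
      on an open set of the ambient space.\<close>
    have "ana (\<lambda>y. snd (g (t, sgn y))) y"
      by (rule ana_snd[OF ana_compose[OF g ana_Pair[OF ana_const ana_sgn[OF ana_ident that]]]])
    moreover have "eventually (\<lambda>y'. snd (g (t, sgn y')) = inv_into ?S (\<lambda>x. \<Psi> (t, x)) (sgn y')) (nhds y)"
    proof -
      have "filterlim sgn (nhds (\<Psi> (t, x))) (nhds y)"
        using ana_isCont[OF ana_sgn[OF ana_ident that]] x(2) by (simp add: isCont_def tendsto_nhds_iff)
      from eventually_compose_filterlim[OF ev[OF x(1) e] this]
      have 1: "eventually (\<lambda>y'. sgn y' \<in> ?S \<longrightarrow> sgn y' \<in> ?I \<and> snd (g (t, sgn y')) \<in> ?S \<and> \<Psi> (t, snd (g (t, sgn y'))) = sgn y') (nhds y)" .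
      have "eventually (\<lambda>y'. y' \<noteq> 0) (nhds y)" using that by (rule t1_space_nhds)
      with 1 show ?thesis
      proof eventually_elim
        case (elim y')
        then have "sgn y' \<in> ?S" by (simp add: norm_sgn)
        with elim show ?case using inv_into_f_f[OF inj, of "snd (g (t, sgn y'))"] by auto
      qed
    qed
    ultimately show ?thesis by (rule ana_cong)
  qed
qed

section \<open>The quaternionic frame and the normalized family\<close>

definition J1 :: "C2 \<Rightarrow> C2" where "J1 z = (\<i> * fst z, \<i> * snd z)"
definition J2 :: "C2 \<Rightarrow> C2" where "J2 z = (- cnj (snd z), cnj (fst z))"
definition J3 :: "C2 \<Rightarrow> C2" where "J3 z = (- \<i> * cnj (snd z), \<i> * cnj (fst z))"

text \<open>\<open>J1\<close>, \<open>J2\<close>, \<open>J3\<close> are quaternion units with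
  \<open>J1 J2 = J3\<close>. The contact form is \<open>J1 z \<bullet> v\<close>, and
  \<open>J2 z \<bullet> v\<close> is the form \<open>Re (z1 dz2 - z2 dz1)\<close>. As
  \<open>J3\<close> is skew and orthogonal and anticommutes with \<open>J1\<close>,
  \<open>rot t\<close> is a scalar times a rotation, and \<open>rot 1\<close> pulls the contact form
  back to twice the other form.\<close>

definition rot :: "real \<Rightarrow> C2 \<Rightarrow> C2" where "rot t w = w - t *\<^sub>R J3 w"

lemma S3_eq_sphere: "S3 = sphere 0 1"
  by (auto simp: S3_def norm_Pair)

lemma bounded_linear_J: "bounded_linear J1" "bounded_linear J2" "bounded_linear J3"
  unfolding J1_def[abs_def] J2_def[abs_def] J3_def[abs_def]
  by (intro bounded_linear_Pair bounded_linear_minus bounded_linear_const_mult bounded_linear_fst bounded_linear_snd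
      bounded_linear_compose[OF bounded_linear_cnj])+

lemma bounded_linear_rot: "bounded_linear (rot t)"
  unfolding rot_def[abs_def]
  by (intro bounded_linear_sub bounded_linear_ident bounded_linear_compose[OF bounded_linear_scaleR_right bounded_linear_J(3)])

lemma norm_rot: "(norm (rot t w))\<^sup>2 = (1 + t\<^sup>2) * (norm w)\<^sup>2"
  unfolding power2_norm_eq_inner
  by (simp add: inner_prod_def inner_complex_def rot_def J3_def power2_eq_square algebra_simps)

lemma rot_eq_0_iff: "rot t w = 0 \<longleftrightarrow> w = 0"
proof -
  have "(norm (rot t w))\<^sup>2 = 0 \<longleftrightarrow> (norm w)\<^sup>2 = 0"
    unfolding norm_rot using zero_le_power2[of t] by (simp add: add_nonneg_eq_0_iff del: zero_le_power2)
  then show ?thesis by simp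
qed

lemma rot_scaleR: "rot t (c *\<^sub>R w) = c *\<^sub>R rot t w"
  by (rule linear_scale[OF bounded_linear.linear[OF bounded_linear_rot]])

lemma rot_inject: "rot t v = rot t w \<longleftrightarrow> v = w"
  using rot_eq_0_iff[of t "v - w"] linear_diff[OF bounded_linear.linear[OF bounded_linear_rot], of t v w] by auto

lemma contact_form_eq: "contact_form z v = J1 z \<bullet> v"
  by (simp add: contact_form_def J1_def inner_prod_def inner_complex_def)

lemma contact_form_rot:
  "contact_form (rot 1 z) (rot 1 v) = 2 * Re (fst z * snd v - snd z * fst v)"
  by (simp add: contact_form_def rot_def J3_def algebra_simps)

lemma sgn_has_derivative:
  fixes x :: "'a::euclidean_space"
  assumes "norm x = 1" shows "(sgn has_derivative (\<lambda>v. v - (x \<bullet> v) *\<^sub>R x)) (at x)"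
proof -
  have x: "x \<noteq> 0" using assms by auto
  have "(norm has_derivative (\<lambda>h. h \<bullet> sgn x)) (at x)" using x by (rule has_derivative_norm)
  from has_derivative_scaleR[OF Deriv.has_derivative_inverse[OF _ this] has_derivative_ident] x
  have "((\<lambda>x. inverse (norm x) *\<^sub>R x) has_derivative
      (\<lambda>v. inverse (norm x) *\<^sub>R v + (- (inverse (norm x) * (v \<bullet> sgn x) * inverse (norm x))) *\<^sub>R x)) (at x)"
    by simp
  then show ?thesis
    unfolding sgn_div_norm[abs_def] by (simp add: assms sgn_div_norm inner_commute)
qed

text \<open>The extension from the sphere is homogeneous of degree 1: the norm is then preserved on
  the ambient space, and the immersion property can be stated for the full differential instead of
  tangent spaces.\<close>

definition fam :: "real \<Rightarrow> nat \<Rightarrow> real \<times> C2 \<Rightarrow> C2" where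
  "fam \<tau> N p = norm (snd p) *\<^sub>R sgn (rot (fst p) (zmap \<tau> N (fst p) (sgn (snd p))))"

context
  fixes \<tau> :: real and N :: nat
  assumes \<tau>: "- (1/3) < \<tau>" "\<tau> < 1" and N: "6400 \<le> N * winding_gap \<tau>"
begin

lemma rot_zmap_nonzero:
  "0 \<le> t \<Longrightarrow> t \<le> 1 \<Longrightarrow> x \<noteq> 0 \<Longrightarrow> rot t (zmap \<tau> N t (sgn x)) \<noteq> 0"
  using zmap_nonzero[OF \<tau>] by (simp add: rot_eq_0_iff S3_eq_sphere norm_sgn)

lemma norm_fam: "0 \<le> t \<Longrightarrow> t \<le> 1 \<Longrightarrow> norm (fam \<tau> N (t, x)) = norm x"
  using rot_zmap_nonzero[of t x] by (cases "x = 0") (auto simp: fam_def norm_sgn)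

lemma ana_rot_zmap: "snd p \<noteq> 0 \<Longrightarrow> ana (\<lambda>p. rot (fst p) (zmap \<tau> N (fst p) (sgn (snd p)))) p"
  unfolding rot_def zmap_def zsnd_def J3_def
  by (intro ana_diff ana_scaleR ana_Pair ana_mult ana_add ana_power ana_cnj ana_minus ana_fst ana_snd ana_sgn
      ana_of_real ana_const ana_ident)

lemma ana_fam: "0 \<le> t \<Longrightarrow> t \<le> 1 \<Longrightarrow> x \<noteq> 0 \<Longrightarrow> ana (fam \<tau> N) (t, x)"
  unfolding fam_def[abs_def]
  by (intro ana_scaleR ana_norm ana_snd ana_ident ana_sgn ana_rot_zmap) (simp_all add: rot_zmap_nonzero)

lemma fam_0: "fam \<tau> N (0, x) = x"
proof -
  have "zmap \<tau> N 0 y = y" "rot 0 y = y" for y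
    by (simp_all add: zmap_def zsnd_def rot_def)
  then show ?thesis by (cases "x = 0") (simp_all add: fam_def, simp add: sgn_div_norm)
qed

text \<open>Up to the scalar function \<open>m\<close>, \<open>fam\<close> is the unnormalized map
  \<open>W\<close>, so the product rule changes the derivative only by a scalar factor and a
  multiple of the value.\<close>

lemma fam_derivative:
  assumes t: "0 \<le> t" "t \<le> 1" and x: "norm x = 1"
    and D: "((\<lambda>x. fam \<tau> N (t, x)) has_derivative D) (at x)"
  obtains c d where "c \<noteq> 0"
    "\<And>v. x \<bullet> v = 0 \<Longrightarrow> c *\<^sub>R D v = rot t (zmap' \<tau> N t x v) - d v *\<^sub>R fam \<tau> N (t, x)"
proof -
  let ?f = "\<lambda>y. fam \<tau> N (t, y)"
  define W where "W y = rot t (zmap \<tau> N t (sgn y))" for y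
  have x0: "x \<noteq> 0" "sgn x = x" using x by (auto simp: sgn_div_norm)
  have W0: "W x \<noteq> 0" unfolding W_def using rot_zmap_nonzero[OF t x0(1)] .
  have "(zmap \<tau> N t has_derivative zmap' \<tau> N t x) (at (sgn x))"
    unfolding x0 by (rule zmap_has_derivative)
  from bounded_linear.has_derivative[OF bounded_linear_rot has_derivative_compose[OF sgn_has_derivative[OF x] this]]
  have WD: "(W has_derivative (\<lambda>v. rot t (zmap' \<tau> N t x (v - (x \<bullet> v) *\<^sub>R x)))) (at x)"
    unfolding W_def .
  have anaW: "ana W x"
  proof -
    define h where "h p = rot (fst p) (zmap \<tau> N (fst p) (sgn (snd p)))" for p
    have "ana h (t, x)" unfolding h_def[abs_def] using ana_rot_zmap[of "(t, x)"] x0 by simp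
    from ana_compose[where f = h and g = "\<lambda>y. (t, y)", OF this ana_Pair[OF ana_const ana_ident]]
    show ?thesis by (simp add: W_def[abs_def] h_def)
  qed
  define m where "m y = norm (W y) * inverse (norm y)" for y
  have "ana m x"
    unfolding m_def by (intro ana_mult ana_norm anaW ana_inverse ana_ident) (use W0 x0 in auto)
  then obtain m' where m': "(m has_derivative m') (at x)"
    using ana_differentiable by (auto simp: differentiable_def)
  have "((\<lambda>y. m y *\<^sub>R ?f y) has_derivative (\<lambda>v. m x *\<^sub>R D v + m' v *\<^sub>R ?f x)) (at x)"
    by (rule has_derivative_scaleR[OF m' D])
  then have "(W has_derivative (\<lambda>v. m x *\<^sub>R D v + m' v *\<^sub>R ?f x)) (at x)"
  proof (rule has_derivative_transform_within_open[where s = "- {0}"])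
    fix y :: C2 assume "y \<in> - {0}"
    moreover have "norm (W y) *\<^sub>R sgn (W y) = W y" by (cases "W y = 0") (auto simp: sgn_div_norm)
    moreover have "?f y = norm y *\<^sub>R sgn (W y)" by (simp add: fam_def W_def)
    ultimately show "m y *\<^sub>R ?f y = W y" by (simp add: m_def mult.assoc)
  qed (use x0 in auto)
  with WD have "(\<lambda>v. rot t (zmap' \<tau> N t x (v - (x \<bullet> v) *\<^sub>R x))) = (\<lambda>v. m x *\<^sub>R D v + m' v *\<^sub>R ?f x)"
    by (rule has_derivative_unique)
  from fun_cong[OF this] have "m x *\<^sub>R D v = rot t (zmap' \<tau> N t x v) - m' v *\<^sub>R ?f x" if "x \<bullet> v = 0" for v
    using that by (metis add_diff_cancel_right' diff_zero scaleR_zero_left)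
  moreover have "m x \<noteq> 0" using W0 x by (simp add: m_def)
  ultimately show ?thesis using that by blast
qed

text \<open>Differentiating the preserved norm shows that a kernel vector is tangent to the sphere.
  By injectivity of \<open>rot t\<close> it then satisfies the hypothesis of
  \<open>zmap_immersion\<close>.\<close>

lemma fam_immersion:
  assumes t: "0 \<le> t" "t \<le> 1" and x: "norm x = 1"
    and D: "((\<lambda>x. fam \<tau> N (t, x)) has_derivative D) (at x)" and v: "D v = 0"
  shows "v = 0"
proof -
  let ?f = "\<lambda>y. fam \<tau> N (t, y)"
  have tang: "x \<bullet> v = 0"
  proof -
    have 1: "((\<lambda>y. ?f y \<bullet> ?f y) has_derivative (\<lambda>v. ?f x \<bullet> D v + D v \<bullet> ?f x)) (at x)"
      by (rule has_derivative_inner[OF D D])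
    have "(\<lambda>y. ?f y \<bullet> ?f y) = (\<lambda>y. y \<bullet> y)"
      using norm_fam[OF t] by (simp add: dot_square_norm)
    note 2 = 1[unfolded this]
    have 3: "((\<lambda>y. y \<bullet> y) has_derivative (\<lambda>v. x \<bullet> v + v \<bullet> x)) (at x)"
      by (rule has_derivative_inner[OF has_derivative_ident has_derivative_ident])
    have "(\<lambda>v. ?f x \<bullet> D v + D v \<bullet> ?f x) = (\<lambda>v. x \<bullet> v + v \<bullet> x)"
      by (rule has_derivative_unique[OF 2 3])
    from fun_cong[OF this, of v] v show ?thesis by (simp add: inner_commute)
  qed
  define w where "w = zmap \<tau> N t x"
  obtain c d where cd: "c \<noteq> 0" "\<And>v. x \<bullet> v = 0 \<Longrightarrow> c *\<^sub>R D v = rot t (zmap' \<tau> N t x v) - d v *\<^sub>R ?f x"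
    using fam_derivative[OF t x D] by metis
  have "sgn x = x" using x by (simp add: sgn_div_norm)
  then have "?f x = rot t (inverse (norm (rot t w)) *\<^sub>R w)"
    by (simp add: fam_def w_def x sgn_div_norm rot_scaleR)
  moreover have "rot t (zmap' \<tau> N t x v) = d v *\<^sub>R ?f x" using cd(2)[OF tang] v by simp
  ultimately have "zmap' \<tau> N t x v = (d v * inverse (norm (rot t w))) *\<^sub>R w"
    by (simp add: rot_scaleR[symmetric] rot_inject)
  moreover have "x \<in> S3" using x by (simp add: S3_eq_sphere)
  ultimately show ?thesis unfolding w_def using zmap_immersion[OF \<tau> N t _ tang] by blast
qed

end

section \<open>Second derivatives and the volume form in the frame\<close>

lemma det_4_expand:
  "det (A::'a::comm_ring_1^4^4) =
     A$1$1 * (A$2$2 * (A$3$3 * A$4$4 - A$3$4 * A$4$3) - A$2$3 * (A$3$2 * A$4$4 - A$3$4 * A$4$2) + A$2$4 * (A$3$2 * A$4$3 - A$3$3 * A$4$2))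
   - A$1$2 * (A$2$1 * (A$3$3 * A$4$4 - A$3$4 * A$4$3) - A$2$3 * (A$3$1 * A$4$4 - A$3$4 * A$4$1) + A$2$4 * (A$3$1 * A$4$3 - A$3$3 * A$4$1))
   + A$1$3 * (A$2$1 * (A$3$2 * A$4$4 - A$3$4 * A$4$2) - A$2$2 * (A$3$1 * A$4$4 - A$3$4 * A$4$1) + A$2$4 * (A$3$1 * A$4$2 - A$3$2 * A$4$1))
   - A$1$4 * (A$2$1 * (A$3$2 * A$4$3 - A$3$3 * A$4$2) - A$2$2 * (A$3$1 * A$4$3 - A$3$3 * A$4$1) + A$2$3 * (A$3$1 * A$4$2 - A$3$2 * A$4$1))"
proof -
  have f: "finite {2::4, 3, 4}" "1 \<notin> {2::4, 3, 4}" "finite {3::4, 4}" "2 \<notin> {3::4, 4}" "finite {4::4}" "3 \<notin> {4::4}"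
    by auto
  show ?thesis
    unfolding det_def UNIV_4
    unfolding sum_over_permutations_insert[OF f(1,2)]
    unfolding sum_over_permutations_insert[OF f(3,4)]
    unfolding sum_over_permutations_insert[OF f(5,6)]
    unfolding permutes_sing
    by (simp add: sign_swap_id permutation_swap_id sign_compose sign_id swap_id_eq permutation_compose algebra_simps)
qed

text \<open>Both sides are limits of one second difference over a small parallelogram, divided by
  \<open>h * h\<close>. Two applications of the mean value theorem in each component express it
  through a second derivative at an intermediate point.\<close>

lemma ana_symmetric_second_derivative:
  assumes "ana f a"
  shows "frechet_derivative (\<lambda>x. frechet_derivative f (at x) v) (at a) u
       = frechet_derivative (\<lambda>x. frechet_derivative f (at x) u) (at a) v"
proof -
  let ?D = "\<lambda>w x. frechet_derivative f (at x) w"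
  let ?DD = "\<lambda>w w' x. frechet_derivative (?D w) (at x) w'"
  obtain e where e: "0 < e" and an: "\<And>x. dist x a < e \<Longrightarrow> ana f x"
    using ana_eventually[OF assms] by (auto simp: eventually_nhds_metric)
  have d1: "(f has_derivative (\<lambda>w. ?D w x)) (at x)" if "ana f x" for x
    using ana_differentiable[OF that] frechet_derivative_works by blast
  have d2: "(?D w has_derivative (\<lambda>w'. ?DD w w' x)) (at x)" if "ana f x" for x w
    using ana_differentiable[OF ana_frechet_derivative[OF that]] frechet_derivative_works by blast
  have lim: "((\<lambda>x. ?DD w w' x) \<longlongrightarrow> ?DD w w' a) (nhds a)" for w w'
    using ana_isCont[OF ana_frechet_derivative[OF ana_frechet_derivative[OF assms]]]
    by (simp add: isCont_def tendsto_nhds_iff)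
  define K where "K = norm u + norm v + 1"
  have K: "0 < K" by (simp add: K_def add_nonneg_pos)
  have step: "\<exists>\<xi>. dist \<xi> a \<le> h * K \<and> ((f (a + h *\<^sub>R u + h *\<^sub>R v) - f (a + h *\<^sub>R u)) - (f (a + h *\<^sub>R v) - f a)) \<bullet> b = h * h * (?DD u v \<xi> \<bullet> b)"
    if h: "0 < h" "h * K < e" and K: "norm u + norm v \<le> K" for h u v b
  proof -
    have near: "ana f (a + s *\<^sub>R u + t *\<^sub>R v)" "dist (a + s *\<^sub>R u + t *\<^sub>R v) a \<le> h * K" if "0 \<le> s" "s \<le> h" "0 \<le> t" "t \<le> h" for s t
    proof -
      have "norm (s *\<^sub>R u + t *\<^sub>R v) \<le> h * norm u + h * norm v"
        by (rule order_trans[OF norm_triangle_ineq]) (use that in \<open>auto intro!: add_mono mult_right_mono\<close>)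
      also have "\<dots> \<le> h * K" using K h by (simp add: distrib_left[symmetric])
      finally show "dist (a + s *\<^sub>R u + t *\<^sub>R v) a \<le> h * K" by (simp add: dist_norm add.assoc)
      then show "ana f (a + s *\<^sub>R u + t *\<^sub>R v)" using h by (intro an) simp
    qed
    define \<phi> where "\<phi> s = (f (a + s *\<^sub>R u + h *\<^sub>R v) - f (a + s *\<^sub>R u)) \<bullet> b" for s
    have \<phi>': "(\<phi> has_real_derivative (?D u (a + s *\<^sub>R u + h *\<^sub>R v) - ?D u (a + s *\<^sub>R u)) \<bullet> b) (at s)" if s: "0 \<le> s" "s \<le> h" for s
    proof -
      have p: "((\<lambda>s. a + s *\<^sub>R u + c) has_derivative (\<lambda>k. k *\<^sub>R u)) (at s)" "((\<lambda>s. a + s *\<^sub>R u) has_derivative (\<lambda>k. k *\<^sub>R u)) (at s)" for c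
        by (auto intro!: derivative_eq_intros)
      have n: "ana f (a + s *\<^sub>R u + h *\<^sub>R v)" "ana f (a + s *\<^sub>R u)"
        using near(1)[of s h] near(1)[of s 0] s h by simp_all
      have "(\<phi> has_derivative (\<lambda>k. (?D (k *\<^sub>R u) (a + s *\<^sub>R u + h *\<^sub>R v) - ?D (k *\<^sub>R u) (a + s *\<^sub>R u)) \<bullet> b)) (at s)"
        unfolding \<phi>_def
        by (rule has_derivative_inner_left[OF has_derivative_diff[OF
              has_derivative_compose[OF p(1) d1[OF n(1)]] has_derivative_compose[OF p(2) d1[OF n(2)]]]])
      moreover have "?D (k *\<^sub>R u) x = k *\<^sub>R ?D u x" if "ana f x" for k x
        using linear_scale[OF has_derivative_linear[OF d1[OF that]]] by simp
      ultimately show ?thesis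
        using n by (simp add: has_field_derivative_def mult_commute_abs scaleR_diff_right[symmetric])
    qed
    from MVT2[OF h(1) \<phi>'] obtain s where s: "0 < s" "s < h" "\<phi> h - \<phi> 0 = (h - 0) * ((?D u (a + s *\<^sub>R u + h *\<^sub>R v) - ?D u (a + s *\<^sub>R u)) \<bullet> b)"
      by blast
    define \<psi> where "\<psi> t = ?D u (a + s *\<^sub>R u + t *\<^sub>R v) \<bullet> b" for t
    have \<psi>': "(\<psi> has_real_derivative ?DD u v (a + s *\<^sub>R u + t *\<^sub>R v) \<bullet> b) (at t)" if t: "0 \<le> t" "t \<le> h" for t
    proof -
      have p: "((\<lambda>t. a + s *\<^sub>R u + t *\<^sub>R v) has_derivative (\<lambda>k. k *\<^sub>R v)) (at t)"
        by (auto intro!: derivative_eq_intros)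
      have an': "ana f (a + s *\<^sub>R u + t *\<^sub>R v)" using near(1) s t by simp
      have "(\<psi> has_derivative (\<lambda>k. ?DD u (k *\<^sub>R v) (a + s *\<^sub>R u + t *\<^sub>R v) \<bullet> b)) (at t)"
        unfolding \<psi>_def by (rule has_derivative_inner_left[OF has_derivative_compose[OF p d2[OF an']]])
      moreover have "?DD u (k *\<^sub>R v) (a + s *\<^sub>R u + t *\<^sub>R v) = k *\<^sub>R ?DD u v (a + s *\<^sub>R u + t *\<^sub>R v)" for k
        using linear_scale[OF has_derivative_linear[OF d2[OF an']]] by simp
      ultimately show ?thesis by (simp add: has_field_derivative_def mult_commute_abs)
    qed
    from MVT2[OF h(1) \<psi>'] obtain t where t: "0 < t" "t < h" "\<psi> h - \<psi> 0 = (h - 0) * (?DD u v (a + s *\<^sub>R u + t *\<^sub>R v) \<bullet> b)"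
      by blast
    have "\<phi> h - \<phi> 0 = h * h * (?DD u v (a + s *\<^sub>R u + t *\<^sub>R v) \<bullet> b)"
      using s(3) t(3) by (simp add: \<psi>_def inner_diff_left)
    then show ?thesis using near(2)[of s t] s t
      by (intro exI[of _ "a + s *\<^sub>R u + t *\<^sub>R v"]) (simp add: \<phi>_def inner_diff_left)
  qed
  show ?thesis
  proof (rule euclidean_eqI)
    fix b :: 'b assume "b \<in> Basis"
    \<comment> \<open>A null sequence of side lengths for which the parallelograms stay in the ball
      where \<open>f\<close> is analytic.\<close>
    define h where "h n = e / (2 * K) / real (Suc n)" for n
    have h: "0 < h n" "h n * K < e" for n
    proof -
      show "0 < h n" using e K by (simp add: h_def)
      have "h n \<le> e / (2 * K)" using e K by (simp add: h_def divide_le_eq mult_ge1_I)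
      then have "h n * K \<le> e / 2" using K by (simp add: field_simps)
      then show "h n * K < e" using e by linarith
    qed
    have hlim: "(\<lambda>n. h n * K) \<longlonglongrightarrow> 0"
    proof -
      have "(\<lambda>n. e / 2 * inverse (real (Suc n))) \<longlonglongrightarrow> e / 2 * 0"
        by (intro tendsto_mult tendsto_const LIMSEQ_inverse_real_of_nat)
      moreover have "e / 2 * inverse (real (Suc n)) = h n * K" for n
      proof -
        have "e / (2 * K) * K = e / 2" using K by simp
        then show ?thesis unfolding h_def divide_inverse[of _ "real (Suc n)"] by (metis mult.assoc mult.commute)
      qed
      ultimately show ?thesis by (simp only: mult_zero_right)
    qed
    have "\<exists>\<xi> \<zeta>. dist \<xi> a \<le> h n * K \<and> dist \<zeta> a \<le> h n * K \<and> ?DD u v \<xi> \<bullet> b = ?DD v u \<zeta> \<bullet> b" for n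
    proof -
      obtain \<xi> where \<xi>: "dist \<xi> a \<le> h n * K" "((f (a + h n *\<^sub>R u + h n *\<^sub>R v) - f (a + h n *\<^sub>R u)) - (f (a + h n *\<^sub>R v) - f a)) \<bullet> b = h n * h n * (?DD u v \<xi> \<bullet> b)"
        using step[OF h, of u v n b] by (auto simp: K_def)
      obtain \<zeta> where \<zeta>: "dist \<zeta> a \<le> h n * K" "((f (a + h n *\<^sub>R v + h n *\<^sub>R u) - f (a + h n *\<^sub>R v)) - (f (a + h n *\<^sub>R u) - f a)) \<bullet> b = h n * h n * (?DD v u \<zeta> \<bullet> b)"
        using step[OF h, of v u n b] by (auto simp: K_def)
      have "(f (a + h n *\<^sub>R u + h n *\<^sub>R v) - f (a + h n *\<^sub>R u)) - (f (a + h n *\<^sub>R v) - f a)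
         = (f (a + h n *\<^sub>R v + h n *\<^sub>R u) - f (a + h n *\<^sub>R v)) - (f (a + h n *\<^sub>R u) - f a)"
        by (simp add: add_ac)
      with \<xi> \<zeta> h(1)[of n] show ?thesis by (intro exI[of _ \<xi>] exI[of _ \<zeta>]) auto
    qed
    then obtain \<xi> \<zeta> where x: "\<And>n. dist (\<xi> n) a \<le> h n * K" "\<And>n. dist (\<zeta> n) a \<le> h n * K"
      "\<And>n. ?DD u v (\<xi> n) \<bullet> b = ?DD v u (\<zeta> n) \<bullet> b" by metis
    have cvg: "s \<longlonglongrightarrow> a" if "\<And>n. dist (s n) a \<le> h n * K" for s :: "nat \<Rightarrow> 'a"
      by (subst tendsto_dist_iff, rule Lim_null_comparison[OF _ hlim]) (simp add: that)
    have "\<xi> \<longlonglongrightarrow> a" "\<zeta> \<longlonglongrightarrow> a"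
      using cvg x(1,2) by blast+
    have L: "(\<lambda>n. ?DD w w' (s n) \<bullet> b) \<longlonglongrightarrow> ?DD w w' a \<bullet> b" if "s \<longlonglongrightarrow> a" for s w w'
      by (rule tendsto_inner[OF filterlim_compose[OF lim that] tendsto_const])
    show "?DD v u a \<bullet> b = ?DD u v a \<bullet> b"
      by (rule LIMSEQ_unique[OF L[OF \<open>\<zeta> \<longlonglongrightarrow> a\<close>] L[OF \<open>\<xi> \<longlonglongrightarrow> a\<close>, of u v, unfolded x(3)]])
  qed
qed

lemma vector_4_nth:
  "(vector [a, b, c, d] :: ('a::zero)^4) $ 1 = a" "(vector [a, b, c, d] :: ('a::zero)^4) $ 2 = b"
  "(vector [a, b, c, d] :: ('a::zero)^4) $ 3 = c" "(vector [a, b, c, d] :: ('a::zero)^4) $ 4 = d"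
  by (simp_all add: vector_def)

text \<open>Contraction of the volume form with one frame field is the wedge of the other two; the
  positive cyclic order is \<open>J1\<close>, \<open>J2\<close>, \<open>J3\<close>.\<close>

lemma vol_S3_J2: "vol_S3 x (J2 x) v w = (J3 x \<bullet> v) * (J1 x \<bullet> w) - (J1 x \<bullet> v) * (J3 x \<bullet> w)"
  unfolding vol_S3_def det_4_expand coords_def vector_4_nth
  by (simp add: J1_def J2_def J3_def inner_prod_def inner_complex_def algebra_simps)

lemma vol_S3_J3: "vol_S3 x (J3 x) v w = (J1 x \<bullet> v) * (J2 x \<bullet> w) - (J2 x \<bullet> v) * (J1 x \<bullet> w)"
  unfolding vol_S3_def det_4_expand coords_def vector_4_nth
  by (simp add: J1_def J2_def J3_def inner_prod_def inner_complex_def algebra_simps)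

lemma vol_S3_linear: "vol_S3 x (a *\<^sub>R u + b *\<^sub>R u') v w = a * vol_S3 x u v w + b * vol_S3 x u' v w"
  unfolding vol_S3_def det_4_expand coords_def vector_4_nth
  by (simp add: algebra_simps)

lemma J_orthonormal:
  "x \<bullet> J1 x = 0" "x \<bullet> J2 x = 0" "x \<bullet> J3 x = 0" "J1 x \<bullet> J2 x = 0" "J1 x \<bullet> J3 x = 0" "J2 x \<bullet> J3 x = 0"
  "J1 x \<bullet> J1 x = x \<bullet> x" "J2 x \<bullet> J2 x = x \<bullet> x" "J3 x \<bullet> J3 x = x \<bullet> x"
  by (simp_all add: J1_def J2_def J3_def inner_prod_def inner_complex_def algebra_simps)

lemma J_frame:
  assumes "x \<bullet> x = 1"
  shows "v = (x \<bullet> v) *\<^sub>R x + (J1 x \<bullet> v) *\<^sub>R J1 x + (J2 x \<bullet> v) *\<^sub>R J2 x + (J3 x \<bullet> v) *\<^sub>R J3 x"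
proof -
  have "(x \<bullet> x) *\<^sub>R v = (x \<bullet> v) *\<^sub>R x + (J1 x \<bullet> v) *\<^sub>R J1 x + (J2 x \<bullet> v) *\<^sub>R J2 x + (J3 x \<bullet> v) *\<^sub>R J3 x"
    by (simp add: J1_def J2_def J3_def inner_prod_def inner_complex_def prod_eq_iff complex_eq_iff algebra_simps)
  then show ?thesis using assms by simp
qed

lemma ana_frechet_derivative_field:
  assumes "ana f a" "ana h a" shows "ana (\<lambda>x. frechet_derivative f (at x) (h x)) a"
proof (rule ana_cong)
  show "ana (\<lambda>x. \<Sum>b\<in>Basis. (h x \<bullet> b) *\<^sub>R frechet_derivative f (at x) b) a"
    by (intro ana_sum ana_scaleR ana_inner assms ana_const ana_frechet_derivative)
  show "eventually (\<lambda>x. (\<Sum>b\<in>Basis. (h x \<bullet> b) *\<^sub>R frechet_derivative f (at x) b) = frechet_derivative f (at x) (h x)) (nhds a)"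
    using ana_eventually[OF assms(1)]
  proof eventually_elim
    case (elim x)
    then have "(f has_derivative frechet_derivative f (at x)) (at x)"
      using ana_differentiable frechet_derivative_works by blast
    then have lin: "linear (frechet_derivative f (at x))" by (rule has_derivative_linear)
    have "frechet_derivative f (at x) (h x) = frechet_derivative f (at x) (\<Sum>b\<in>Basis. (h x \<bullet> b) *\<^sub>R b)"
      by (simp add: euclidean_representation)
    then show ?case by (simp add: linear_sum[OF lin] linear_scale[OF lin])
  qed
qed

section \<open>The Legendrian field\<close>

text \<open>In the application \<open>\<psi>\<close> is the end of the isotopy. Its inverse is
  extended to the 0-homogeneous map \<open>\<phi>\<close>, so that pulled back forms can be
  differentiated in the ambient space.\<close>

locale legendrian_conjugation =
  fixes \<psi> \<phi> :: "C2 \<Rightarrow> C2" and p q :: real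
  assumes pq: "0 < p" "0 < q"
    and ana_\<psi>: "\<And>x. norm x = 1 \<Longrightarrow> ana \<psi> x"
    and ana_\<phi>: "\<And>y. y \<noteq> 0 \<Longrightarrow> ana \<phi> y"
    and norm_\<psi>: "\<And>x. norm x = 1 \<Longrightarrow> norm (\<psi> x) = 1"
    and norm_\<phi>: "\<And>y. y \<noteq> 0 \<Longrightarrow> norm (\<phi> y) = 1"
    and \<phi>_\<psi>: "\<And>x. norm x = 1 \<Longrightarrow> \<phi> (\<psi> x) = x"
    and \<psi>_\<phi>: "\<And>y. norm y = 1 \<Longrightarrow> \<psi> (\<phi> y) = y"
    and \<phi>_sgn: "\<And>y. \<phi> (sgn y) = \<phi> y"
    and leg: "\<And>x. norm x = 1 \<Longrightarrow>
      contact_form (\<psi> x) (frechet_derivative \<psi> (at x) (\<i> * p * fst x, \<i> * q * snd x)) = 0"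
begin

definition Rf :: "C2 \<Rightarrow> C2" where "Rf z = (\<i> * p * fst z, \<i> * q * snd z)"

definition Om :: "C2 \<Rightarrow> C2 \<Rightarrow> real" where
  "Om a b = p * (J1 (0, snd a) \<bullet> (0, snd b)) + q * (J1 (fst a, 0) \<bullet> (fst b, 0))"

definition E :: "C2 \<Rightarrow> C2 \<Rightarrow> C2" where "E y v = frechet_derivative \<phi> (at y) v"

definition om :: "C2 \<Rightarrow> C2 \<Rightarrow> C2 \<Rightarrow> real" where "om y v w = Om (E y v) (E y w)"

text \<open>The coefficients are those of \<open>om\<close> in the frame. There is no
  \<open>J1\<close> term because \<open>om\<close> vanishes on the pair \<open>J2\<close>,
  \<open>J3\<close>.\<close>

definition X :: "C2 \<Rightarrow> C2" where
  "X y = om y (J3 y) (J1 y) *\<^sub>R J2 y + om y (J1 y) (J2 y) *\<^sub>R J3 y"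

definition V :: "C2 \<Rightarrow> C2" where "V y = frechet_derivative \<psi> (at (\<phi> y)) (Rf (\<phi> y))"

lemma Om_expand: "Om a b = p * (Re (snd a) * Im (snd b) - Im (snd a) * Re (snd b)) + q * (Re (fst a) * Im (fst b) - Im (fst a) * Re (fst b))"
  by (simp add: Om_def J1_def inner_prod_def inner_complex_def algebra_simps)

lemma Om_bounded_bilinear: "bounded_bilinear Om"
  unfolding bilinear_conv_bounded_bilinear[symmetric] bilinear_def linear_iff
  by (simp add: Om_expand algebra_simps)

lemma Om_antisym: "Om a b = - Om b a" by (simp add: Om_expand algebra_simps)

text \<open>Tangent vectors at \<open>z\<close> are orthogonal to \<open>z\<close>, so the Seifert
  field lies in the kernel of \<open>Om\<close> on the sphere.\<close>

lemma Om_Rf: "Om (Rf z) b = - (p * q) * (z \<bullet> b)"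
  by (simp add: Om_expand Rf_def inner_prod_def inner_complex_def algebra_simps)

lemma E_has_derivative: "y \<noteq> 0 \<Longrightarrow> (\<phi> has_derivative E y) (at y)"
proof -
  assume "y \<noteq> 0"
  moreover have "E y = frechet_derivative \<phi> (at y)" by (rule ext) (simp add: E_def)
  ultimately show ?thesis using ana_differentiable[OF ana_\<phi>] frechet_derivative_works by metis
qed

lemma linear_E: "y \<noteq> 0 \<Longrightarrow> linear (E y)"
  using E_has_derivative has_derivative_linear by blast

lemma ana_E: "y \<noteq> 0 \<Longrightarrow> ana (\<lambda>y. E y v) y"
  unfolding E_def by (intro ana_frechet_derivative ana_\<phi>)

text \<open>The derivative of a 0-homogeneous map is homogeneous of degree -1.\<close>

lemma E_scale:
  assumes "y \<noteq> 0" "0 < c" shows "E (c *\<^sub>R y) (c *\<^sub>R v) = E y v"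
proof -
  have "\<phi> (c *\<^sub>R y) = \<phi> y" for y
    using \<phi>_sgn[of "c *\<^sub>R y"] \<phi>_sgn[of y] assms(2) by (simp add: sgn_scaleR)
  moreover have "((\<lambda>y. \<phi> (c *\<^sub>R y)) has_derivative (\<lambda>v. E (c *\<^sub>R y) (c *\<^sub>R v))) (at y)"
    by (rule has_derivative_compose[where f = "\<lambda>y. c *\<^sub>R y"]) (use assms E_has_derivative in \<open>auto intro!: derivative_eq_intros\<close>)
  ultimately have "(\<phi> has_derivative (\<lambda>v. E (c *\<^sub>R y) (c *\<^sub>R v))) (at y)" by simp
  from has_derivative_unique[OF this E_has_derivative[OF assms(1)]] show ?thesis by metis
qed

lemma E_sgn: "y \<noteq> 0 \<Longrightarrow> E (sgn y) v = norm y *\<^sub>R E y v"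
  using E_scale[of y "inverse (norm y)" "norm y *\<^sub>R v"] linear_scale[OF linear_E, of y "norm y" v]
  by (simp add: sgn_div_norm)

lemma E_radial: assumes "y \<noteq> 0" shows "E y y = 0"
proof -
  have "((\<lambda>s. \<phi> (exp s *\<^sub>R y)) has_derivative (\<lambda>s. E y (s *\<^sub>R y))) (at 0)"
    by (rule has_derivative_compose[where f = "\<lambda>s. exp s *\<^sub>R y"]) (use E_has_derivative assms in \<open>auto intro!: derivative_eq_intros\<close>)
  moreover have "\<phi> (exp s *\<^sub>R y) = \<phi> y" for s :: real
    using \<phi>_sgn[of "exp s *\<^sub>R y"] \<phi>_sgn[of y] by (simp add: sgn_scaleR)
  ultimately have "((\<lambda>s. \<phi> y) has_derivative (\<lambda>s. E y (s *\<^sub>R y))) (at 0)" by simp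
  from has_derivative_unique[OF this has_derivative_const] show ?thesis by (metis scaleR_one)
qed

lemma \<phi>_E_orth: assumes "y \<noteq> 0" shows "\<phi> y \<bullet> E y v = 0"
proof -
  have 1: "((\<lambda>y. \<phi> y \<bullet> \<phi> y) has_derivative (\<lambda>v. \<phi> y \<bullet> E y v + E y v \<bullet> \<phi> y)) (at y)"
    by (rule has_derivative_inner[OF E_has_derivative[OF assms] E_has_derivative[OF assms]])
  have "((\<lambda>y. \<phi> y \<bullet> \<phi> y) has_derivative (\<lambda>v. 0)) (at y)"
    by (rule has_derivative_transform_within_open[OF has_derivative_const[of 1], where s = "- {0}"])
      (use assms norm_\<phi> in \<open>auto simp: dot_square_norm\<close>)
  from fun_cong[OF has_derivative_unique[OF 1 this], of v] show ?thesis by (simp add: inner_commute)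
qed

lemma \<psi>_has_derivative: "norm x = 1 \<Longrightarrow> (\<psi> has_derivative frechet_derivative \<psi> (at x)) (at x)"
  using ana_differentiable[OF ana_\<psi>] frechet_derivative_works by blast

text \<open>The relation between \<open>\<phi>\<close> and \<open>\<psi>\<close> is known only on
  the sphere. It is differentiated after composition with \<open>sgn\<close>, whose derivative fixes
  tangent vectors.\<close>

lemma tangential_derivatives:
  assumes x: "norm x = 1" and v: "x \<bullet> v = 0"
  shows "E (\<psi> x) (frechet_derivative \<psi> (at x) v) = v" "\<psi> x \<bullet> frechet_derivative \<psi> (at x) v = 0"
proof -
  have x0: "x \<noteq> 0" "sgn x = x" using x by (auto simp: sgn_div_norm)
  have \<psi>0: "\<psi> x \<noteq> 0" using norm_\<psi>[OF x] by auto
  let ?P = "\<lambda>v. frechet_derivative \<psi> (at x) (v - (x \<bullet> v) *\<^sub>R x)"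
  have P: "((\<lambda>y. \<psi> (sgn y)) has_derivative ?P) (at x)"
    by (rule has_derivative_compose[OF sgn_has_derivative[OF x]]) (use \<psi>_has_derivative[OF x] x0 in simp)
  have 1: "((\<lambda>y. \<phi> (\<psi> (sgn y))) has_derivative (\<lambda>v. E (\<psi> x) (?P v))) (at x)"
    by (rule has_derivative_compose[OF P]) (use E_has_derivative[OF \<psi>0] x0 in simp)
  have 2: "((\<lambda>y. \<phi> (\<psi> (sgn y))) has_derivative (\<lambda>v. v - (x \<bullet> v) *\<^sub>R x)) (at x)"
    by (rule has_derivative_transform_within_open[OF sgn_has_derivative[OF x], where s = "- {0}"])
      (use x0 \<phi>_\<psi> in \<open>auto simp: norm_sgn\<close>)
  from fun_cong[OF has_derivative_unique[OF 1 2], of v] v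
  show "E (\<psi> x) (frechet_derivative \<psi> (at x) v) = v" by simp
  have 3: "((\<lambda>y. \<psi> (sgn y) \<bullet> \<psi> (sgn y)) has_derivative (\<lambda>v. \<psi> (sgn x) \<bullet> ?P v + ?P v \<bullet> \<psi> (sgn x))) (at x)"
    by (rule has_derivative_inner[OF P P])
  have 4: "((\<lambda>y. \<psi> (sgn y) \<bullet> \<psi> (sgn y)) has_derivative (\<lambda>v. 0)) (at x)"
    by (rule has_derivative_transform_within_open[OF has_derivative_const[of 1], where s = "- {0}"])
      (use x0 norm_\<psi> in \<open>auto simp: dot_square_norm norm_sgn\<close>)
  from fun_cong[OF has_derivative_unique[OF 3 4], of v] v x0
  show "\<psi> x \<bullet> frechet_derivative \<psi> (at x) v = 0" by (simp add: inner_commute)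
qed

lemma Rf_tangent: "z \<bullet> Rf z = 0"
  by (simp add: Rf_def inner_prod_def inner_complex_def)

lemma Rf_nonzero: assumes "norm z = 1" shows "Rf z \<noteq> 0"
proof
  assume "Rf z = 0"
  then have "z = 0" using pq by (simp add: Rf_def prod_eq_iff)
  with assms show False by simp
qed

lemma V_props:
  assumes y: "norm y = 1"
  shows "E y (V y) = Rf (\<phi> y)" "y \<bullet> V y = 0" "J1 y \<bullet> V y = 0" "V y \<noteq> 0"
proof -
  have y0: "y \<noteq> 0" using y by auto
  have z: "norm (\<phi> y) = 1" "\<psi> (\<phi> y) = y" using norm_\<phi>[OF y0] \<psi>_\<phi>[OF y] by auto
  show 1: "E y (V y) = Rf (\<phi> y)" "y \<bullet> V y = 0"
    using tangential_derivatives[OF z(1) Rf_tangent] by (simp_all add: V_def z)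
  show "J1 y \<bullet> V y = 0"
    using leg[OF z(1)] by (simp add: V_def Rf_def z contact_form_eq)
  show "V y \<noteq> 0"
  proof
    assume "V y = 0"
    then have "Rf (\<phi> y) = 0" using 1(1) linear_0[OF linear_E[OF y0]] by simp
    then show False using Rf_nonzero[OF z(1)] by simp
  qed
qed

lemma om_bilinear:
  assumes "y \<noteq> 0"
  shows "om y (a *\<^sub>R u + b *\<^sub>R v) w = a * om y u w + b * om y v w" "om y v v = 0" "om y v w = - om y w v"
proof -
  show "om y (a *\<^sub>R u + b *\<^sub>R v) w = a * om y u w + b * om y v w"
    by (simp add: om_def linear_add[OF linear_E[OF assms]] linear_scale[OF linear_E[OF assms]] Om_expand algebra_simps)
  show "om y v w = - om y w v" by (simp add: om_def Om_antisym[of "E y v"])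
  show "om y v v = 0" by (simp add: om_def Om_expand)
qed

lemma om_V: assumes "norm y = 1" shows "om y (V y) w = 0"
proof -
  have "y \<noteq> 0" using assms by auto
  then show ?thesis using V_props(1)[OF assms] by (simp add: om_def Om_Rf \<phi>_E_orth)
qed

lemma V_frame:
  assumes "norm y = 1" shows "V y = (J2 y \<bullet> V y) *\<^sub>R J2 y + (J3 y \<bullet> V y) *\<^sub>R J3 y"
  using J_frame[of y "V y"] V_props[OF assms] assms by (simp add: dot_square_norm)

text \<open>The Legendrian condition enters here: \<open>V y\<close> is a nonzero vector in the span
  of \<open>J2 y\<close> and \<open>J3 y\<close>, and it lies in the kernel of \<open>om y\<close>.
  A 2-form on a plane with a nonzero kernel vector is 0.\<close>

lemma om_J2_J3: assumes y: "norm y = 1" shows "om y (J2 y) (J3 y) = 0"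
proof -
  have y0: "y \<noteq> 0" using y by auto
  define a b where "a = J2 y \<bullet> V y" and "b = J3 y \<bullet> V y"
  have Vab: "V y = a *\<^sub>R J2 y + b *\<^sub>R J3 y" unfolding a_def b_def by (rule V_frame[OF y])
  have "a * om y (J2 y) (J3 y) = 0"
    using om_V[OF y, of "J3 y"] by (simp add: Vab om_bilinear(1,2)[OF y0])
  moreover have "b * om y (J3 y) (J2 y) = 0"
    using om_V[OF y, of "J2 y"] by (simp add: Vab om_bilinear(1,2)[OF y0])
  moreover have "a \<noteq> 0 \<or> b \<noteq> 0" using V_props(4)[OF y] Vab by auto
  ultimately show ?thesis using om_bilinear(3)[OF y0, of "J2 y" "J3 y"] by auto
qed

lemma vol_X: assumes y: "norm y = 1" shows "vol_S3 y (X y) v w = om y v w"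
proof -
  have y0: "y \<noteq> 0" and yy: "y \<bullet> y = 1" using y by (auto simp: dot_square_norm)
  define n m where "n = om y (J1 y) (J2 y)" and "m = om y (J3 y) (J1 y)"
  have frame: "E y v = (J1 y \<bullet> v) *\<^sub>R E y (J1 y) + (J2 y \<bullet> v) *\<^sub>R E y (J2 y) + (J3 y \<bullet> v) *\<^sub>R E y (J3 y)" for v
  proof -
    have "E y v = E y ((y \<bullet> v) *\<^sub>R y + (J1 y \<bullet> v) *\<^sub>R J1 y + (J2 y \<bullet> v) *\<^sub>R J2 y + (J3 y \<bullet> v) *\<^sub>R J3 y)"
      by (rule arg_cong[OF J_frame[OF yy]])
    then show ?thesis
      by (simp only: linear_add[OF linear_E[OF y0]] linear_scale[OF linear_E[OF y0]] E_radial[OF y0] scaleR_zero_right add_0_left)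
  qed
  have rel: "Om (E y (J1 y)) (E y (J2 y)) = n" "Om (E y (J3 y)) (E y (J1 y)) = m" "Om (E y (J2 y)) (E y (J3 y)) = 0"
    using om_J2_J3[OF y] by (simp_all add: n_def m_def om_def)
  have rel': "Om (E y (J2 y)) (E y (J1 y)) = - n" "Om (E y (J1 y)) (E y (J3 y)) = - m" "Om (E y (J3 y)) (E y (J2 y)) = 0"
    using rel Om_antisym[of "E y (J2 y)" "E y (J1 y)"] Om_antisym[of "E y (J1 y)" "E y (J3 y)"]
      Om_antisym[of "E y (J3 y)" "E y (J2 y)"] by simp_all
  have self: "Om a a = 0" for a by (simp add: Om_expand)
  interpret Om: bounded_bilinear Om by (rule Om_bounded_bilinear)
  have "om y v w = ((J3 y \<bullet> v) * (J1 y \<bullet> w) - (J1 y \<bullet> v) * (J3 y \<bullet> w)) * m + ((J1 y \<bullet> v) * (J2 y \<bullet> w) - (J2 y \<bullet> v) * (J1 y \<bullet> w)) * n"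
    unfolding om_def frame[of v] frame[of w] Om.add_left Om.add_right Om.scaleR_left Om.scaleR_right rel rel' self
    by (simp add: algebra_simps)
  then show ?thesis
    by (simp add: X_def vol_S3_linear vol_S3_J2 vol_S3_J3 n_def m_def algebra_simps)
qed

text \<open>Where \<open>X\<close> vanishes, so does \<open>om\<close>, hence also \<open>Om\<close>
  on the tangent space at \<open>z = \<phi> y\<close>; but \<open>Om (J2 z) (J3 z)\<close> is
  positive.\<close>

lemma X_nonzero: assumes y: "norm y = 1" shows "X y \<noteq> 0"
proof
  assume "X y = 0"
  have y0: "y \<noteq> 0" using y by auto
  from \<open>X y = 0\<close> have om0: "om y v w = 0" for v w
    using vol_X[OF y, of v w] vol_S3_linear[of y 0 0 0 0] by simp
  define z where "z = \<phi> y"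
  have z: "norm z = 1" "\<psi> z = y" using norm_\<phi>[OF y0] \<psi>_\<phi>[OF y] by (auto simp: z_def)
  have "E y (frechet_derivative \<psi> (at z) (J2 z)) = J2 z" "E y (frechet_derivative \<psi> (at z) (J3 z)) = J3 z"
    using tangential_derivatives(1)[OF z(1)] J_orthonormal by (auto simp: z)
  then have "Om (J2 z) (J3 z) = 0" using om0 by (metis om_def)
  moreover have "Om (J2 z) (J3 z) = p * (cmod (fst z))\<^sup>2 + q * (cmod (snd z))\<^sup>2"
    by (simp add: Om_expand J2_def J3_def cmod_power2) (simp add: power2_eq_square)
  ultimately have "fst z = 0 \<and> snd z = 0" using pq by (simp add: add_nonneg_eq_0_iff)
  then have "z = 0" by (simp add: prod_eq_iff)
  then show False using z by simp
qed

text \<open>The ratio of \<open>X\<close> to \<open>V\<close>, computed after pulling back by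
  \<open>\<phi>\<close> as a projection onto the Seifert field, which makes its continuity
  visible.\<close>

definition speed :: "C2 \<Rightarrow> real" where "speed y = (E y (X y) \<bullet> Rf (\<phi> y)) / (Rf (\<phi> y) \<bullet> Rf (\<phi> y))"

text \<open>\<open>X y\<close> and \<open>V y\<close> both lie in the span of \<open>J2 y\<close>
  and \<open>J3 y\<close>, and \<open>om y (V y) (J1 y) = 0\<close> is the vanishing of their
  determinant there.\<close>

lemma X_eq_speed: assumes y: "norm y = 1" shows "X y = speed y *\<^sub>R V y" "E y (X y) = speed y *\<^sub>R Rf (\<phi> y)" "speed y \<noteq> 0"
proof -
  have y0: "y \<noteq> 0" using y by auto
  define a b where "a = J2 y \<bullet> V y" and "b = J3 y \<bullet> V y"
  have Vab: "V y = a *\<^sub>R J2 y + b *\<^sub>R J3 y" unfolding a_def b_def by (rule V_frame[OF y])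
  define n m where "n = om y (J1 y) (J2 y)" and "m = om y (J3 y) (J1 y)"
  have X: "X y = m *\<^sub>R J2 y + n *\<^sub>R J3 y" by (simp add: X_def n_def m_def)
  have "om y (V y) (J1 y) = 0" by (rule om_V[OF y])
  then have rel: "b * m = a * n"
    by (simp add: Vab om_bilinear(1)[OF y0] om_bilinear(3)[OF y0, of "J2 y" "J1 y"] n_def m_def)
  have ab: "a\<^sup>2 + b\<^sup>2 \<noteq> 0" using V_props(4)[OF y] Vab by (auto simp: sum_power2_eq_zero_iff)
  define f where "f = (m * a + n * b) / (a\<^sup>2 + b\<^sup>2)"
  have "f * a = m" "f * b = n"
  proof -
    have "(m * a + n * b) * a = m * (a\<^sup>2 + b\<^sup>2)" "(m * a + n * b) * b = n * (a\<^sup>2 + b\<^sup>2)"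
      using rel by (simp_all add: power2_eq_square algebra_simps)
    then show "f * a = m" "f * b = n" using ab by (simp_all add: f_def)
  qed
  then have Xf: "X y = f *\<^sub>R V y" unfolding X Vab by (simp add: scaleR_add_right)
  have Ef: "E y (X y) = f *\<^sub>R Rf (\<phi> y)"
    unfolding Xf linear_scale[OF linear_E[OF y0]] V_props(1)[OF y] ..
  have "Rf (\<phi> y) \<noteq> 0" by (rule Rf_nonzero[OF norm_\<phi>[OF y0]])
  then have "speed y = f" by (simp add: speed_def Ef)
  with Xf Ef show "X y = speed y *\<^sub>R V y" "E y (X y) = speed y *\<^sub>R Rf (\<phi> y)" by auto
  then show "speed y \<noteq> 0" using X_nonzero[OF y] by auto
qed

lemma ana_X: "y \<noteq> 0 \<Longrightarrow> ana X y"
  unfolding X_def[abs_def] om_def E_def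
  by (intro ana_add ana_scaleR ana_bounded_bilinear[OF Om_bounded_bilinear] ana_frechet_derivative_field ana_\<phi>
      ana_bounded_linear bounded_linear_J)

lemma ana_Rf: "ana Rf y"
  unfolding Rf_def[abs_def] by (intro ana_Pair ana_mult ana_const ana_fst ana_snd ana_ident)

lemma isCont_speed: assumes "norm y = 1" shows "isCont speed y"
proof -
  have y0: "y \<noteq> 0" using assms by auto
  have "isCont (\<lambda>y. Rf (\<phi> y)) y" by (intro ana_isCont ana_compose[OF ana_Rf] ana_\<phi> y0)
  moreover have "isCont (\<lambda>y. E y (X y)) y" unfolding E_def by (intro ana_isCont ana_frechet_derivative_field ana_\<phi> ana_X y0)
  moreover have "Rf (\<phi> y) \<noteq> 0" by (rule Rf_nonzero[OF norm_\<phi>[OF y0]])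
  ultimately show ?thesis unfolding speed_def[abs_def] by (intro continuous_intros) auto
qed

lemma X_tangent: "y \<bullet> X y = 0" "contact_form y (X y) = 0"
  by (simp_all add: X_def contact_form_eq inner_add_right J_orthonormal)

text \<open>By homogeneity the contraction extends off the origin as
  \<open>(y \<bullet> y) * om y v w\<close>. The derivative of the first factor vanishes on tangent
  vectors. What is left is the exterior derivative of the pullback of a constant 2-form, whose terms
  cancel in pairs by symmetry of second derivatives.\<close>

lemma X_divergence: "has_divergence X (\<lambda>_. 0)"
  unfolding has_divergence_def
proof (intro ballI)
  fix x u v w assume x: "x \<in> S3" and T: "u \<in> T_S3 x" "v \<in> T_S3 x" "w \<in> T_S3 x"
  have nx: "norm x = 1" and x0: "x \<noteq> 0" using x by (auto simp: S3_eq_sphere)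
  interpret Om: bounded_bilinear Om by (rule Om_bounded_bilinear)
  define DD where "DD v u = frechet_derivative (\<lambda>y. E y v) (at x) u" for v u
  have sym: "DD v u = DD u v" for u v
    unfolding DD_def E_def by (rule ana_symmetric_second_derivative[OF ana_\<phi>[OF x0]])
  have dE: "((\<lambda>y. E y v) has_derivative DD v) (at x)" for v
  proof -
    have "DD v = frechet_derivative (\<lambda>y. E y v) (at x)" by (rule ext) (simp add: DD_def)
    then show ?thesis using ana_differentiable[OF ana_E[OF x0]] frechet_derivative_works by metis
  qed
  have D: "frechet_derivative (\<lambda>y. interior_vol X (sgn y) v w) (at x) u = Om (E x v) (DD w u) + Om (DD v u) (E x w)"
    if "u \<in> T_S3 x" for u v w
  proof -
    have "((\<lambda>y. (y \<bullet> y) * Om (E y v) (E y w)) has_derivative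
       (\<lambda>u. (x \<bullet> x) * (Om (E x v) (DD w u) + Om (DD v u) (E x w)) + (x \<bullet> u + u \<bullet> x) * Om (E x v) (E x w))) (at x)"
      by (intro has_derivative_mult has_derivative_inner has_derivative_ident Om.FDERIV dE)
    then have "((\<lambda>y. interior_vol X (sgn y) v w) has_derivative
       (\<lambda>u. (x \<bullet> x) * (Om (E x v) (DD w u) + Om (DD v u) (E x w)) + (x \<bullet> u + u \<bullet> x) * Om (E x v) (E x w))) (at x)"
    proof (rule has_derivative_transform_within_open[where s = "- {0}"])
      fix y :: C2 assume "y \<in> - {0}"
      then have y: "y \<noteq> 0" "norm (sgn y) = 1" by (auto simp: norm_sgn)
      show "(y \<bullet> y) * Om (E y v) (E y w) = interior_vol X (sgn y) v w"
        unfolding interior_vol_def vol_X[OF y(2)] om_def E_sgn[OF y(1)] Om.scaleR_left Om.scaleR_right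
        by (simp add: dot_square_norm power2_eq_square)
    qed (use x0 in auto)
    from frechet_derivative_at[OF this, symmetric] that show ?thesis
      using nx by (simp add: T_S3_def dot_square_norm inner_commute)
  qed
  show "ext_deriv_S3 (interior_vol X) x u v w = 0 * vol_S3 x u v w"
    unfolding ext_deriv_S3_def D[OF T(1)] D[OF T(2)] D[OF T(3)]
    using sym[of u v] sym[of u w] sym[of v w] Om_antisym[of "E x v" "DD w u"] by simp
qed

end

section \<open>Antiderivatives and changes of time\<close>

lemma continuous_antiderivative:
  fixes f :: "real \<Rightarrow> real"
  assumes "\<And>x. isCont f x"
  obtains F where "F 0 = 0" "\<And>x. (F has_real_derivative f x) (at x)"
proof (rule that[of "\<lambda>u. LBINT y=ereal 0..ereal u. f y"])
  show "(LBINT y=ereal 0..ereal 0. f y) = 0" by simp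
  fix x :: real
  \<comment> \<open>The interval contains both 0 and \<open>x\<close> in its interior, so the
    derivative within it is the full one.\<close>
  define b where "b = \<bar>x\<bar> + 1"
  have "((\<lambda>u. LBINT y=ereal 0..ereal u. f y) has_vector_derivative f x) (at x within {-b..b})"
    by (rule interval_integral_FTC2) (use assms in \<open>auto simp: b_def intro!: continuous_at_imp_continuous_on\<close>)
  moreover have "at x within {-b..b} = at x"
    by (rule at_within_interior) (auto simp: b_def)
  ultimately show "((\<lambda>u. LBINT y=ereal 0..ereal u. f y) has_real_derivative f x) (at x)"
    by (simp add: has_real_derivative_iff_has_vector_derivative)
qed

text \<open>Separation of variables: \<open>h\<close> is the inverse of an antiderivative
  \<open>T\<close> of \<open>1 / g\<close>. The upper bound on \<open>g\<close> makes
  \<open>T\<close> unbounded in both directions, so \<open>h\<close> is defined for all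
  times.\<close>

lemma time_change_pos:
  fixes g :: "real \<Rightarrow> real"
  assumes cont: "\<And>x. isCont g x" and pos: "\<And>x. 0 < g x" and bd: "\<And>x. g x \<le> B"
  obtains h where "h 0 = 0" "surj h" "\<And>s. (h has_real_derivative g (h s)) (at s)"
proof -
  have B: "0 < B" using pos[of 0] bd[of 0] by linarith
  have "isCont (\<lambda>x. 1 / g x) x" for x
    using pos[of x] by (intro continuous_intros cont) auto
  then obtain T where T0: "T 0 = 0" and T: "\<And>x. (T has_real_derivative 1 / g x) (at x)"
    using continuous_antiderivative[of "\<lambda>x. 1 / g x"] by blast
  have grow: "(y - x) / B \<le> T y - T x" if "x < y" for x y
  proof -
    obtain z where "T y - T x = (y - x) * (1 / g z)"
      using MVT2[of x y T "\<lambda>x. 1 / g x", OF \<open>x < y\<close> T] by auto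
    moreover have "1 / B \<le> 1 / g z" using pos[of z] bd[of z] by (intro divide_left_mono) auto
    ultimately show ?thesis using that by (simp add: mult_left_mono[of "1 / B" "1 / g z" "y - x"] divide_inverse)
  qed
  have mono: "T x < T y" if "x < y" for x y
    using grow[OF that] divide_pos_pos[of "y - x" B] that B by linarith
  have inj: "inj T" using mono by (metis injI less_irrefl linorder_less_linear)
  have contT: "isCont T x" for x using T DERIV_isCont by blast
  have "\<exists>x. T x = s" for s
  proof -
    \<comment> \<open>\<open>T\<close> grows at least at the rate \<open>1 / B\<close>, so an
      interval of this length suffices to pass \<open>\<bar>s\<bar>\<close>.\<close>
    define a where "a = (\<bar>s\<bar> + 1) * B"
    have a: "0 < a" using B by (simp add: a_def)
    have "a / B = \<bar>s\<bar> + 1" using B by (simp add: a_def)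
    then have "s \<le> T a" "T (- a) \<le> s" using grow[of 0 a] grow[of "-a" 0] a T0 by auto
    then show ?thesis using IVT[of T "-a" s a] contT a by auto
  qed
  then have surj: "surj T" by (metis surjI)
  define h where "h = inv T"
  have hT: "h (T x) = x" and Th: "T (h s) = s" for x s
    by (simp_all add: h_def inj surj_f_inv_f[OF surj])
  have conth: "isCont h s" for s
    using isCont_inverse_function[of 1 "h s" h T] hT contT Th by simp
  show ?thesis
  proof
    show "h 0 = 0" using hT[of 0] T0 by simp
    show "surj h" using hT by (metis surjI)
    fix s
    have "(h has_real_derivative inverse (1 / g (h s))) (at s)"
      by (rule DERIV_inverse_function[where f = T and a = "s - 1" and b = "s + 1"]) (use T pos[of "h s"] Th conth in auto)
    then show "(h has_real_derivative g (h s)) (at s)" by simp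
  qed
qed

text \<open>A continuous function without zeros has constant sign, and reversing time reduces the
  negative case to the positive one.\<close>

lemma time_change:
  fixes g :: "real \<Rightarrow> real"
  assumes cont: "\<And>x. isCont g x" and nz: "\<And>x. g x \<noteq> 0" and bd: "\<And>x. \<bar>g x\<bar> \<le> B"
  obtains h where "h 0 = 0" "surj h" "\<And>s. (h has_real_derivative g (h s)) (at s)"
proof (cases "\<forall>x. 0 < g x")
  case True
  show ?thesis
  proof (rule time_change_pos[of g B])
    show "g x \<le> B" for x using bd[of x] by linarith
  qed (use True cont that in auto)
next
  case False
  have neg: "0 < - g x" for x
  proof (rule ccontr)
    assume "\<not> 0 < - g x"
    then have x: "0 < g x" using nz[of x] by linarith
    obtain y where "g y < 0" using False nz by (metis linorder_neqE_linordered_idom)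
    then have "\<exists>z. g z = 0"
      using IVT[of g y 0 x] IVT2[of g y 0 x] x cont by (cases "x \<le> y") (auto simp: less_imp_le)
    then show False using nz by blast
  qed
  show ?thesis
  proof (rule time_change_pos[of "\<lambda>x. - g x" B])
    show "- g x \<le> B" for x using bd[of x] by linarith
    fix h :: "real \<Rightarrow> real" assume h: "h 0 = 0" "surj h" "\<And>s. (h has_real_derivative - g (h s)) (at s)"
    show thesis
    proof (rule that[of "\<lambda>s. h (- s)"])
      show "surj (\<lambda>s. h (- s))" using h(2) by (metis surj_def minus_minus)
      fix s
      show "((\<lambda>s. h (- s)) has_real_derivative g (h (- s))) (at s)"
        using DERIV_chain2[where f = h and g = uminus and x = s, OF h(3) DERIV_minus[OF DERIV_ident]] by simp
    qed (use h in simp)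
  qed (use neg cont in auto)
qed

section \<open>Leaves of the Seifert foliation and of the field\<close>

lemma seifert_leaf_eq_range:
  "seifert_leaf p q z = range (\<lambda>a. (fst z * cis (of_int p * a), snd z * cis (of_int q * a)))"
proof -
  have "(fst z * cis (p * a), snd z * cis (q * a)) \<in> seifert_leaf p q z" for a :: real
  proof -
    \<comment> \<open>The number of full turns in \<open>a\<close>; removing them does not move the
      point, since \<open>p\<close> and \<open>q\<close> are integers.\<close>
    define n where "n = \<lfloor>a / (2 * pi)\<rfloor>"
    define b where "b = a - 2 * pi * n"
    have "n \<le> a / (2 * pi)" "a / (2 * pi) < n + 1" by (simp_all add: n_def)
    then have "b \<in> {0..<2 * pi}" by (auto simp: b_def field_simps)
    moreover have "cis (m * a) = cis (m * b)" for m :: int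
    proof -
      have "m * a = m * b + 2 * pi * of_int (m * n)" by (simp add: b_def algebra_simps)
      then show ?thesis by (simp only: cis_mult[symmetric] cis_multiple_2pi[OF Ints_of_int] mult_1_right)
    qed
    ultimately show ?thesis unfolding seifert_leaf_def by auto
  qed
  then show ?thesis by (auto simp: seifert_leaf_def)
qed

context legendrian_conjugation
begin

definition seifert_flow :: "real \<Rightarrow> C2 \<Rightarrow> C2" where
  "seifert_flow a z = (fst z * cis (p * a), snd z * cis (q * a))"

lemma norm_seifert_flow: "norm (seifert_flow a z) = norm z"
  by (simp add: seifert_flow_def norm_Pair norm_mult norm_prod_def)

lemma seifert_flow_0: "seifert_flow 0 z = z"
  by (simp add: seifert_flow_def)

lemma seifert_flow_inverse: "seifert_flow a (seifert_flow (- a) z) = z"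
  by (simp add: seifert_flow_def mult.assoc cis_mult)

text \<open>The flow commutes with its generator \<open>Rf\<close>, so a change of the flow time can
  be recorded as a multiple of \<open>Rf\<close> before the flow is applied.\<close>

lemma seifert_flow_derivative:
  assumes \<eta>: "(\<eta> has_vector_derivative v) (at s)" and f: "(f has_real_derivative d) (at s)"
  shows "((\<lambda>s. seifert_flow (f s) (\<eta> s)) has_vector_derivative seifert_flow (f s) (v + d *\<^sub>R Rf (\<eta> s))) (at s)"
proof -
  have \<eta>': "(\<eta> has_derivative (\<lambda>h. h *\<^sub>R v)) (at s)" using \<eta> by (simp add: has_vector_derivative_def)
  have f': "(f has_derivative (\<lambda>h. h * d)) (at s)"
    using f by (simp add: has_field_derivative_def mult_commute_abs)
  show ?thesis
    unfolding has_vector_derivative_def seifert_flow_def Rf_def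
    by (rule derivative_eq_intros \<eta>' f' refl)+
      (auto simp: fun_eq_iff scaleR_conv_of_real algebra_simps)
qed

lemma isCont_seifert_flow: "isCont (\<lambda>a. seifert_flow a z) a"
  using seifert_flow_derivative[OF has_vector_derivative_const DERIV_ident]
    has_vector_derivative_continuous by blast

text \<open>With \<open>F\<close> the integral of the speed along the curve, the Seifert flow for
  time \<open>- F\<close> applied to the curve pulled back by \<open>\<phi>\<close> has derivative
  0. The pulled back curve therefore stays on the circle of \<open>z\<close>.\<close>

lemma integral_curve_in_leaf:
  assumes z: "norm z = 1" and \<gamma>: "\<gamma> 0 = \<psi> z"
    "\<And>s. norm (\<gamma> s) = 1" "\<And>s. (\<gamma> has_vector_derivative X (\<gamma> s)) (at s)"
  shows "\<exists>a. \<gamma> t = \<psi> (seifert_flow a z)"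
proof -
  have \<gamma>0: "\<gamma> s \<noteq> 0" for s using \<gamma>(2)[of s] by auto
  have "isCont (\<lambda>s. speed (\<gamma> s)) s" for s
    using isCont_o2[OF has_vector_derivative_continuous[OF \<gamma>(3)] isCont_speed[OF \<gamma>(2)]] .
  then obtain F where F: "F 0 = 0" "\<And>s. (F has_real_derivative speed (\<gamma> s)) (at s)"
    using continuous_antiderivative[of "\<lambda>s. speed (\<gamma> s)"] by blast
  have \<eta>: "((\<lambda>s. \<phi> (\<gamma> s)) has_vector_derivative speed (\<gamma> s) *\<^sub>R Rf (\<phi> (\<gamma> s))) (at s)" for s
    using has_derivative_compose[OF \<gamma>(3)[unfolded has_vector_derivative_def] E_has_derivative[OF \<gamma>0]]
    by (simp add: has_vector_derivative_def linear_scale[OF linear_E[OF \<gamma>0]] X_eq_speed(2)[OF \<gamma>(2)])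
  have "((\<lambda>s. seifert_flow (- F s) (\<phi> (\<gamma> s))) has_vector_derivative 0) (at s)" for s
    using seifert_flow_derivative[OF \<eta> DERIV_minus[OF F(2)], of s] by (simp add: seifert_flow_def zero_prod_def)
  then obtain c where c: "\<And>s. seifert_flow (- F s) (\<phi> (\<gamma> s)) = c"
    using has_vector_derivative_zero_constant[of UNIV "\<lambda>s. seifert_flow (- F s) (\<phi> (\<gamma> s))"] by auto
  have "c = z" using c[of 0] by (simp add: F(1) \<gamma>(1) \<phi>_\<psi>[OF z] seifert_flow_0)
  then have "\<phi> (\<gamma> t) = seifert_flow (F t) z" using c[of t] seifert_flow_inverse by metis
  then show ?thesis using \<psi>_\<phi>[OF \<gamma>(2)] by metis
qed

text \<open>The circle is traversed with a time change \<open>h\<close> solving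
  \<open>h' = g (h)\<close>, where \<open>g\<close> is the speed along it. Compactness bounds the
  speed, and surjectivity of \<open>h\<close> gives the whole leaf.\<close>

lemma leaf_integral_curve:
  assumes z: "norm z = 1"
  obtains \<gamma> where "\<gamma> 0 = \<psi> z" "\<And>s. norm (\<gamma> s) = 1" "\<And>s. (\<gamma> has_vector_derivative X (\<gamma> s)) (at s)"
    "range (\<lambda>a. \<psi> (seifert_flow a z)) = range \<gamma>"
proof -
  define y where "y a = seifert_flow a z" for a
  have y: "norm (y a) = 1" for a by (simp add: y_def norm_seifert_flow z)
  have \<psi>y: "norm (\<psi> (y a)) = 1" for a by (rule norm_\<psi>[OF y])
  define g where "g a = speed (\<psi> (y a))" for a
  have "isCont (\<lambda>a. \<psi> (y a)) a" for a
    unfolding y_def by (rule isCont_o2[OF isCont_seifert_flow ana_isCont[OF ana_\<psi>]]) (simp add: norm_seifert_flow z)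
  then have contg: "isCont g a" for a
    unfolding g_def by (rule isCont_o2[where g = speed]) (auto intro: isCont_speed \<psi>y)
  have "compact (speed ` sphere 0 1)"
    by (intro compact_continuous_image continuous_at_imp_continuous_on ballI isCont_speed compact_sphere) auto
  then obtain B where B: "\<And>w. norm w = 1 \<Longrightarrow> \<bar>speed w\<bar> \<le> B"
    using compact_imp_bounded bounded_iff by (metis imageI mem_sphere_0 real_norm_def)
  obtain h where h: "h 0 = 0" "surj h" "\<And>s. (h has_real_derivative g (h s)) (at s)"
    by (rule time_change[of g B]) (use contg X_eq_speed(3)[OF \<psi>y] B[OF \<psi>y] in \<open>auto simp: g_def\<close>)
  show ?thesis
  proof
    show "\<psi> (y (h 0)) = \<psi> z" by (simp add: h y_def seifert_flow_0)
    show "norm (\<psi> (y (h s))) = 1" for s by (rule \<psi>y)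
    show "range (\<lambda>a. \<psi> (seifert_flow a z)) = range (\<lambda>s. \<psi> (y (h s)))"
      using image_image[of "\<lambda>a. \<psi> (y a)" h UNIV] h(2) by (simp add: y_def)
    fix s
    have "((\<lambda>s. y (h s)) has_vector_derivative seifert_flow (h s) (0 + g (h s) *\<^sub>R Rf z)) (at s)"
      unfolding y_def by (rule seifert_flow_derivative[OF has_vector_derivative_const h(3)])
    also have "seifert_flow (h s) (0 + g (h s) *\<^sub>R Rf z) = g (h s) *\<^sub>R Rf (y (h s))"
      by (simp add: seifert_flow_def Rf_def y_def mult_ac)
    finally have "((\<lambda>s. y (h s)) has_vector_derivative g (h s) *\<^sub>R Rf (y (h s))) (at s)" .
    from has_derivative_compose[OF this[unfolded has_vector_derivative_def] \<psi>_has_derivative[OF y]]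
    have "((\<lambda>s. \<psi> (y (h s))) has_vector_derivative g (h s) *\<^sub>R frechet_derivative \<psi> (at (y (h s))) (Rf (y (h s)))) (at s)"
      by (simp add: has_vector_derivative_def linear_scale[OF has_derivative_linear[OF \<psi>_has_derivative[OF y]]])
    also have "g (h s) *\<^sub>R frechet_derivative \<psi> (at (y (h s))) (Rf (y (h s))) = X (\<psi> (y (h s)))"
      by (simp add: X_eq_speed(1)[OF \<psi>y] g_def V_def \<phi>_\<psi>[OF y])
    finally show "((\<lambda>s. \<psi> (y (h s))) has_vector_derivative X (\<psi> (y (h s)))) (at s)" .
  qed
qed

lemma field_leaf_X:
  assumes z: "norm z = 1" shows "field_leaf X (\<psi> z) = \<psi> ` range (\<lambda>a. seifert_flow a z)"
proof
  show "field_leaf X (\<psi> z) \<subseteq> \<psi> ` range (\<lambda>a. seifert_flow a z)"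
  proof
    fix w assume "w \<in> field_leaf X (\<psi> z)"
    then obtain \<gamma> t where w: "w = \<gamma> t" and \<gamma>: "\<gamma> 0 = \<psi> z" "\<And>s. norm (\<gamma> s) = 1"
        "\<And>s. (\<gamma> has_vector_derivative X (\<gamma> s)) (at s)"
      by (auto simp: field_leaf_def S3_eq_sphere)
    show "w \<in> \<psi> ` range (\<lambda>a. seifert_flow a z)"
      using integral_curve_in_leaf[OF z \<gamma>, of t] w by auto
  qed
  show "\<psi> ` range (\<lambda>a. seifert_flow a z) \<subseteq> field_leaf X (\<psi> z)"
  proof (rule leaf_integral_curve[OF z])
    fix \<gamma> assume \<gamma>: "\<gamma> 0 = \<psi> z" "\<And>s. norm (\<gamma> s) = 1" "\<And>s. (\<gamma> has_vector_derivative X (\<gamma> s)) (at s)"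
      "range (\<lambda>a. \<psi> (seifert_flow a z)) = range \<gamma>"
    have "range \<gamma> \<subseteq> field_leaf X (\<psi> z)" unfolding field_leaf_def S3_eq_sphere using \<gamma>(1-3) by auto
    then show ?thesis using \<gamma>(4) by (simp add: image_image)
  qed
qed

end

section \<open>The isotopy and the proof of the theorem\<close>

lemma smooth_map_cong:
  assumes "smooth_map S f" "\<And>x. x \<in> S \<Longrightarrow> f x = g x" shows "smooth_map S g"
  using assms unfolding smooth_map_def by fastforce

context
  fixes \<tau> :: real and N :: nat
  assumes \<tau>: "- (1/3) < \<tau>" "\<tau> < 1" and N: "6400 \<le> N * winding_gap \<tau>"
begin

lemma ana_fam_slice: assumes "0 \<le> t" "t \<le> 1" "x \<noteq> 0" shows "ana (\<lambda>x. fam \<tau> N (t, x)) x"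
  by (rule ana_compose[where f = "fam \<tau> N" and g = "\<lambda>x. (t, x)", OF ana_fam[OF \<tau> N assms] ana_Pair[OF ana_const ana_ident]])

lemma fam_bij_inverse:
  assumes t: "0 \<le> t" "t \<le> 1"
  shows "bij_betw (\<lambda>x. fam \<tau> N (t, x)) S3 S3"
    and "y \<noteq> 0 \<Longrightarrow> ana (\<lambda>y. inv_into S3 (\<lambda>x. fam \<tau> N (t, x)) (sgn y)) y"
proof -
  have 1: "ana (fam \<tau> N) (t, x)" if "0 \<le> t" "t \<le> 1" "norm x = 1" for t x
    by (rule ana_fam[OF \<tau> N that(1,2)]) (use that(3) in auto)
  have dim: "2 \<le> DIM(C2)" by simp
  note * = isotopy_of_immersions[of "fam \<tau> N", OF dim 1 norm_fam[OF \<tau> N] fam_immersion[OF \<tau> N] fam_0[OF \<tau> N] t]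
  show "bij_betw (\<lambda>x. fam \<tau> N (t, x)) S3 S3" unfolding S3_eq_sphere by (rule *(1))
  show "y \<noteq> 0 \<Longrightarrow> ana (\<lambda>y. inv_into S3 (\<lambda>x. fam \<tau> N (t, x)) (sgn y)) y"
    unfolding S3_eq_sphere by (rule *(2))
qed

lemma diffeo_fam: assumes t: "0 \<le> t" "t \<le> 1" shows "diffeo_S3 (\<lambda>x. fam \<tau> N (t, x))"
  unfolding diffeo_S3_def
proof (intro conjI)
  show "bij_betw (\<lambda>x. fam \<tau> N (t, x)) S3 S3" by (rule fam_bij_inverse(1)[OF t])
  show "smooth_map S3 (\<lambda>x. fam \<tau> N (t, x))"
    by (rule ana_imp_smooth_map, rule ana_fam_slice[OF t]) (auto simp: S3_eq_sphere)
  have "smooth_map S3 (\<lambda>y. inv_into S3 (\<lambda>x. fam \<tau> N (t, x)) (sgn y))"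
    by (rule ana_imp_smooth_map, rule fam_bij_inverse(2)[OF t]) (auto simp: S3_eq_sphere)
  then show "smooth_map S3 (inv_into S3 (\<lambda>x. fam \<tau> N (t, x)))"
    by (rule smooth_map_cong) (simp add: S3_eq_sphere sgn_div_norm)
qed

lemma isotopic_fam: "isotopic_to_id (\<lambda>x. fam \<tau> N (1, x))"
  unfolding isotopic_to_id_def
proof (rule exI[of _ "\<lambda>t x. fam \<tau> N (t, x)"], intro conjI ballI)
  have "ana (fam \<tau> N) p" if "p \<in> {0..1} \<times> S3" for p
  proof -
    obtain t x where p: "p = (t, x)" by (cases p)
    have t: "0 \<le> t" "t \<le> 1" and x: "norm x = 1" using that by (simp_all only: p S3_eq_sphere mem_Sigma_iff atLeastAtMost_iff mem_sphere_0)
    have "x \<noteq> 0" using x by auto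
    then show ?thesis unfolding p by (rule ana_fam[OF \<tau> N t])
  qed
  then show "smooth_map ({0..1} \<times> S3) (\<lambda>(t, x). fam \<tau> N (t, x))"
    by (simp add: ana_imp_smooth_map)
qed (auto intro: diffeo_fam simp: fam_0[OF \<tau> N])

lemma legendrian_conjugation_fam:
  fixes p q :: real
  assumes pq: "0 < p" "0 < q" "p - q = \<tau> * (p + 3 * q)"
  shows "legendrian_conjugation (\<lambda>x. fam \<tau> N (1, x)) (\<lambda>y. inv_into S3 (\<lambda>x. fam \<tau> N (1, x)) (sgn y)) p q"
proof -
  let ?\<psi> = "\<lambda>x. fam \<tau> N (1, x)"
  have bij: "bij_betw ?\<psi> S3 S3" using fam_bij_inverse(1)[of 1] by simp
  show ?thesis
  proof
    show "ana ?\<psi> x" if "norm x = 1" for x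
      using ana_fam_slice[of 1 x] that by fastforce
    show "norm (?\<psi> x) = 1" if "norm x = 1" for x using norm_fam[OF \<tau> N, of 1 x] that by simp
    show "norm (inv_into S3 ?\<psi> (sgn y)) = 1" if "y \<noteq> 0" for y
    proof -
      have "sgn y \<in> ?\<psi> ` S3" using bij that by (simp add: bij_betw_def) (simp add: S3_eq_sphere norm_sgn)
      from inv_into_into[OF this] show ?thesis by (simp add: S3_eq_sphere)
    qed
    show "inv_into S3 ?\<psi> (sgn (?\<psi> x)) = x" if "norm x = 1" for x
      using bij_betw_inv_into_left[OF bij, of x] norm_fam[OF \<tau> N, of 1 x] that by (simp add: S3_eq_sphere sgn_div_norm)
    show "?\<psi> (inv_into S3 ?\<psi> (sgn y)) = y" if "norm y = 1" for y
      using bij_betw_inv_into_right[OF bij, of y] that by (simp add: S3_eq_sphere sgn_div_norm)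
    fix x :: C2 assume x: "norm x = 1"
    define v where "v = (\<i> * p * fst x, \<i> * q * snd x)"
    have x0: "x \<noteq> 0" and xS: "x \<in> S3" and sx: "sgn x = x" using x by (auto simp: S3_eq_sphere sgn_div_norm)
    have D: "(?\<psi> has_derivative frechet_derivative ?\<psi> (at x)) (at x)"
      using ana_differentiable[OF ana_fam_slice[of 1 x]] x0 frechet_derivative_works by fastforce
    obtain c d where c: "c \<noteq> 0"
      and cd: "\<And>v. x \<bullet> v = 0 \<Longrightarrow> c *\<^sub>R frechet_derivative ?\<psi> (at x) v = rot 1 (zmap' \<tau> N 1 x v) - d v *\<^sub>R ?\<psi> x"
      using fam_derivative[OF \<tau> N _ _ x D] by auto
    have "x \<bullet> v = 0" by (simp add: v_def inner_prod_def inner_complex_def)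
    note cd = cd[OF this]
    have \<psi>: "?\<psi> x = rot 1 (inverse (norm (rot 1 (zmap \<tau> N 1 x))) *\<^sub>R zmap \<tau> N 1 x)"
      by (simp add: fam_def sx x sgn_div_norm rot_scaleR)
    \<comment> \<open>The form is bilinear and alternating, so the normalization and the multiple of
      the value in the derivative do not affect its vanishing.\<close>
    have lin: "contact_form y (a *\<^sub>R w) = a * contact_form y w" "contact_form (a *\<^sub>R y) w = a * contact_form y w"
      "contact_form y (w - w') = contact_form y w - contact_form y w'" "contact_form y y = 0" for a y w w'
      by (simp_all add: contact_form_def algebra_simps)
    have "contact_form (rot 1 (zmap \<tau> N 1 x)) (rot 1 (zmap' \<tau> N 1 x v)) = 0"
      unfolding contact_form_rot using zmap_legendrian[OF xS pq(3), of N] by (simp add: v_def)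
    then have "contact_form (?\<psi> x) (rot 1 (zmap' \<tau> N 1 x v)) = 0"
      unfolding \<psi> rot_scaleR by (simp add: lin)
    then have "contact_form (?\<psi> x) (c *\<^sub>R frechet_derivative ?\<psi> (at x) v) = 0"
      unfolding cd by (simp add: lin)
    then show "contact_form (?\<psi> x) (frechet_derivative ?\<psi> (at x) (\<i> * p * fst x, \<i> * q * snd x)) = 0"
      using c by (simp add: lin v_def)
  next
    show "inv_into S3 ?\<psi> (sgn (sgn y)) = inv_into S3 ?\<psi> (sgn y)" for y :: C2
      by (cases "y = 0") (simp_all add: sgn_div_norm[of "sgn y"] norm_sgn)
  qed (use pq fam_bij_inverse(2)[of 1] in auto)
qed

end

theorem proposition1p5:
  fixes p q :: int
  assumes "p \<ge> 1" and "q \<ge> 1" and "gcd p q = 1"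
  shows "\<exists>X :: C2 \<Rightarrow> C2.
           tangent_field X \<and>
           (\<forall>x\<in>S3. X x \<noteq> 0) \<and>
           real_analytic_map S3 X \<and>
           has_divergence X (\<lambda>_. 0) \<and>
           legendrian_field X \<and>
           isotopic_foliations (seifert_foliation p q) (field_foliation X)"
proof -
  define \<tau> :: real where "\<tau> = (p - q) / (p + 3 * q)"
  have pq: "1 \<le> real_of_int p" "1 \<le> real_of_int q" using assms by simp_all
  \<comment> \<open>After clearing denominators the two bounds read \<open>4 * p > 0\<close> and
    \<open>4 * q > 0\<close>.\<close>
  have \<tau>: "- (1/3) < \<tau>" "\<tau> < 1" using pq by (simp_all add: \<tau>_def field_simps)
  have eq: "real_of_int p - real_of_int q = \<tau> * (real_of_int p + 3 * real_of_int q)"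
    using pq by (simp add: \<tau>_def)
  \<comment> \<open>The gap is positive on this range of \<open>\<tau>\<close>, so the archimedean
    property supplies the exponent.\<close>
  obtain N :: nat where "6400 < N * winding_gap \<tau>"
    using reals_Archimedean3[OF winding_gap_pos[OF \<tau>]] by blast
  then have N: "6400 \<le> N * winding_gap \<tau>" by simp
  define \<psi> where "\<psi> x = fam \<tau> N (1, x)" for x
  interpret legendrian_conjugation \<psi> "\<lambda>y. inv_into S3 \<psi> (sgn y)" p q
    unfolding \<psi>_def using pq by (intro legendrian_conjugation_fam \<tau> N eq) auto
  have bij: "\<psi> ` S3 = S3"
    using fam_bij_inverse(1)[OF \<tau> N, of 1] by (simp add: bij_betw_def \<psi>_def[abs_def])
  have leaf: "\<psi> ` seifert_leaf p q z = field_leaf X (\<psi> z)" if "z \<in> S3" for z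
    using field_leaf_X[of z] that by (simp add: S3_eq_sphere seifert_leaf_eq_range seifert_flow_def)
  have "(\<lambda>L. \<psi> ` L) ` seifert_foliation p q = (\<lambda>z. field_leaf X (\<psi> z)) ` S3"
    unfolding seifert_foliation_def image_image using leaf by (rule image_cong[OF refl])
  \<comment> \<open>Every point of the sphere is of the form \<open>\<psi> z\<close>, so no leaf of
    the field is missed.\<close>
  also have "\<dots> = field_foliation X"
    unfolding field_foliation_def by (subst (2) bij[symmetric]) (simp add: image_image)
  finally have "isotopic_foliations (seifert_foliation p q) (field_foliation X)"
    unfolding isotopic_foliations_def
    using diffeo_fam[OF \<tau> N, of 1] isotopic_fam[OF \<tau> N] by (auto simp: \<psi>_def[abs_def])
  moreover have "tangent_field X" using X_tangent(1) by (simp add: tangent_field_def T_S3_def)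
  moreover have "legendrian_field X"
    using X_tangent \<open>tangent_field X\<close> by (simp add: legendrian_field_def)
  moreover have "real_analytic_map S3 X"
    by (rule ana_imp_real_analytic_map, rule ana_X) (auto simp: S3_eq_sphere)
  moreover have "\<forall>x\<in>S3. X x \<noteq> 0" using X_nonzero by (simp add: S3_eq_sphere)
  ultimately show ?thesis using X_divergence by blast
qed

end
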